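(* Let $\Delta\subset\mathbb{R}^n$ be a root system, $\Pi=\{\alpha_1,\dots,\alpha_n\}\subset\Delta$ a system of simple roots, $\{\alpha_1^*,\dots,\alpha_n^*\}$ the dual basis, $W=W(\Delta)$ the associated reflection group, and $C(\Pi)=\{\lambda\in\mathbb{R}^n\mid(\lambda,\alpha)\ge 0\ \text{for all }\alpha\in\Pi\}=\{\sum_{j=1}^n t_j\alpha_j^*\mid t_j\ge 0\}$. Let $a_1,\dots,a_n>1$, let $A$ be the linear map with $A\alpha_j^*=a_j\alpha_j^*$ for $j=1,\dots,n$, and let $B=A^T$, $\mathcal{D}_1=\{B^k\mid k\in\mathbb{Z}\}$ and $\mathcal{D}=\mathcal{D}_1W=\{B^kw\mid k\in\mathbb{Z},\,w\in W\}$. Let $\Gamma=G\mathbb{Z}^n$ with $G\in\mathrm{GL}(n,\mathbb{R})$ and $\det G=1$. Then there exists a $(\mathcal{D},\Gamma)$-wavelet set $\Omega\subset C(\Pi)$.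
   Context: $(\cdot,\cdot)$ is the standard inner product on $\mathbb{R}^n$. For $\alpha\neq0$ let $r_\alpha(\lambda)=\lambda-\frac{2(\lambda,\alpha)}{(\alpha,\alpha)}\alpha$. A root system in $\mathbb{R}^n$ is a finite set $\Delta$ of nonzero vectors which spans $\mathbb{R}^n$, such that $\Delta\cap\mathbb{R}\alpha=\{\alpha,-\alpha\}$ for all $\alpha\in\Delta$, and $r_\alpha(\beta)\in\Delta$ for all $\alpha,\beta\in\Delta$. $W(\Delta)\subset\mathrm{O}(n)$ is the (finite) group generated by the $r_\alpha$, $\alpha\in\Delta$. A simple system $\Pi\subset\Delta$ is a basis of $\mathbb{R}^n$ such that every element of $\Delta$ is a linear combination of elements of $\Pi$ with all coefficients of the same sign. The dual basis is defined by $(\alpha_i,\alpha_j^* )=\delta_{ij}$. The Fourier transform is $\mathcal{F}(f)(\lambda)=\int_{\mathbb{R}^n}f(x)e^{-2\pi i(x,\lambda)}\,dx$, extended to $L^2(\mathbb{R}^n)$. For countable sets $\mathcal{D}\subset\mathrm{GL}(n,\mathbb{R})$ and $\mathcal{T}\subset\mathbb{R}^n$, a $(\mathcal{D},\mathcal{T})$-wavelet is a function $\psi\in L^2(\mathbb{R}^n)$ such that $\{|\det d|^{1/2}\psi(dx+t)\mid d\in\mathcal{D},\,t\in\mathcal{T}\}$ is an orthonormal basis of $L^2(\mathbb{R}^n)$. A measurable set $\Omega\subset\mathbb{R}^n$ is a $(\mathcal{D},\mathcal{T})$-wavelet set if the function $\psi$ with $\mathcal{F}(\psi)=\chi_\Omega$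 is a $(\mathcal{D},\mathcal{T})$-wavelet. *)

theory Defs
  imports "HOL-Analysis.Analysis" "HOL-Algebra.Generated_Groups"
begin

definition GL :: "(real^'n^'n) monoid" where
  "GL = \<lparr>carrier = {M. invertible M}, mult = (**), one = mat 1\<rparr>"

lemma group_GL: "group (GL :: (real^'n^'n) monoid)"
proof (rule groupI)
  fix x :: "real^'n^'n"
  assume "x \<in> carrier GL"
  then obtain y where "x ** y = mat 1" "y ** x = mat 1"
    unfolding GL_def invertible_def by auto
  then show "\<exists>y\<in>carrier GL. y \<otimes>\<^bsub>GL\<^esub> x = \<one>\<^bsub>GL\<^esub>"
    unfolding GL_def invertible_def by auto
next
  show "\<one>\<^bsub>GL\<^esub> \<in> carrier (GL :: (real^'n^'n) monoid)"
    unfolding GL_def invertible_def by (auto intro: exI[of _ "mat 1"])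
qed (auto simp: GL_def invertible_mult matrix_mul_assoc)


section \<open>Root systems\<close>

definition reflection :: "real^'n \<Rightarrow> real^'n \<Rightarrow> real^'n" where
  "reflection \<alpha> v = v - (2 * (v \<bullet> \<alpha>) / (\<alpha> \<bullet> \<alpha>)) *\<^sub>R \<alpha>"

definition root_system :: "(real^'n) set \<Rightarrow> bool" where
  "root_system \<Delta> \<longleftrightarrow>
     finite \<Delta> \<and> 0 \<notin> \<Delta> \<and> span \<Delta> = UNIV \<and>
     (\<forall>\<alpha>\<in>\<Delta>. \<Delta> \<inter> range (\<lambda>c. c *\<^sub>R \<alpha>) = {\<alpha>, - \<alpha>}) \<and>
     (\<forall>\<alpha>\<in>\<Delta>. \<forall>\<beta>\<in>\<Delta>. reflection \<alpha> \<beta> \<in> \<Delta>)"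

definition weyl_group :: "(real^'n) set \<Rightarrow> (real^'n^'n) set" where
  "weyl_group \<Delta> = generate GL ((\<lambda>\<alpha>. matrix (reflection \<alpha>)) ` \<Delta>)"

definition simple_system :: "(real^'n) set \<Rightarrow> (real^'n) set \<Rightarrow> bool" where
  "simple_system \<Delta> S \<longleftrightarrow>
     S \<subseteq> \<Delta> \<and> independent S \<and> span S = UNIV \<and>
     (\<forall>\<beta>\<in>\<Delta>. \<exists>c. \<beta> = (\<Sum>\<gamma>\<in>S. c \<gamma> *\<^sub>R \<gamma>) \<and>
        ((\<forall>\<gamma>\<in>S. c \<gamma> \<ge> 0) \<or> (\<forall>\<gamma>\<in>S. c \<gamma> \<le> 0)))"

definition dual_basis :: "('n \<Rightarrow> real^'n) \<Rightarrow> ('n \<Rightarrow> real^'n) \<Rightarrow> bool" where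
  "dual_basis \<alpha> \<alpha>' \<longleftrightarrow> (\<forall>i j. \<alpha> i \<bullet> \<alpha>' j = (if i = j then 1 else 0))"

definition chamber :: "(real^'n) set \<Rightarrow> (real^'n) set" where
  "chamber S = {v. \<forall>\<alpha>\<in>S. v \<bullet> \<alpha> \<ge> 0}"

lemma chamber_eq_dual_cone:
  fixes \<alpha> \<alpha>' :: "'n \<Rightarrow> real^'n"
  assumes "simple_system \<Delta> S" "bij_betw \<alpha> UNIV S" "dual_basis \<alpha> \<alpha>'"
  shows "chamber S = {\<Sum>j\<in>UNIV. t j *\<^sub>R \<alpha>' j | t. \<forall>j. t j \<ge> 0}"
proof -
  have S: "S = range \<alpha>" using assms(2) by (simp add: bij_betw_def)
  have coord: "(\<Sum>j\<in>UNIV. t j *\<^sub>R \<alpha>' j) \<bullet> \<alpha> i = t i" for t i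
  proof -
    have "(\<Sum>j\<in>UNIV. t j *\<^sub>R \<alpha>' j) \<bullet> \<alpha> i = (\<Sum>j\<in>UNIV. t j * (\<alpha> i \<bullet> \<alpha>' j))"
      by (subst inner_commute) (simp add: inner_sum_right)
    also have "\<dots> = (\<Sum>j\<in>UNIV. if i = j then t j else 0)"
      using assms(3) by (intro sum.cong) (auto simp: dual_basis_def)
    finally show ?thesis by simp
  qed
  have expand: "v = (\<Sum>j\<in>UNIV. (v \<bullet> \<alpha> j) *\<^sub>R \<alpha>' j)" for v
  proof -
    define w where "w = v - (\<Sum>j\<in>UNIV. (v \<bullet> \<alpha> j) *\<^sub>R \<alpha>' j)"
    have "orthogonal w x" if "x \<in> S" for x
      using that coord by (auto simp: S w_def orthogonal_def inner_diff_left)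
    then have "orthogonal w w"
      using assms(1) orthogonal_to_span[of w S w] by (auto simp: simple_system_def)
    then show ?thesis by (simp add: w_def orthogonal_def)
  qed
  show ?thesis
  proof (intro equalityI subsetI)
    fix v assume "v \<in> chamber S"
    then show "v \<in> {\<Sum>j\<in>UNIV. t j *\<^sub>R \<alpha>' j | t. \<forall>j. t j \<ge> 0}"
      using expand[of v] unfolding chamber_def S
      by (auto intro!: exI[of _ "\<lambda>j. v \<bullet> \<alpha> j"])
  qed (auto simp: chamber_def S coord)
qed


section \<open>Square-integrable functions and the Fourier transform\<close>

text \<open>Elements of \<open>L\<^sup>2\<close> are represented by functions; equality in \<open>L\<^sup>2\<close> is equality
  almost everywhere.\<close>

definition square_integrable :: "(real^'n \<Rightarrow> complex) \<Rightarrow> bool" where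
  "square_integrable f \<longleftrightarrow>
     f \<in> borel_measurable lebesgue \<and> integrable lebesgue (\<lambda>x. (norm (f x))\<^sup>2)"

definition L2_inner :: "(real^'n \<Rightarrow> complex) \<Rightarrow> (real^'n \<Rightarrow> complex) \<Rightarrow> complex" where
  "L2_inner f g = (\<integral>x. f x * cnj (g x) \<partial>lebesgue)"

definition L2_norm :: "(real^'n \<Rightarrow> complex) \<Rightarrow> real" where
  "L2_norm f = sqrt (\<integral>x. (norm (f x))\<^sup>2 \<partial>lebesgue)"

definition L2_tendsto :: "(nat \<Rightarrow> real^'n \<Rightarrow> complex) \<Rightarrow> (real^'n \<Rightarrow> complex) \<Rightarrow> bool" where
  "L2_tendsto F f \<longleftrightarrow>
     (\<forall>k. square_integrable (F k)) \<and> square_integrable f \<and>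
     (\<lambda>k. L2_norm (\<lambda>x. F k x - f x)) \<longlonglongrightarrow> 0"

definition fourier :: "(real^'n \<Rightarrow> complex) \<Rightarrow> real^'n \<Rightarrow> complex" where
  "fourier f \<xi> =
     (\<integral>x. f x * exp (- (2 * complex_of_real pi * \<i> * complex_of_real (x \<bullet> \<xi>))) \<partial>lebesgue)"

text \<open>The extension of \<^const>\<open>fourier\<close> from \<open>L\<^sup>1 \<inter> L\<^sup>2\<close> to \<open>L\<^sup>2\<close> by continuity, as a relation because
  the transform is determined only almost everywhere. By Plancherel's theorem the choice of the
  approximating sequence is immaterial.\<close>

definition has_L2_fourier :: "(real^'n \<Rightarrow> complex) \<Rightarrow> (real^'n \<Rightarrow> complex) \<Rightarrow> bool" where
  "has_L2_fourier f g \<longleftrightarrow>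
     (\<exists>F. (\<forall>k. integrable lebesgue (F k)) \<and>
          L2_tendsto F f \<and> L2_tendsto (\<lambda>k. fourier (F k)) g)"


section \<open>Wavelets and wavelet sets\<close>

text \<open>An orthonormal basis indexed by \<open>I\<close>: an orthonormal family whose finite linear combinations
  are dense in \<open>L\<^sup>2\<close>.\<close>

definition L2_orthonormal_basis :: "'i set \<Rightarrow> ('i \<Rightarrow> real^'n \<Rightarrow> complex) \<Rightarrow> bool" where
  "L2_orthonormal_basis I e \<longleftrightarrow>
     (\<forall>i\<in>I. square_integrable (e i)) \<and>
     (\<forall>i\<in>I. \<forall>j\<in>I. L2_inner (e i) (e j) = (if i = j then 1 else 0)) \<and>
     (\<forall>f. square_integrable f \<longrightarrow>
        (\<forall>\<epsilon>>0. \<exists>J c. finite J \<and> J \<subseteq> I \<and> L2_norm (\<lambda>x. f x - (\<Sum>i\<in>J. c i * e i x)) < \<epsilon>))"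

definition wavelet :: "(real^'n^'n) set \<Rightarrow> (real^'n) set \<Rightarrow> (real^'n \<Rightarrow> complex) \<Rightarrow> bool" where
  "wavelet \<D> \<T> \<psi> \<longleftrightarrow>
     square_integrable \<psi> \<and>
     L2_orthonormal_basis (\<D> \<times> \<T>)
       (\<lambda>(d, t) x. complex_of_real (sqrt \<bar>det d\<bar>) * \<psi> (d *v x + t))"

text \<open>The existential quantifier expresses ``the'' function with transform \<open>\<chi>\<^sub>\<Omega>\<close>, which is unique
  up to null sets.\<close>

definition wavelet_set :: "(real^'n^'n) set \<Rightarrow> (real^'n) set \<Rightarrow> (real^'n) set \<Rightarrow> bool" where
  "wavelet_set \<D> \<T> \<Omega> \<longleftrightarrow>
     \<Omega> \<in> sets lebesgue \<and>
     (\<exists>\<psi>. has_L2_fourier \<psi> (indicator \<Omega>) \<and> wavelet \<D> \<T> \<psi>)"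

end

theory Submission
  imports Defs "HOL-Probability.Characteristic_Functions" "HOL-Real_Asymp.Real_Asymp"
begin

text \<open>
  The Fourier transform turns the statement into geometry. If \<psi> has transform \<open>\<chi>\<^sub>\<Omega>\<close>, then the transform of
  \<open>x \<mapsto> \<bar>det d\<bar>\<^sup>1\<^sup>/\<^sup>2 \<psi>(d x + t)\<close> is, up to the factor \<open>\<bar>det d\<bar>\<^sup>-\<^sup>1\<^sup>/\<^sup>2\<close>, a character restricted to \<open>d\<^sup>T \<Omega>\<close>.
  By Plancherel the wavelet system is therefore an orthonormal basis as soon as the sets \<open>d\<^sup>T \<Omega>\<close> tile
  space up to a null set and the characters belonging to \<Gamma> form an orthonormal basis of \<open>L\<^sup>2(\<Omega>)\<close>; the
  latter holds when \<Omega> contains exactly one point of every coset of the dual lattice \<open>\<Gamma>\<^sup>*\<close>, which has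
  covolume \<open>1\<close> because \<open>det G = 1\<close> (lemma \<open>is_wavelet_set\<close>).

  For \<open>d = B\<^sup>k w\<close> one has \<open>d\<^sup>T \<Omega> = w\<^sup>T A\<^sup>k \<Omega>\<close>. The Weyl group permutes the chambers simply transitively, so
  its translates of the open chamber are disjoint and miss only a null set (\<open>weyl_chambers_disjoint\<close>,
  \<open>AE_weyl_chambers\<close>), and \<open>A\<close> preserves the chamber because it is diagonal in the coordinates given by
  the simple roots. What remains is to find \<Omega> in the open chamber that contains exactly one point of
  every orbit of \<open>A\<close> in the chamber and exactly one point of every coset of \<open>\<Gamma>\<^sup>*\<close>. Representatives of the
  \<open>A\<close>-orbits can be chosen so close to \<open>0\<close> that no two are congruent modulo \<open>\<Gamma>\<^sup>*\<close>; representatives of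
  the cosets can be chosen so far out in the chamber that no two lie on one \<open>A\<close>-orbit. A
  Cantor-Schroeder-Bernstein argument (\<open>common_transversal\<close>) merges the two sets into one Borel set that
  has both properties exactly, not just almost everywhere.

  On the analytic side all functions are reduced to bounded integrable ones, for which the transform is
  an absolutely convergent integral. Plancherel's formula for them follows from Gaussian regularisation
  (\<open>plancherel\<close>), and the identity \<open>fourier_duality\<close> supplies both the \<open>L\<^sup>2\<close> inversion of \<open>\<chi>\<^sub>\<Omega>\<close> and the
  transfer of density from the frequency side to the time side. Density of the characters on \<Omega> is the
  theorem of Stone and Weierstrass on the torus, carried over from the unit cell of \<open>\<Gamma>\<^sup>*\<close> to \<Omega> by
  periodicity.
\<close>


section \<open>Linear changes of variables\<close>

lemma nn_integral_shift:
  fixes f :: "'a::euclidean_space \<Rightarrow> ennreal"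
  assumes [measurable]: "f \<in> borel_measurable borel"
  shows "(\<integral>\<^sup>+x. f (x + c) \<partial>lborel) = (\<integral>\<^sup>+x. f x \<partial>lborel)"
proof -
  have "(\<integral>\<^sup>+x. f x \<partial>lborel) = (\<integral>\<^sup>+x. f x \<partial>distr lborel borel ((+) c))"
    by (simp add: lborel_distr_plus)
  also have "\<dots> = (\<integral>\<^sup>+x. f (c + x) \<partial>lborel)"
    by (subst nn_integral_distr) auto
  finally show ?thesis by (simp add: add.commute)
qed

text \<open>Averaging over an additional parameter \<open>t \<in> [0, 1]\<close> lets the integrand be translated by \<open>t e\<close> without
  changing the integral. After exchanging the order of integration the displacement \<open>\<phi> x\<close> is a
  translation of \<open>t\<close>, which is absorbed by the invariance of the one-dimensional measure; the remaining
  translation by \<open>t e\<close> does not affect \<phi>.\<close>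

lemma nn_integral_shear:
  fixes f :: "'a::euclidean_space \<Rightarrow> ennreal" and \<phi> :: "'a \<Rightarrow> real"
  assumes [measurable]: "f \<in> borel_measurable borel" "\<phi> \<in> borel_measurable borel"
    and inv: "\<And>x t. \<phi> (x + t *\<^sub>R e) = \<phi> x"
  shows "(\<integral>\<^sup>+x. f (x + \<phi> x *\<^sub>R e) \<partial>lborel) = (\<integral>\<^sup>+x. f x \<partial>lborel)"
proof -
  let ?c = "indicator {0..1} :: real \<Rightarrow> ennreal"
  have unit: "(\<integral>\<^sup>+t. ?c (t + s) \<partial>lborel) = 1" for s :: real
    by (subst nn_integral_shift) auto
  have "(\<integral>\<^sup>+x. f (x + \<phi> x *\<^sub>R e) \<partial>lborel)
      = (\<integral>\<^sup>+t. ?c t * (\<integral>\<^sup>+x. f (x + \<phi> x *\<^sub>R e) \<partial>lborel) \<partial>lborel)"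
    by (subst nn_integral_multc) auto
  also have "\<dots> = (\<integral>\<^sup>+t. \<integral>\<^sup>+x. ?c t * f (x + \<phi> x *\<^sub>R e) \<partial>lborel \<partial>lborel)"
    by (subst nn_integral_cmult) auto
  also have "\<dots> = (\<integral>\<^sup>+t. \<integral>\<^sup>+x. ?c t * f ((x + t *\<^sub>R e) + \<phi> (x + t *\<^sub>R e) *\<^sub>R e) \<partial>lborel \<partial>lborel)"
    by (intro nn_integral_cong nn_integral_shift[symmetric, where f = "\<lambda>y. ?c t * f (y + \<phi> y *\<^sub>R e)" for t]) measurable
  also have "\<dots> = (\<integral>\<^sup>+t. \<integral>\<^sup>+x. ?c t * f (x + (t + \<phi> x) *\<^sub>R e) \<partial>lborel \<partial>lborel)"
    by (simp add: inv algebra_simps)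
  also have "\<dots> = (\<integral>\<^sup>+x. \<integral>\<^sup>+t. ?c t * f (x + (t + \<phi> x) *\<^sub>R e) \<partial>lborel \<partial>lborel)"
    by (rule lborel_pair.Fubini') measurable
  also have "\<dots> = (\<integral>\<^sup>+x. \<integral>\<^sup>+t. ?c ((t + \<phi> x) - \<phi> x) * f (x + (t + \<phi> x) *\<^sub>R e) \<partial>lborel \<partial>lborel)"
    by simp
  also have "\<dots> = (\<integral>\<^sup>+x. \<integral>\<^sup>+t. ?c (t - \<phi> x) * f (x + t *\<^sub>R e) \<partial>lborel \<partial>lborel)"
    by (intro nn_integral_cong nn_integral_shift[where f = "\<lambda>s. ?c (s - \<phi> x) * f (x + s *\<^sub>R e)" for x]) measurable
  also have "\<dots> = (\<integral>\<^sup>+t. \<integral>\<^sup>+x. ?c (t - \<phi> x) * f (x + t *\<^sub>R e) \<partial>lborel \<partial>lborel)"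
    by (rule lborel_pair.Fubini') measurable
  also have "\<dots> = (\<integral>\<^sup>+t. \<integral>\<^sup>+x. ?c (t - \<phi> (x + t *\<^sub>R e)) * f (x + t *\<^sub>R e) \<partial>lborel \<partial>lborel)"
    by (simp add: inv)
  also have "\<dots> = (\<integral>\<^sup>+t. \<integral>\<^sup>+x. ?c (t - \<phi> x) * f x \<partial>lborel \<partial>lborel)"
    by (intro nn_integral_cong nn_integral_shift[where f = "\<lambda>y. ?c (t - \<phi> y) * f y" for t]) measurable
  also have "\<dots> = (\<integral>\<^sup>+x. \<integral>\<^sup>+t. ?c (t - \<phi> x) * f x \<partial>lborel \<partial>lborel)"
    by (rule lborel_pair.Fubini') measurable
  also have "\<dots> = (\<integral>\<^sup>+x. f x \<partial>lborel)"
  proof (intro nn_integral_cong)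
    fix x :: 'a
    show "(\<integral>\<^sup>+t. ?c (t - \<phi> x) * f x \<partial>lborel) = f x"
      using unit[of "- \<phi> x"] by (subst nn_integral_multc) auto
  qed
  finally show ?thesis .
qed

lemma lborel_distr_transpose:
  fixes m n :: "'n::finite"
  shows "distr lborel borel (\<lambda>x::real^'n. \<chi> i. x $ Transposition.transpose m n i) = lborel"
proof (rule lborel_eqI[symmetric])
  let ?\<tau> = "Transposition.transpose m n"
  let ?s = "\<lambda>x::real^'n. \<chi> i. x $ ?\<tau> i"
  have meas [measurable]: "?s \<in> borel_measurable borel"
    by (intro borel_measurable_continuous_onI continuous_intros)
  fix l u :: "real^'n" assume lu: "\<And>b. b \<in> Basis \<Longrightarrow> l \<bullet> b \<le> u \<bullet> b"
  then have le: "l $ i \<le> u $ i" for i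
    by (metis axis_in_Basis_iff inner_axis' inner_commute inner_real_def mult_cancel_right2 real_inner_1_left Basis_real_def singletonI)
  have pre: "?s -` box l u = box (?s l) (?s u)"
    by (auto simp: mem_box_cart) (metis transpose_involutory)+
  have "emeasure (distr lborel borel ?s) (box l u) = emeasure lborel (box (?s l) (?s u))"
    by (subst emeasure_distr) (auto simp: pre)
  also have "\<dots> = (\<Prod>b\<in>Basis. (?s u - ?s l) \<bullet> b)"
    by (rule emeasure_lborel_box) (use le in \<open>auto simp: Basis_vec_def inner_axis\<close>)
  also have "(\<Prod>b\<in>Basis. (?s u - ?s l) \<bullet> b) = (\<Prod>i\<in>UNIV. u $ ?\<tau> i - l $ ?\<tau> i)"
    by (simp add: Basis_vec_def inner_axis prod.UNION_disjoint axis_eq_axis prod.reindex inj_on_def)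
  also have "\<dots> = (\<Prod>i\<in>UNIV. u $ i - l $ i)"
    by (rule prod.reindex_bij_betw[where h = ?\<tau> and g = "\<lambda>i. u $ i - l $ i"]) simp
  also have "\<dots> = (\<Prod>b\<in>Basis. (u - l) \<bullet> b)"
    by (simp add: Basis_vec_def inner_axis prod.UNION_disjoint axis_eq_axis prod.reindex inj_on_def)
  finally show "emeasure (distr lborel borel ?s) (box l u) = (\<Prod>b\<in>Basis. (u - l) \<bullet> b)" .
qed simp

lemma measurable_matrix_vector [measurable]: "(\<lambda>x::real^'n. (M::real^'n^'m) *v x) \<in> borel_measurable borel"
  by (intro borel_measurable_continuous_onI linear_continuous_on) (simp add: linear_linear)

text \<open>The formula is multiplicative in the matrix, so it is enough to check it on the factors produced by
  Gaussian elimination: diagonal matrices, transpositions of coordinates and elementary shears. A factor with a zero row is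
  singular and therefore excluded.\<close>

lemma nn_integral_linear:
  fixes M :: "real^'n^'n" and f :: "real^'n \<Rightarrow> ennreal"
  assumes "det M \<noteq> 0" and "f \<in> borel_measurable borel"
  shows "ennreal \<bar>det M\<bar> * (\<integral>\<^sup>+x. f (M *v x) \<partial>lborel) = (\<integral>\<^sup>+x. f x \<partial>lborel)"
proof -
  define P where "P M \<longleftrightarrow> (det M \<noteq> 0 \<longrightarrow> (\<forall>f \<in> borel_measurable borel.
      ennreal \<bar>det M\<bar> * (\<integral>\<^sup>+x. f (M *v x) \<partial>lborel) = (\<integral>\<^sup>+x. f x \<partial>lborel)))" for M :: "real^'n^'n"
  have "P M"
  proof (rule induct_matrix_elementary_alt)
    fix A B :: "real^'n^'n" assume A: "P A" and B: "P B"
    show "P (A ** B)" unfolding P_def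
    proof (intro impI ballI)
      fix f :: "real^'n \<Rightarrow> ennreal" assume d: "det (A ** B) \<noteq> 0" and [measurable]: "f \<in> borel_measurable borel"
      have "(\<integral>\<^sup>+x. f x \<partial>lborel) = ennreal \<bar>det A\<bar> * (\<integral>\<^sup>+x. f (A *v x) \<partial>lborel)"
        using A d by (simp add: P_def det_mul)
      also have "(\<integral>\<^sup>+x. f (A *v x) \<partial>lborel) = ennreal \<bar>det B\<bar> * (\<integral>\<^sup>+x. f (A *v (B *v x)) \<partial>lborel)"
        using B d by (auto simp: P_def det_mul dest!: bspec[where x = "\<lambda>x. f (A *v x)"])
      finally show "ennreal \<bar>det (A ** B)\<bar> * (\<integral>\<^sup>+x. f ((A ** B) *v x) \<partial>lborel) = (\<integral>\<^sup>+x. f x \<partial>lborel)"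
        by (simp add: matrix_vector_mul_assoc det_mul abs_mult ennreal_mult mult.assoc)
    qed
  next
    fix A :: "real^'n^'n" and i assume "row i A = 0"
    then show "P A" by (simp add: P_def det_zero_row)
  next
    fix A :: "real^'n^'n" assume diag: "\<And>i j. i \<noteq> j \<Longrightarrow> A $ i $ j = 0"
    show "P A" unfolding P_def
    proof (intro impI ballI)
      fix f :: "real^'n \<Rightarrow> ennreal" assume d: "det A \<noteq> 0" and [measurable]: "f \<in> borel_measurable borel"
      have det: "det A = (\<Prod>i\<in>UNIV. A $ i $ i)" by (rule det_diagonal) (use diag in auto)
      then have nz: "A $ i $ i \<noteq> 0" for i using d by auto
      define c where "c = (\<lambda>b. b \<bullet> (A *v b))"
      have cax: "c (axis i 1) = A $ i $ i" for i
        by (simp add: c_def inner_axis' matrix_vector_mult_basis column_def)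
      have c0: "c b \<noteq> 0" if "b \<in> Basis" for b using that nz cax by (auto simp: Basis_vec_def)
      have T: "(0 + (\<Sum>j\<in>Basis. (c j * (x \<bullet> j)) *\<^sub>R j)) = A *v x" for x :: "real^'n"
      proof -
        have "(A *v x) $ i = A $ i $ i * x $ i" for i
          by (simp add: matrix_vector_mult_def sum.remove[of _ i] diag)
        then show ?thesis
          by (subst (2) euclidean_representation[symmetric])
             (auto intro!: sum.cong simp: Basis_vec_def inner_axis cax)
      qed
      have "(\<integral>\<^sup>+x. f x \<partial>lborel) = (\<integral>\<^sup>+x. f x \<partial>density (distr lborel borel ((*v) A)) (\<lambda>_. \<Prod>j\<in>Basis. \<bar>c j\<bar>))"
        using lborel_affine_euclidean[of c 0] c0 by (simp only: T) simp
      also have "(\<Prod>j\<in>Basis. \<bar>c j\<bar>) = \<bar>det A\<bar>"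
        by (simp add: det Basis_vec_def prod.UNION_disjoint axis_eq_axis cax abs_prod)
      finally show "ennreal \<bar>det A\<bar> * (\<integral>\<^sup>+x. f (A *v x) \<partial>lborel) = (\<integral>\<^sup>+x. f x \<partial>lborel)"
        by (simp add: nn_integral_density nn_integral_distr nn_integral_cmult)
    qed
  next
    fix m n :: 'n assume "m \<noteq> n"
    let ?S = "(\<chi> i j. mat 1 $ i $ Transposition.transpose m n j) :: real^'n^'n"
    have eq: "?S *v x = (\<chi> i. x $ Transposition.transpose m n i)" for x
    proof -
      have "i = Transposition.transpose m n j \<longleftrightarrow> j = Transposition.transpose m n i" for i j
        by (metis transpose_involutory)
      then have "?S $ i $ j * x $ j = (if j = Transposition.transpose m n i then x $ j else 0)" for i j
        by (auto simp: mat_def)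
      then show ?thesis
        by (simp add: matrix_vector_mult_def vec_eq_iff)
    qed
    have "\<bar>det ?S\<bar> = 1"
    proof -
      have "det ?S = of_int (sign (Transposition.transpose m n)) * det (mat 1 :: real^'n^'n)"
        using det_permute_columns[of "Transposition.transpose m n" "mat 1 :: real^'n^'n"] by (simp add: permutes_swap_id)
      then show ?thesis by (simp add: sign_swap_id)
    qed
    moreover have "(\<integral>\<^sup>+x. f (?S *v x) \<partial>lborel) = (\<integral>\<^sup>+x. f x \<partial>lborel)"
      if [measurable]: "f \<in> borel_measurable borel" for f
    proof -
      have [measurable]: "(\<lambda>x::real^'n. \<chi> i. x $ Transposition.transpose m n i) \<in> borel_measurable borel"
        by (intro borel_measurable_continuous_onI continuous_intros)
      show ?thesis unfolding eq
        by (subst (2) lborel_distr_transpose[of m n, symmetric]) (simp add: nn_integral_distr)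
    qed
    ultimately show "P ?S" by (simp add: P_def)
  next
    fix m n :: 'n assume mn: "m \<noteq> n"
    let ?S = "(\<chi> i j. of_bool (i = m \<and> j = n \<or> i = j)) :: real^'n^'n"
    have eq: "?S *v x = x + (x $ n) *\<^sub>R axis m 1" for x
    proof -
      have "(?S *v x) $ i = (x + (x $ n) *\<^sub>R axis m 1) $ i" for i
      proof (cases "i = m")
        case True
        have "(\<Sum>j\<in>UNIV. of_bool (j = n \<or> m = j) * x $ j) = (\<Sum>j\<in>{m,n}. x $ j)"
          by (rule sum.mono_neutral_cong_right) auto
        then show ?thesis using True mn by (simp add: matrix_vector_mult_def)
      next
        case False
        then show ?thesis by (simp add: matrix_vector_mult_def axis_def if_distrib cong: if_cong)
      qed
      then show ?thesis by (simp add: vec_eq_iff)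
    qed
    have "det ?S = 1"
    proof -
      have "?S = (\<chi> k. if k = m then row m (mat 1 :: real^'n^'n) + 1 *s row n (mat 1) else row k (mat 1))"
        using mn by (auto simp: vec_eq_iff row_def mat_def of_bool_def)
      then show ?thesis using det_row_operation[OF mn, of "mat 1 :: real^'n^'n" 1] by simp
    qed
    moreover have "(\<integral>\<^sup>+x. f (?S *v x) \<partial>lborel) = (\<integral>\<^sup>+x. f x \<partial>lborel)"
      if "f \<in> borel_measurable borel" for f
      unfolding eq by (rule nn_integral_shear[OF that]) (use mn in \<open>auto simp: axis_def\<close>)
    ultimately show "P ?S" by (simp add: P_def)
  qed
  then show ?thesis using assms by (simp add: P_def)
qed


lemma lborel_linear:
  fixes M :: "real^'n^'n"
  assumes "det M \<noteq> 0"
  shows "lborel = density (distr lborel borel ((*v) M)) (\<lambda>_. ennreal \<bar>det M\<bar>)"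
proof (rule measure_eqI)
  fix X :: "(real^'n) set" assume "X \<in> sets lborel"
  then have [measurable]: "X \<in> sets borel" by simp
  have "emeasure lborel X = (\<integral>\<^sup>+x. indicator X x \<partial>lborel)" by simp
  also have "\<dots> = ennreal \<bar>det M\<bar> * (\<integral>\<^sup>+x. indicator X (M *v x) \<partial>lborel)"
    by (rule nn_integral_linear[OF assms, symmetric]) simp
  finally show "emeasure lborel X = emeasure (density (distr lborel borel ((*v) M)) (\<lambda>_. ennreal \<bar>det M\<bar>)) X"
    by (subst emeasure_density, simp, simp, subst nn_integral_distr, simp, simp, subst nn_integral_cmult, simp_all)
qed simp

lemma integrable_scaleR_iff:
  fixes f :: "'a \<Rightarrow> 'b::{banach, second_countable_topology}"
  assumes "c \<noteq> 0"
  shows "integrable M (\<lambda>x. c *\<^sub>R f x) \<longleftrightarrow> integrable M f"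
proof
  assume "integrable M (\<lambda>x. c *\<^sub>R f x)"
  from integrable_scaleR_right[of "1 / c", OF this] show "integrable M f" using assms by simp
qed simp

lemma integral_linear:
  fixes M :: "real^'n^'n" and f :: "real^'n \<Rightarrow> 'b::{banach, second_countable_topology}"
  assumes "det M \<noteq> 0" and [measurable]: "f \<in> borel_measurable borel"
  shows "(\<integral>x. f x \<partial>lborel) = \<bar>det M\<bar> *\<^sub>R (\<integral>x. f (M *v x) \<partial>lborel)"
  by (subst lborel_linear[OF assms(1)]) (simp add: integral_density integral_distr)

lemma
  fixes f :: "'a::euclidean_space \<Rightarrow> 'b::{banach, second_countable_topology}"
  assumes [measurable]: "f \<in> borel_measurable borel"
  shows integrable_shift: "integrable lborel (\<lambda>x. f (x + c)) \<longleftrightarrow> integrable lborel f"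
    and integral_shift: "(\<integral>x. f (x + c) \<partial>lborel) = (\<integral>x. f x \<partial>lborel)"
proof -
  show "integrable lborel (\<lambda>x. f (x + c)) \<longleftrightarrow> integrable lborel f"
    by (subst (2) lborel_distr_plus[of c, symmetric]) (simp add: integrable_distr_eq add.commute)
  show "(\<integral>x. f (x + c) \<partial>lborel) = (\<integral>x. f x \<partial>lborel)"
    by (subst (2) lborel_distr_plus[of c, symmetric]) (simp add: integral_distr add.commute)
qed

lemma
  fixes f :: "'a::euclidean_space \<Rightarrow> 'b::{banach, second_countable_topology}"
  assumes [measurable]: "f \<in> borel_measurable borel" and "r \<noteq> 0"
  shows integrable_scale: "integrable lborel (\<lambda>x. f (r *\<^sub>R x)) \<longleftrightarrow> integrable lborel f"
    and integral_scale: "(\<integral>x. f x \<partial>lborel) = \<bar>r\<bar> ^ DIM('a) *\<^sub>R (\<integral>x. f (r *\<^sub>R x) \<partial>lborel)"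
proof -
  have l: "(lborel :: 'a measure) = density (distr lborel borel (\<lambda>x. r *\<^sub>R x)) (\<lambda>_. \<bar>r\<bar> ^ DIM('a))"
    using lborel_affine[OF assms(2), of "0::'a"] by simp
  show "integrable lborel (\<lambda>x. f (r *\<^sub>R x)) \<longleftrightarrow> integrable lborel f"
    by (subst (2) l) (use assms(2) in \<open>simp add: integrable_density integrable_distr_eq integrable_scaleR_iff\<close>)
  show "(\<integral>x. f x \<partial>lborel) = \<bar>r\<bar> ^ DIM('a) *\<^sub>R (\<integral>x. f (r *\<^sub>R x) \<partial>lborel)"
    by (subst l) (simp add: integral_density integral_distr)
qed

section \<open>Gaussians and translations\<close>

lemma measurable_cis [measurable]: "cis \<in> borel_measurable borel"
  by (intro borel_measurable_continuous_onI continuous_intros)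

text \<open>This is the characteristic function of the standard normal distribution, rescaled by \<open>r = sqrt (2 \<pi>) / k\<close>.\<close>

lemma gauss_char_1d:
  fixes k t :: real
  assumes k: "k > 0"
  shows "integrable lborel (\<lambda>x. complex_of_real (exp (- pi * x\<^sup>2 / k\<^sup>2)) * cis (- (2 * pi * (x * t))))"
    and "(\<integral>x. complex_of_real (exp (- pi * x\<^sup>2 / k\<^sup>2)) * cis (- (2 * pi * (x * t))) \<partial>lborel)
         = complex_of_real (k * exp (- pi * k\<^sup>2 * t\<^sup>2))"
proof -
  define r where "r = sqrt (2 * pi) / k"
  have r: "r > 0" using k by (simp add: r_def)
  let ?s = "- (sqrt (2 * pi) * k * t)"
  let ?g = "\<lambda>x. complex_of_real (std_normal_density x) * cis (?s * x)"
  have ig: "integrable lborel ?g"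
  proof (rule Bochner_Integration.integrable_bound)
    show "integrable lborel std_normal_density" by (rule integrable_normal_density) simp
  qed (auto simp: norm_mult)
  have "char std_normal_distribution ?s = (\<integral>x. ?g x \<partial>lborel)"
    unfolding char_def
    by (subst integral_density) (auto simp: normal_density_nonneg scaleR_conv_of_real cis_conv_exp)
  then have vg: "(\<integral>x. ?g x \<partial>lborel) = complex_of_real (exp (- pi * k\<^sup>2 * t\<^sup>2))"
    by (simp add: char_std_normal_distribution power_mult_distrib real_sqrt_pow2 mult.assoc)
  have eq: "?g (r * x) = (1 / sqrt (2 * pi)) *\<^sub>R
      (complex_of_real (exp (- pi * x\<^sup>2 / k\<^sup>2)) * cis (- (2 * pi * (x * t))))" for x
  proof -
    have "?s * (r * x) = - (2 * pi * (x * t))"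
      using k by (simp add: r_def field_simps)
    moreover have "std_normal_density (r * x) = 1 / sqrt (2 * pi) * exp (- pi * x\<^sup>2 / k\<^sup>2)"
      by (simp add: normal_density_def r_def power_mult_distrib power_divide real_sqrt_pow2)
    ultimately show ?thesis by (simp only: of_real_mult mult.assoc scaleR_conv_of_real)
  qed
  have ig': "integrable lborel (\<lambda>x. ?g (r * x))"
    using lborel_integrable_real_affine[OF ig, of r 0] r by simp
  then show "integrable lborel (\<lambda>x. complex_of_real (exp (- pi * x\<^sup>2 / k\<^sup>2)) * cis (- (2 * pi * (x * t))))"
    unfolding eq
    by (subst (asm) integrable_scaleR_iff) auto
  have "(\<integral>x. ?g x \<partial>lborel) = r *\<^sub>R (\<integral>x. ?g (r * x) \<partial>lborel)"
    using lborel_integral_real_affine[of r ?g 0] r by simp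
  also have "\<dots> = complex_of_real (r / sqrt (2 * pi)) * 
      (\<integral>x. complex_of_real (exp (- pi * x\<^sup>2 / k\<^sup>2)) * cis (- (2 * pi * (x * t))) \<partial>lborel)"
    unfolding eq by (simp add: scaleR_conv_of_real)
  also have "r / sqrt (2 * pi) = 1 / k" by (simp add: r_def)
  finally have "complex_of_real (exp (- pi * k\<^sup>2 * t\<^sup>2)) = complex_of_real (1 / k) *
      (\<integral>x. complex_of_real (exp (- pi * x\<^sup>2 / k\<^sup>2)) * cis (- (2 * pi * (x * t))) \<partial>lborel)" (is "_ = _ * ?I")
    unfolding vg .
  then have "complex_of_real k * complex_of_real (exp (- pi * k\<^sup>2 * t\<^sup>2)) = (complex_of_real k * complex_of_real (1 / k)) * ?I"
    by (simp only: mult.assoc)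
  also have "complex_of_real k * complex_of_real (1 / k) = 1" using k by simp
  finally show "?I = complex_of_real (k * exp (- pi * k\<^sup>2 * t\<^sup>2))" by simp
qed

lemma
  fixes f :: "'a::euclidean_space \<Rightarrow> real \<Rightarrow> complex"
  assumes "\<And>b. b \<in> Basis \<Longrightarrow> integrable lborel (f b)"
  shows integral_lborel_prod: "(\<integral>x. (\<Prod>b\<in>Basis. f b (x \<bullet> b)) \<partial>lborel) = (\<Prod>b\<in>Basis. \<integral>x. f b x \<partial>lborel)"
    and integrable_lborel_prod: "integrable lborel (\<lambda>x. \<Prod>b\<in>Basis. f b (x \<bullet> b))"
proof -
  interpret product_sigma_finite "\<lambda>_::'a. lborel :: real measure" ..
  have [measurable]: "f b \<in> borel_measurable borel" if "b \<in> Basis" for b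
    using borel_measurable_integrable[OF assms[OF that]] by simp
  have coord: "(\<Prod>b\<in>Basis. f b ((\<Sum>b\<in>Basis. x b *\<^sub>R b) \<bullet> b)) = (\<Prod>b\<in>Basis. f b (x b))" for x :: "'a \<Rightarrow> real"
    by (intro prod.cong) (auto simp: inner_sum_left inner_Basis if_distrib cong: if_cong)
  show "(\<integral>x. (\<Prod>b\<in>Basis. f b (x \<bullet> b)) \<partial>lborel) = (\<Prod>b\<in>Basis. \<integral>x. f b x \<partial>lborel)"
    by (subst lborel_eq, subst integral_distr) (simp_all add: coord product_integral_prod assms)
  show "integrable lborel (\<lambda>x. \<Prod>b\<in>Basis. f b (x \<bullet> b))"
    by (subst lborel_eq, subst integrable_distr_eq) (simp_all add: coord product_integrable_prod assms)
qed

text \<open>The weights \<open>gauss k\<close> increase to \<open>1\<close>, while their Fourier transforms \<open>gauss_kernel k\<close> are probability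
  densities concentrating at \<open>0\<close>. The index is shifted by one so that \<open>k = 0\<close> needs no exception.\<close>

definition gauss :: "nat \<Rightarrow> 'a::euclidean_space \<Rightarrow> real" where
  "gauss k x = exp (- pi * (norm x)\<^sup>2 / (real (Suc k))\<^sup>2)"

definition gauss_kernel :: "nat \<Rightarrow> 'a::euclidean_space \<Rightarrow> real" where
  "gauss_kernel k x = real (Suc k) ^ DIM('a) * exp (- pi * (real (Suc k))\<^sup>2 * (norm x)\<^sup>2)"

lemma measurable_gauss [measurable]: "gauss k \<in> borel_measurable borel" "gauss_kernel k \<in> borel_measurable borel"
  unfolding gauss_def[abs_def] gauss_kernel_def[abs_def] by measurable

lemma norm_power2_Basis: "(norm (x::'a::euclidean_space))\<^sup>2 = (\<Sum>b\<in>Basis. (x \<bullet> b)\<^sup>2)"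
  unfolding power2_norm_eq_inner by (subst euclidean_inner) (simp add: power2_eq_square)

lemma
  fixes \<xi> :: "'a::euclidean_space"
  shows gauss_char: "(\<integral>x. complex_of_real (gauss k x) * cis (- (2 * pi * (x \<bullet> \<xi>))) \<partial>lborel) = complex_of_real (gauss_kernel k \<xi>)"
    and integrable_gauss_char: "integrable lborel (\<lambda>x. complex_of_real (gauss k x) * cis (- (2 * pi * (x \<bullet> \<xi>))))"
proof -
  let ?k = "real (Suc k)"
  let ?f = "\<lambda>b x. complex_of_real (exp (- pi * x\<^sup>2 / ?k\<^sup>2)) * cis (- (2 * pi * (x * (\<xi> \<bullet> b))))"
  have cis_sum: "cis (\<Sum>b\<in>A. g b) = (\<Prod>b\<in>A. cis (g b))" for A and g :: "'a \<Rightarrow> real"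
    by (induction A rule: infinite_finite_induct) (auto simp: cis_mult[symmetric])
  have eq: "complex_of_real (gauss k x) * cis (- (2 * pi * (x \<bullet> \<xi>))) = (\<Prod>b\<in>Basis. ?f b (x \<bullet> b))" for x
  proof -
    have "gauss k x = (\<Prod>b\<in>Basis. exp (- pi * (x \<bullet> b)\<^sup>2 / ?k\<^sup>2))"
      by (simp add: gauss_def norm_power2_Basis exp_sum[symmetric] sum_distrib_left sum_divide_distrib sum_negf)
    moreover have "cis (- (2 * pi * (x \<bullet> \<xi>))) = (\<Prod>b\<in>Basis. cis (- (2 * pi * ((x \<bullet> b) * (\<xi> \<bullet> b)))))"
      by (subst euclidean_inner[of x]) (simp add: cis_sum[symmetric] sum_distrib_left sum_negf)
    ultimately show ?thesis by (simp add: prod.distrib of_real_prod)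
  qed
  have k: "?k > 0" by simp
  note g = gauss_char_1d[OF k]
  show "integrable lborel (\<lambda>x. complex_of_real (gauss k x) * cis (- (2 * pi * (x \<bullet> \<xi>))))"
    unfolding eq by (rule integrable_lborel_prod[of ?f]) (rule g(1))
  have "(\<integral>x. complex_of_real (gauss k x) * cis (- (2 * pi * (x \<bullet> \<xi>))) \<partial>lborel)
      = (\<Prod>b\<in>Basis. complex_of_real (?k * exp (- pi * ?k\<^sup>2 * (\<xi> \<bullet> b)\<^sup>2)))"
    unfolding eq by (subst integral_lborel_prod[of ?f]) (simp_all only: g)
  also have "\<dots> = complex_of_real (gauss_kernel k \<xi>)"
    by (simp add: gauss_kernel_def prod.distrib norm_power2_Basis exp_sum[symmetric] sum_distrib_left sum_negf of_real_prod[symmetric] del: of_real_prod of_nat_Suc)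
  finally show "(\<integral>x. complex_of_real (gauss k x) * cis (- (2 * pi * (x \<bullet> \<xi>))) \<partial>lborel) = complex_of_real (gauss_kernel k \<xi>)" .
qed

lemma integrable_gauss: "integrable lborel (gauss k :: 'a::euclidean_space \<Rightarrow> real)"
  using integrable_norm[OF integrable_gauss_char[of k 0]] by (simp add: norm_mult gauss_def[abs_def])

lemma gauss_kernel_scale: "gauss_kernel k ((1 / real (Suc k)) *\<^sub>R x) = real (Suc k) ^ DIM('a) * exp (- pi * (norm (x::'a::euclidean_space))\<^sup>2)"
  by (simp add: gauss_kernel_def power_mult_distrib power_divide del: of_nat_Suc)

lemma gauss_0: "gauss 0 x = exp (- pi * (norm x)\<^sup>2)"
  by (simp add: gauss_def)

lemma integral_gauss_0: "(\<integral>x. gauss 0 (x::'a::euclidean_space) \<partial>lborel) = 1"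
proof -
  have "complex_of_real (\<integral>x. gauss 0 (x::'a) \<partial>lborel) = 1"
    using gauss_char[of 0 "0::'a"] by (simp add: gauss_kernel_def flip: integral_of_real)
  then show ?thesis by simp
qed

lemma gauss_kernel_gauss: "gauss_kernel k (x::'a::euclidean_space) = real (Suc k) ^ DIM('a) * gauss 0 (real (Suc k) *\<^sub>R x)"
  by (simp add: gauss_kernel_def gauss_0 power_mult_distrib del: of_nat_Suc)

lemma integrable_gauss_kernel: "integrable lborel (gauss_kernel k :: 'a::euclidean_space \<Rightarrow> real)"
  unfolding gauss_kernel_gauss[abs_def]
  by (intro integrable_mult_right, subst integrable_scale) (auto simp: integrable_gauss)

lemma gauss_bounds: "0 < gauss k x" "gauss k x \<le> 1"
  for x :: "'a::euclidean_space"
  by (auto simp: gauss_def divide_nonpos_nonneg mult_nonpos_nonneg simp del: of_nat_Suc)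

lemma gauss_tendsto: "(\<lambda>k. gauss k x) \<longlonglongrightarrow> 1"
proof -
  have "(\<lambda>k. exp (- pi * (norm x)\<^sup>2 / (real (Suc k))\<^sup>2)) \<longlonglongrightarrow> 1" by real_asymp
  then show ?thesis by (simp add: gauss_def)
qed

lemma gauss_mono: "gauss k x \<le> gauss (Suc k) x"
proof -
  have "pi * (norm x)\<^sup>2 / (real (Suc (Suc k)))\<^sup>2 \<le> pi * (norm x)\<^sup>2 / (real (Suc k))\<^sup>2"
    by (intro divide_left_mono power_mono mult_pos_pos) auto
  then show ?thesis by (simp add: gauss_def del: of_nat_Suc)
qed

text \<open>The property survives sums and dominated limits, so it need only be checked for the indicator of a
  set \<open>A\<close> of finite measure. Take an open \<open>U \<supseteq> A\<close> with \<open>U - A\<close> of small measure. Points of \<open>A\<close> stay in \<open>U\<close>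
  under small translations, and they can leave \<open>A\<close> only by entering \<open>U - A\<close>.\<close>

lemma translation_continuous_L1:
  fixes f :: "'a::euclidean_space \<Rightarrow> complex"
  assumes "integrable lborel f" "v \<longlonglongrightarrow> 0"
  shows "(\<lambda>i. \<integral>x. norm (f (x + v i) - f x) \<partial>lborel) \<longlonglongrightarrow> 0"
  using assms(1)
proof (induction rule: integrable_induct)
  case (base A c)
  then have A [measurable]: "A \<in> sets borel" and fin: "emeasure lborel A < \<infinity>" by auto
  have shift_meas [measurable]: "{x. x + w \<in> A} \<in> sets borel" for w
    using measurable_sets_borel[of "\<lambda>y. y + w" borel A] by (simp add: vimage_def)
  have eq: "norm (indicator A (x + w) *\<^sub>R c - indicator A x *\<^sub>R c)
      = norm c * (indicator {x. x + w \<in> A} x + indicator A x - 2 * indicator ({x. x + w \<in> A} \<inter> A) x)" for x w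
    by (auto split: split_indicator)
  have em: "emeasure lborel {x. x + w \<in> A} = emeasure lborel A" for w
    using nn_integral_shift[of "indicator A" w] by (simp add: indicator_def[of A] flip: nn_integral_indicator) 
       (simp add: indicator_def)
  have mm: "measure lborel {x. x + w \<in> A} = measure lborel A" for w by (simp add: measure_def em)
  have int: "(\<integral>x. norm (indicator A (x + w) *\<^sub>R c - indicator A x *\<^sub>R c) \<partial>lborel)
      = norm c * (2 * (measure lborel A - measure lborel ({x. x + w \<in> A} \<inter> A)))" for w
  proof -
    have "emeasure lborel ({x. x + w \<in> A} \<inter> A) < \<infinity>"
      by (rule le_less_trans[OF emeasure_mono fin]) auto
    then show ?thesis unfolding eq using fin em[of w] mm[of w] by (simp add: algebra_simps)
  qed
  have lim: "(\<lambda>i. measure lborel ({x. x + v i \<in> A} \<inter> A)) \<longlonglongrightarrow> measure lborel A"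
  proof (rule LIMSEQ_I)
    fix e :: real assume "e > 0"
    then have e2: "e / 2 > 0" by simp
    obtain U where U: "open U" "A \<subseteq> U" "emeasure lborel (U - A) < ennreal (e / 2)"
      using outer_regular_lborel[OF A e2] by blast
    have [measurable]: "U \<in> sets borel" using U(1) by simp
    have UA: "U - A \<in> fmeasurable lborel" using U(3) by (auto simp: fmeasurable_def intro: less_trans[OF _ ennreal_less_top])
    have shiftU [measurable]: "{x. x + w \<in> B} \<in> sets borel" if "B \<in> sets borel" for w and B :: "'a set"
      using measurable_sets_borel[of "\<lambda>y. y + w" borel B] that by (simp add: vimage_def)
    have emU: "emeasure lborel {x. x + w \<in> U - A} = emeasure lborel (U - A)" for w
      using nn_integral_shift[of "indicator (U - A)" w] by (simp add: indicator_def[of "U - A"] flip: nn_integral_indicator) 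
         (simp add: indicator_def)
    have "(\<lambda>i. \<integral>x. indicator A x * indicator U (x + v i) \<partial>lborel) \<longlonglongrightarrow> (\<integral>x. (indicator A x :: real) \<partial>lborel)"
    proof (rule integral_dominated_convergence)
      show "integrable lborel (\<lambda>x. indicator A x :: real)" using fin by simp
      show "AE x in lborel. (\<lambda>i. indicator A x * indicator U (x + v i)) \<longlonglongrightarrow> (indicator A x :: real)"
      proof (intro AE_I2)
        fix x
        show "(\<lambda>i. indicator A x * indicator U (x + v i)) \<longlonglongrightarrow> (indicator A x :: real)"
        proof (cases "x \<in> A")
          case True
          have "(\<lambda>i. x + v i) \<longlonglongrightarrow> x" using tendsto_add[OF tendsto_const assms(2), of x] by simp
          then have "\<forall>\<^sub>F i in sequentially. x + v i \<in> U" using topological_tendstoD U(1,2) True by blast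
          then have "\<forall>\<^sub>F i in sequentially. indicator A x * indicator U (x + v i) = (indicator A x :: real)"
            by eventually_elim simp
          then show ?thesis by (rule tendsto_eventually)
        qed simp
      qed
    qed (auto split: split_indicator)
    moreover have "(\<integral>x. indicator A x * indicator U (x + w) \<partial>lborel) = measure lborel (A \<inter> {x. x + w \<in> U})" for w
    proof -
      have "(\<lambda>x. indicator A x * indicator U (x + w) :: real) = indicator (A \<inter> {x. x + w \<in> U})"
        by (auto simp: fun_eq_iff split: split_indicator)
      then show ?thesis by simp
    qed
    ultimately have "(\<lambda>i. measure lborel (A \<inter> {x. x + v i \<in> U})) \<longlonglongrightarrow> measure lborel A" by simp
    from LIMSEQ_D[OF this e2] obtain N where N: "\<And>n. n \<ge> N \<Longrightarrow>
        norm (measure lborel (A \<inter> {x. x + v n \<in> U}) - measure lborel A) < e / 2" by blast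
    have Af: "A \<inter> S \<in> fmeasurable lborel" if "S \<in> sets borel" for S
      using that fin by (intro fmeasurableI) (auto intro: le_less_trans[OF emeasure_mono])
    have "norm (measure lborel ({x. x + v n \<in> A} \<inter> A) - measure lborel A) < e" if "n \<ge> N" for n
    proof -
      have d: "{x. x + v n \<in> U - A} \<in> fmeasurable lborel"
        using UA emU[of "v n"] by (auto simp: fmeasurable_def)
      have "measure lborel (A \<inter> {x. x + v n \<in> U}) \<le> measure lborel ((A \<inter> {x. x + v n \<in> A}) \<union> {x. x + v n \<in> U - A})"
        by (rule measure_mono_fmeasurable) (use Af d in \<open>auto intro: fmeasurable.Un\<close>)
      also have "\<dots> \<le> measure lborel (A \<inter> {x. x + v n \<in> A}) + measure lborel {x. x + v n \<in> U - A}"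
        by (rule measure_Un_le) auto
      also have "measure lborel {x. x + v n \<in> U - A} = measure lborel (U - A)"
        using emU[of "v n"] by (simp add: measure_def)
      also have "measure lborel (U - A) < e / 2"
        using U(3) unfolding emeasure_eq_measure2[OF UA] by (simp add: ennreal_less_iff)
      finally have "measure lborel (A \<inter> {x. x + v n \<in> U}) < measure lborel (A \<inter> {x. x + v n \<in> A}) + e / 2" by simp
      moreover have "measure lborel (A \<inter> {x. x + v n \<in> A}) \<le> measure lborel A"
        by (rule measure_mono_fmeasurable) (use Af[of UNIV] in auto)
      ultimately show ?thesis using N[OF that] unfolding real_norm_def Int_commute[of _ A] by linarith
    qed
    then show "\<exists>no. \<forall>n\<ge>no. norm (measure lborel ({x. x + v n \<in> A} \<inter> A) - measure lborel A) < e" by blast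
  qed
  show ?case unfolding int
    by (rule tendsto_eq_intros lim | simp)+
next
  case (add f g)
  then have [measurable]: "f \<in> borel_measurable borel" "g \<in> borel_measurable borel"
    by (auto dest: borel_measurable_integrable)
  have i: "integrable lborel (\<lambda>x. norm (h (x + w) - h x))" if "integrable lborel h" for h :: "'a \<Rightarrow> complex" and w
  proof -
    have [measurable]: "h \<in> borel_measurable borel" using borel_measurable_integrable[OF that] by simp
    show ?thesis using that by (intro integrable_norm Bochner_Integration.integrable_diff) (auto simp: integrable_shift)
  qed
  have lim: "(\<lambda>i. (\<integral>x. norm (f (x + v i) - f x) \<partial>lborel) + (\<integral>x. norm (g (x + v i) - g x) \<partial>lborel)) \<longlonglongrightarrow> 0"
    using tendsto_add[OF add(3,4)] by simp
  show ?case
  proof (rule tendsto_sandwich[OF _ _ tendsto_const lim], simp, intro always_eventually allI)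
    fix n
    have "(\<integral>x. norm (f (x + v n) + g (x + v n) - (f x + g x)) \<partial>lborel)
        \<le> (\<integral>x. norm (f (x + v n) - f x) + norm (g (x + v n) - g x) \<partial>lborel)"
    proof (rule integral_mono)
      show "integrable lborel (\<lambda>x. norm (f (x + v n) + g (x + v n) - (f x + g x)))"
        using i[OF Bochner_Integration.integrable_add[OF add(1,2)], of "v n"] by simp
      show "norm (f (x + v n) + g (x + v n) - (f x + g x)) \<le> norm (f (x + v n) - f x) + norm (g (x + v n) - g x)" for x
        by (rule norm_diff_triangle_ineq[of _ _ "f x" "g x", THEN order_trans]) simp
    qed (use i[OF add(1)] i[OF add(2)] in auto)
    then show "(\<integral>x. norm (f (x + v n) + g (x + v n) - (f x + g x)) \<partial>lborel)
       \<le> (\<integral>x. norm (f (x + v n) - f x) \<partial>lborel) + (\<integral>x. norm (g (x + v n) - g x) \<partial>lborel)"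
      using i[OF add(1)] i[OF add(2)] by simp
  qed
next
  case (lim f s)
  have [measurable]: "f \<in> borel_measurable borel" "s i \<in> borel_measurable borel" for i
    using lim.hyps(1,4) by (auto dest: borel_measurable_integrable)
  note [measurable] = \<open>\<And>i. s i \<in> borel_measurable borel\<close>
  have fi: "integrable lborel f" and si: "\<And>i. integrable lborel (s i)" using lim by auto
  have "(\<lambda>i. \<integral>x. norm (s i x - f x) \<partial>lborel) \<longlonglongrightarrow> (\<integral>x. 0 \<partial>(lborel :: 'a measure))"
  proof (rule integral_dominated_convergence)
    show "integrable lborel (\<lambda>x. 3 * norm (f x))" using fi by simp
    show "AE x in lborel. (\<lambda>i. norm (s i x - f x)) \<longlonglongrightarrow> 0"
      using lim by (intro AE_I2) (auto simp: tendsto_norm_zero_iff LIM_zero_iff)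
    show "AE x in lborel. norm (norm (s i x - f x)) \<le> 3 * norm (f x)" for i
    proof (intro AE_I2)
      fix x show "norm (norm (s i x - f x)) \<le> 3 * norm (f x)"
        using lim(3)[of x i] norm_triangle_ineq4[of "s i x" "f x"] by simp
    qed
  qed simp_all
  then have l0: "(\<lambda>i. \<integral>x. norm (s i x - f x) \<partial>lborel) \<longlonglongrightarrow> 0" by simp
  show ?case
  proof (rule LIMSEQ_I)
    fix e :: real assume "e > 0"
    then have "e / 4 > 0" by simp
    then obtain j where j: "(\<integral>x. norm (s j x - f x) \<partial>lborel) < e / 4"
      using LIMSEQ_D[OF l0, of "e / 4"] by fastforce
    obtain N where N: "\<And>n. n \<ge> N \<Longrightarrow> norm (\<integral>x. norm (s j (x + v n) - s j x) \<partial>lborel) < e / 4"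
      using LIMSEQ_D[OF lim.IH[of j] \<open>e / 4 > 0\<close>] by fastforce
    have "norm (\<integral>x. norm (f (x + v n) - f x) \<partial>lborel) < e" if "n \<ge> N" for n
    proof -
      let ?d = "\<lambda>x. norm (s j x - f x)"
      have di: "integrable lborel ?d" using fi si by simp
      have di': "integrable lborel (\<lambda>x. ?d (x + v n))" using di by (subst integrable_shift) auto
      have ssi: "integrable lborel (\<lambda>x. norm (s j (x + v n) - s j x))"
        by (intro integrable_norm Bochner_Integration.integrable_diff) (auto simp: integrable_shift si)
      have "(\<integral>x. norm (f (x + v n) - f x) \<partial>lborel)
          \<le> (\<integral>x. ?d (x + v n) + norm (s j (x + v n) - s j x) + ?d x \<partial>lborel)"
      proof (rule integral_mono)
        show "integrable lborel (\<lambda>x. norm (f (x + v n) - f x))"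
          by (intro integrable_norm Bochner_Integration.integrable_diff) (auto simp: integrable_shift fi)
        fix x
        have "f (x + v n) - f x = - (s j (x + v n) - f (x + v n)) + (s j (x + v n) - s j x) + (s j x - f x)" by simp
        also have "norm \<dots> \<le> ?d (x + v n) + norm (s j (x + v n) - s j x) + ?d x"
          by (intro order_trans[OF norm_triangle_ineq] add_mono) (auto simp: norm_minus_commute)
        finally show "norm (f (x + v n) - f x) \<le> ?d (x + v n) + norm (s j (x + v n) - s j x) + ?d x" .
      qed (use di di' ssi in auto)
      also have "\<dots> = (\<integral>x. ?d x \<partial>lborel) + (\<integral>x. norm (s j (x + v n) - s j x) \<partial>lborel) + (\<integral>x. ?d x \<partial>lborel)"
        using di di' ssi integral_shift[of ?d "v n"] by simp
      also have "\<dots> < e" using j N[OF that] \<open>e > 0\<close> by simp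
      finally show ?thesis by simp
    qed
    then show "\<exists>no. \<forall>n\<ge>no. norm ((\<integral>x. norm (f (x + v n) - f x) \<partial>lborel) - 0) < e" by auto
  qed
qed

section \<open>Plancherel's formula for bounded integrable functions\<close>

lemma measurable_cnj [measurable]: "cnj \<in> borel_measurable borel"
  by (intro borel_measurable_continuous_onI continuous_intros)

lemma fourier_lborel:
  assumes [measurable]: "f \<in> borel_measurable borel"
  shows "fourier f \<xi> = (\<integral>x. f x * cis (- (2 * pi * (x \<bullet> \<xi>))) \<partial>lborel)"
proof -
  have "exp (- (2 * complex_of_real pi * \<i> * complex_of_real (x \<bullet> \<xi>))) = cis (- (2 * pi * (x \<bullet> \<xi>)))" for x
    by (simp add: cis_conv_exp mult_ac)
  then show ?thesis unfolding fourier_def by (simp add: integral_completion)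
qed

lemma measurable_fourier [measurable]:
  assumes [measurable]: "f \<in> borel_measurable borel"
  shows "fourier f \<in> borel_measurable borel"
proof -
  have "(\<lambda>\<xi>. \<integral>x. f x * cis (- (2 * pi * (x \<bullet> \<xi>))) \<partial>lborel) \<in> borel_measurable borel"
    by (rule lborel.borel_measurable_lebesgue_integral) measurable
  then show ?thesis by (simp add: fourier_lborel[OF assms] cong: measurable_cong)
qed

lemma norm_fourier_le:
  assumes "f \<in> borel_measurable borel"
  shows "norm (fourier f \<xi>) \<le> (\<integral>x. norm (f x) \<partial>lborel)"
  using integral_norm_bound[of lborel "\<lambda>x. f x * cis (- (2 * pi * (x \<bullet> \<xi>)))"]
  by (simp add: fourier_lborel[OF assms] norm_mult)

lemma integrable_bounded_mult:
  fixes f g :: "'a \<Rightarrow> complex"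
  assumes "integrable M f" and "g \<in> borel_measurable M" and "\<And>x. norm (g x) \<le> B"
  shows "integrable M (\<lambda>x. f x * g x)" "integrable M (\<lambda>x. g x * f x)"
proof -
  have B: "0 \<le> B" using assms(3) norm_ge_zero order_trans by blast
  note [measurable] = borel_measurable_integrable[OF assms(1)] assms(2)
  show "integrable M (\<lambda>x. f x * g x)"
  proof (rule Bochner_Integration.integrable_bound)
    show "integrable M (\<lambda>x. B * norm (f x))" using assms(1) by simp
    show "AE x in M. norm (f x * g x) \<le> norm (B * norm (f x))"
    proof (intro AE_I2)
      fix x
      have "norm (f x) * norm (g x) \<le> norm (f x) * B" by (intro mult_left_mono assms(3)) simp
      then show "norm (f x * g x) \<le> norm (B * norm (f x))" using B by (simp add: norm_mult mult.commute[of B])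
    qed
  qed measurable
  then show "integrable M (\<lambda>x. g x * f x)" by (simp add: mult.commute)
qed

lemma integrable_prod_bounded:
  fixes f g :: "real^'n \<Rightarrow> complex" and K :: "(real^'n) \<times> (real^'n) \<Rightarrow> complex"
  assumes f: "integrable lborel f" and g: "integrable lborel g"
    and [measurable]: "K \<in> borel_measurable (borel \<Otimes>\<^sub>M borel)" and K: "\<And>z. norm (K z) \<le> B"
  shows "integrable (lborel \<Otimes>\<^sub>M lborel) (\<lambda>(x, y). f x * g y * K (x, y))"
proof (rule lborel_pair.Fubini_integrable)
  have [measurable]: "f \<in> borel_measurable borel" "g \<in> borel_measurable borel"
    using borel_measurable_integrable f g by auto
  have B: "0 \<le> B" using K norm_ge_zero order_trans by blast
  show "(\<lambda>(x, y). f x * g y * K (x, y)) \<in> borel_measurable (lborel \<Otimes>\<^sub>M lborel)" by measurable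
  have i: "integrable lborel (\<lambda>y. f x * g y * K (x, y))" for x
    unfolding mult.assoc by (intro integrable_mult_right integrable_bounded_mult(1)[OF g _ K]) measurable
  then show "AE x in lborel. integrable lborel (\<lambda>y. case (x, y) of (x, y) \<Rightarrow> f x * g y * K (x, y))" by simp
  have "integrable lborel (\<lambda>x. \<integral>y. norm (f x * g y * K (x, y)) \<partial>lborel)"
  proof (rule Bochner_Integration.integrable_bound)
    show "integrable lborel (\<lambda>x. norm (f x) * ((\<integral>y. norm (g y) \<partial>lborel) * B))" using f by simp
    show "(\<lambda>x. \<integral>y. norm (f x * g y * K (x, y)) \<partial>lborel) \<in> borel_measurable lborel"
      by (rule lborel.borel_measurable_lebesgue_integral) measurable
    have "(\<integral>y. norm (f x * g y * K (x, y)) \<partial>lborel) \<le> (\<integral>y. norm (f x) * (norm (g y) * B) \<partial>lborel)" for x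
    proof (rule integral_mono)
      show "norm (f x * g y * K (x, y)) \<le> norm (f x) * (norm (g y) * B)" for y
        using K by (simp add: norm_mult mult.assoc mult_left_mono)
    qed (use i[of x] g in auto)
    then show "AE x in lborel. norm (\<integral>y. norm (f x * g y * K (x, y)) \<partial>lborel)
        \<le> norm (norm (f x) * ((\<integral>y. norm (g y) \<partial>lborel) * B))"
      using B by (intro AE_I2) (simp add: abs_mult)
  qed
  then show "integrable lborel (\<lambda>x. \<integral>y. norm (case (x, y) of (x, y) \<Rightarrow> f x * g y * K (x, y)) \<partial>lborel)" by simp
qed

text \<open>Both sides are the double integral of \<open>f x * h \<xi>\<close> against a kernel that is symmetric in \<open>x\<close> and \<xi>.\<close>

lemma fourier_multiplication_formula:
  assumes f: "integrable lborel f" and h: "integrable lborel h"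
  shows "(\<integral>\<xi>. fourier f \<xi> * h \<xi> \<partial>lborel) = (\<integral>x. f x * fourier h x \<partial>lborel)"
proof -
  have [measurable]: "f \<in> borel_measurable borel" "h \<in> borel_measurable borel"
    using borel_measurable_integrable f h by auto
  let ?K = "\<lambda>(x, \<xi>). cis (- (2 * pi * (x \<bullet> \<xi>)))"
  have "integrable (lborel \<Otimes>\<^sub>M lborel) (\<lambda>(x, \<xi>). f x * h \<xi> * ?K (x, \<xi>))"
    by (rule integrable_prod_bounded[OF f h, where B = 1]) (auto simp: split_beta)
  then have i: "integrable (lborel \<Otimes>\<^sub>M lborel) (\<lambda>(x, \<xi>). f x * h \<xi> * cis (- (2 * pi * (x \<bullet> \<xi>))))" by simp
  have "(\<integral>\<xi>. fourier f \<xi> * h \<xi> \<partial>lborel) = (\<integral>\<xi>. (\<integral>x. f x * h \<xi> * cis (- (2 * pi * (x \<bullet> \<xi>))) \<partial>lborel) \<partial>lborel)"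
    by (simp add: fourier_lborel mult_ac flip: integral_mult_right_zero)
  also have "\<dots> = (\<integral>x. (\<integral>\<xi>. f x * h \<xi> * cis (- (2 * pi * (x \<bullet> \<xi>))) \<partial>lborel) \<partial>lborel)"
    by (rule lborel_pair.Fubini_integral[OF i])
  also have "\<dots> = (\<integral>x. f x * fourier h x \<partial>lborel)"
    by (simp add: fourier_lborel mult.assoc inner_commute)
  finally show ?thesis .
qed

text \<open>Fourier inversion with a Gaussian weight: the multiplication formula moves the transform from \<open>g\<close> to
  a modulated Gaussian, whose transform is the translated kernel.\<close>

lemma gauss_inversion:
  assumes g: "integrable lborel g"
  shows "(\<integral>\<xi>. fourier g \<xi> * (complex_of_real (gauss k \<xi>) * cis (2 * pi * (\<xi> \<bullet> x))) \<partial>lborel)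
       = (\<integral>v. g (x + v) * complex_of_real (gauss_kernel k v) \<partial>lborel)"
proof -
  have [measurable]: "g \<in> borel_measurable borel" using borel_measurable_integrable g by auto
  let ?h = "\<lambda>\<xi>. complex_of_real (gauss k \<xi>) * cis (2 * pi * (\<xi> \<bullet> x))"
  have h: "integrable lborel ?h"
    using integrable_gauss_char[of k "- x"] by simp
  have F: "fourier ?h y = complex_of_real (gauss_kernel k (y - x))" for y
  proof -
    have "fourier ?h y = (\<integral>\<xi>. complex_of_real (gauss k \<xi>) * cis (- (2 * pi * (\<xi> \<bullet> (y - x)))) \<partial>lborel)"
      by (subst fourier_lborel) (auto simp: mult.assoc cis_mult inner_diff_right algebra_simps)
    then show ?thesis by (simp add: gauss_char)
  qed
  have "(\<integral>\<xi>. fourier g \<xi> * ?h \<xi> \<partial>lborel) = (\<integral>y. g y * complex_of_real (gauss_kernel k (y - x)) \<partial>lborel)"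
    by (simp add: fourier_multiplication_formula[OF g h] F)
  also have "\<dots> = (\<integral>v. g (v + x) * complex_of_real (gauss_kernel k (v + x - x)) \<partial>lborel)"
    by (rule integral_shift[symmetric, where f = "\<lambda>y. g y * complex_of_real (gauss_kernel k (y - x))"]) measurable
  finally show ?thesis by (simp add: add.commute)
qed

text \<open>On this class, which contains the indicators of all sets of finite measure, the transform is an
  absolutely convergent integral and the functions are also square integrable; it is large enough for
  every density argument below.\<close>

definition bounded_integrable :: "(real^'n \<Rightarrow> complex) \<Rightarrow> bool" where
  "bounded_integrable f \<longleftrightarrow> f \<in> borel_measurable borel \<and> integrable lborel f \<and> (\<exists>B. \<forall>x. norm (f x) \<le> B)"

lemma bounded_integrableD:
  assumes "bounded_integrable f"
  shows "f \<in> borel_measurable borel" "integrable lborel f" "\<exists>B. \<forall>x. norm (f x) \<le> B"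
  using assms by (auto simp: bounded_integrable_def)

text \<open>The left-hand side is the average of the correlation \<open>\<phi> v = \<integral> f x * cnj (g (x + v))\<close> against a kernel
  that concentrates at \<open>0\<close>, and \<phi> is continuous at \<open>0\<close> because translation is continuous in \<open>L\<^sup>1\<close> and
  \<open>f\<close> is bounded.\<close>

lemma gauss_average_tendsto:
  fixes f g :: "real^'n \<Rightarrow> complex"
  assumes f: "bounded_integrable f" and g: "bounded_integrable g"
  shows "(\<lambda>k. \<integral>x. f x * cnj (\<integral>v. g (x + v) * complex_of_real (gauss_kernel k v) \<partial>lborel) \<partial>lborel)
     \<longlonglongrightarrow> (\<integral>x. f x * cnj (g x) \<partial>lborel)"
proof -
  note [measurable] = bounded_integrableD(1)[OF f] bounded_integrableD(1)[OF g]
  note fi = bounded_integrableD(2)[OF f] and gi = bounded_integrableD(2)[OF g]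
  obtain M where M: "\<And>x. norm (f x) \<le> M" using f by (auto simp: bounded_integrable_def)
  obtain B where B: "\<And>x. norm (g x) \<le> B" using g by (auto simp: bounded_integrable_def)
  have M0: "M \<ge> 0" using M norm_ge_zero order_trans by blast
  define \<phi> where "\<phi> v = (\<integral>x. f x * cnj (g (x + v)) \<partial>lborel)" for v
  have m\<phi> [measurable]: "\<phi> \<in> borel_measurable borel"
    unfolding \<phi>_def[abs_def] by (rule lborel.borel_measurable_lebesgue_integral) measurable
  have int\<phi>: "integrable lborel (\<lambda>x. f x * cnj (g (x + v)))" for v
    by (rule integrable_bounded_mult(1)[OF fi, where B = B]) (auto simp: B)
  have \<phi>_lim: "(\<lambda>i. \<phi> (v i)) \<longlonglongrightarrow> \<phi> 0" if "v \<longlonglongrightarrow> 0" for v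
  proof (rule LIM_zero_cancel, rule tendsto_norm_zero_cancel, rule tendsto_sandwich[OF _ _ tendsto_const])
    show "(\<lambda>i. M * (\<integral>x. norm (g (x + v i) - g x) \<partial>lborel)) \<longlonglongrightarrow> 0"
      using tendsto_mult_left[OF translation_continuous_L1[OF gi that], of M] by simp
    show "\<forall>\<^sub>F i in sequentially. norm (\<phi> (v i) - \<phi> 0) \<le> M * (\<integral>x. norm (g (x + v i) - g x) \<partial>lborel)"
    proof (intro always_eventually allI)
      fix i
      have gd: "integrable lborel (\<lambda>x. g (x + v i) - g x)"
        using gi by (intro Bochner_Integration.integrable_diff) (auto simp: integrable_shift)
      have "\<phi> (v i) - \<phi> 0 = (\<integral>x. f x * cnj (g (x + v i) - g x) \<partial>lborel)"
        using int\<phi>[of "v i"] int\<phi>[of 0] by (simp add: \<phi>_def right_diff_distrib)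
      also have "norm \<dots> \<le> (\<integral>x. M * norm (g (x + v i) - g x) \<partial>lborel)"
      proof (rule Bochner_Integration.integral_norm_bound_integral)
        show "integrable lborel (\<lambda>x. M * norm (g (x + v i) - g x))" using gd by simp
        show "integrable lborel (\<lambda>x. f x * cnj (g (x + v i) - g x))"
          using Bochner_Integration.integrable_diff[OF int\<phi>[of "v i"] int\<phi>[of 0]] by (simp add: right_diff_distrib)
        show "norm (f x * cnj (g (x + v i) - g x)) \<le> M * norm (g (x + v i) - g x)" for x
          unfolding norm_mult complex_mod_cnj by (rule mult_right_mono[OF M norm_ge_zero])
      qed
      finally show "norm (\<phi> (v i) - \<phi> 0) \<le> M * (\<integral>x. norm (g (x + v i) - g x) \<partial>lborel)" by simp
    qed
  qed simp
  have \<phi>_bound: "norm (\<phi> v) \<le> M * (\<integral>x. norm (g x) \<partial>lborel)" for v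
  proof -
    have "norm (\<phi> v) \<le> (\<integral>x. M * norm (g (x + v)) \<partial>lborel)"
      unfolding \<phi>_def
    proof (rule Bochner_Integration.integral_norm_bound_integral[OF int\<phi>])
      show "integrable lborel (\<lambda>x. M * norm (g (x + v)))" using gi by (simp add: integrable_shift)
      show "norm (f x * cnj (g (x + v))) \<le> M * norm (g (x + v))" for x
        unfolding norm_mult complex_mod_cnj by (rule mult_right_mono[OF M norm_ge_zero])
    qed
    then show ?thesis using integral_shift[of "\<lambda>x. norm (g x)" v] by simp
  qed
  have fold: "(\<integral>x. f x * cnj (\<integral>v. g (x + v) * complex_of_real (gauss_kernel k v) \<partial>lborel) \<partial>lborel)
      = (\<integral>u. complex_of_real (gauss 0 u) * \<phi> ((1 / real (Suc k)) *\<^sub>R u) \<partial>lborel)" for k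
  proof -
    have "integrable (lborel \<Otimes>\<^sub>M lborel) (\<lambda>(x, v). f x * complex_of_real (gauss_kernel k v) * (\<lambda>(x, v). cnj (g (x + v))) (x, v))"
      by (rule integrable_prod_bounded[OF fi, where B = B]) (auto simp: split_beta B integrable_gauss_kernel)
    then have i: "integrable (lborel \<Otimes>\<^sub>M lborel) (\<lambda>(x, v). f x * complex_of_real (gauss_kernel k v) * cnj (g (x + v)))" by simp
    have "(\<integral>x. f x * cnj (\<integral>v. g (x + v) * complex_of_real (gauss_kernel k v) \<partial>lborel) \<partial>lborel)
        = (\<integral>x. (\<integral>v. f x * complex_of_real (gauss_kernel k v) * cnj (g (x + v)) \<partial>lborel) \<partial>lborel)"
    proof (rule arg_cong[where f = "integral\<^sup>L lborel"], rule ext)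
      fix x
      have "cnj (\<integral>v. g (x + v) * complex_of_real (gauss_kernel k v) \<partial>lborel)
          = (\<integral>v. cnj (g (x + v) * complex_of_real (gauss_kernel k v)) \<partial>lborel)"
        by (rule Bochner_Integration.integral_cnj[symmetric])
      then show "f x * cnj (\<integral>v. g (x + v) * complex_of_real (gauss_kernel k v) \<partial>lborel)
          = (\<integral>v. f x * complex_of_real (gauss_kernel k v) * cnj (g (x + v)) \<partial>lborel)"
        by (simp add: mult.assoc mult.commute[of "cnj _"] del: Bochner_Integration.integral_cnj)
    qed
    also have "\<dots> = (\<integral>v. (\<integral>x. f x * complex_of_real (gauss_kernel k v) * cnj (g (x + v)) \<partial>lborel) \<partial>lborel)"
      by (rule lborel_pair.Fubini_integral[OF i, symmetric])
    also have "\<dots> = (\<integral>v. complex_of_real (gauss_kernel k v) * \<phi> v \<partial>lborel)"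
      by (simp add: \<phi>_def mult_ac flip: integral_mult_right_zero)
    also have "\<dots> = \<bar>1 / real (Suc k)\<bar> ^ DIM(real^'n) *\<^sub>R
        (\<integral>u. complex_of_real (gauss_kernel k ((1 / real (Suc k)) *\<^sub>R u)) * \<phi> ((1 / real (Suc k)) *\<^sub>R u) \<partial>lborel)"
      using integral_scale[of "\<lambda>v. complex_of_real (gauss_kernel k v) * \<phi> v" "1 / real (Suc k)"] by simp
    also have "\<dots> = (\<integral>u. complex_of_real (gauss 0 u) * \<phi> ((1 / real (Suc k)) *\<^sub>R u) \<partial>lborel)"
      by (subst gauss_kernel_scale)
         (simp add: gauss_0 power_one_over scaleR_conv_of_real mult.assoc del: of_nat_Suc)
    finally show ?thesis .
  qed
  have "(\<lambda>k. \<integral>u. complex_of_real (gauss 0 u) * \<phi> ((1 / real (Suc k)) *\<^sub>R u) \<partial>lborel)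
      \<longlonglongrightarrow> (\<integral>u. complex_of_real (gauss 0 (u::real^'n)) * \<phi> 0 \<partial>lborel)"
  proof (rule integral_dominated_convergence)
    show "integrable lborel (\<lambda>u. gauss 0 (u::real^'n) * (M * (\<integral>x. norm (g x) \<partial>lborel)))"
      by (intro integrable_mult_left integrable_gauss)
    show "AE u in lborel. (\<lambda>k. complex_of_real (gauss 0 u) * \<phi> ((1 / real (Suc k)) *\<^sub>R u)) \<longlonglongrightarrow> complex_of_real (gauss 0 u) * \<phi> 0"
    proof (intro AE_I2 tendsto_mult_left \<phi>_lim)
      fix u :: "real^'n"
      show "(\<lambda>k. (1 / real (Suc k)) *\<^sub>R u) \<longlonglongrightarrow> 0"
        using tendsto_scaleR[OF LIMSEQ_inverse_real_of_nat tendsto_const, of u] by (simp add: inverse_eq_divide)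
    qed
    show "AE u in lborel. norm (complex_of_real (gauss 0 u) * \<phi> ((1 / real (Suc k)) *\<^sub>R u))
        \<le> gauss 0 u * (M * (\<integral>x. norm (g x) \<partial>lborel))" for k
      by (intro AE_I2) (simp add: norm_mult abs_of_pos[OF gauss_bounds(1)] mult_left_mono[OF \<phi>_bound less_imp_le[OF gauss_bounds(1)]])
  qed measurable
  moreover have "(\<integral>u. complex_of_real (gauss 0 (u::real^'n)) * \<phi> 0 \<partial>lborel) = (\<integral>x. f x * cnj (g x) \<partial>lborel)"
    using integral_gauss_0[where 'a = "real^'n"] by (simp add: \<phi>_def)
  ultimately show ?thesis by (simp only: fold)
qed

lemma integrable_sq_mult:
  fixes f g :: "'a \<Rightarrow> complex"
  assumes [measurable]: "f \<in> borel_measurable M" "g \<in> borel_measurable M"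
    and "integrable M (\<lambda>x. (norm (f x))\<^sup>2)" "integrable M (\<lambda>x. (norm (g x))\<^sup>2)"
  shows "integrable M (\<lambda>x. f x * cnj (g x))"
proof (rule Bochner_Integration.integrable_bound)
  show "integrable M (\<lambda>x. (norm (f x))\<^sup>2 + (norm (g x))\<^sup>2)" using assms by simp
  show "AE x in M. norm (f x * cnj (g x)) \<le> norm ((norm (f x))\<^sup>2 + (norm (g x))\<^sup>2)"
  proof (intro AE_I2)
    fix x
    have "norm (f x) * norm (g x) * 2 \<le> (norm (f x))\<^sup>2 + (norm (g x))\<^sup>2"
      using sum_squares_bound[of "norm (f x)" "norm (g x)"] by (simp add: mult_ac)
    moreover have "0 \<le> norm (f x) * norm (g x)" by simp
    ultimately show "norm (f x * cnj (g x)) \<le> norm ((norm (f x))\<^sup>2 + (norm (g x))\<^sup>2)"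
      unfolding norm_mult complex_mod_cnj real_norm_def by linarith
  qed
qed measurable

lemma bounded_integrable_sq:
  assumes "bounded_integrable f"
  shows "integrable lborel (\<lambda>x. (norm (f x))\<^sup>2)"
proof -
  obtain B where B: "\<And>x. norm (f x) \<le> B" using assms by (auto simp: bounded_integrable_def)
  note [measurable] = bounded_integrableD(1)[OF assms]
  have "integrable lborel (\<lambda>x. f x * cnj (f x))"
    by (rule integrable_bounded_mult(1)[OF bounded_integrableD(2)[OF assms], where B = B]) (auto simp: B)
  then have "integrable lborel (\<lambda>x. norm (f x * cnj (f x)))" by (rule integrable_norm)
  then show ?thesis by (simp add: norm_mult power2_eq_square)
qed

lemma fourier_gauss_tendsto:
  assumes f: "bounded_integrable f" and g: "bounded_integrable g"
  shows "(\<lambda>k. \<integral>\<xi>. fourier f \<xi> * cnj (fourier g \<xi>) * complex_of_real (gauss k \<xi>) \<partial>lborel)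
     \<longlonglongrightarrow> (\<integral>x. f x * cnj (g x) \<partial>lborel)"
proof -
  note [measurable] = bounded_integrableD(1)[OF f] bounded_integrableD(1)[OF g]
  note fi = bounded_integrableD(2)[OF f] and gi = bounded_integrableD(2)[OF g]
  have "(\<integral>\<xi>. fourier f \<xi> * cnj (fourier g \<xi>) * complex_of_real (gauss k \<xi>) \<partial>lborel)
      = (\<integral>x. f x * cnj (\<integral>v. g (x + v) * complex_of_real (gauss_kernel k v) \<partial>lborel) \<partial>lborel)" for k
  proof -
    let ?h = "\<lambda>\<xi>. complex_of_real (gauss k \<xi>) * cnj (fourier g \<xi>)"
    have h: "integrable lborel ?h"
      by (rule integrable_bounded_mult(1)[where B = "\<integral>x. norm (g x) \<partial>lborel"]) (auto simp: norm_fourier_le integrable_gauss)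
    have "fourier ?h x = cnj (\<integral>v. g (x + v) * complex_of_real (gauss_kernel k v) \<partial>lborel)" for x
      unfolding gauss_inversion[OF gi, symmetric]
      by (subst fourier_lborel[of ?h], measurable, subst Bochner_Integration.integral_cnj[symmetric])
         (simp add: cis_cnj mult_ac del: Bochner_Integration.integral_cnj)
    then have "(\<integral>\<xi>. fourier f \<xi> * ?h \<xi> \<partial>lborel)
      = (\<integral>x. f x * cnj (\<integral>v. g (x + v) * complex_of_real (gauss_kernel k v) \<partial>lborel) \<partial>lborel)"
      by (simp add: fourier_multiplication_formula[OF fi h])
    then show ?thesis by (simp add: mult_ac)
  qed
  then show ?thesis using gauss_average_tendsto[OF f g] by simp
qed

text \<open>With the weight \<open>gauss k\<close> the integrals converge by the preceding lemma, and the weights increase to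
  \<open>1\<close>, so monotone convergence removes them.\<close>

lemma fourier_sq_integrable:
  assumes f: "bounded_integrable f"
  shows "integrable lborel (\<lambda>\<xi>. (norm (fourier f \<xi>))\<^sup>2)"
proof (rule integrable_monotone_convergence)
  note [measurable] = bounded_integrableD(1)[OF f]
  let ?F = "\<lambda>k \<xi>. (norm (fourier f \<xi>))\<^sup>2 * gauss k \<xi>"
  let ?B = "\<integral>x. norm (f x) \<partial>lborel"
  show "integrable lborel (?F k)" for k
  proof (rule Bochner_Integration.integrable_bound)
    show "integrable lborel (\<lambda>\<xi>. ?B\<^sup>2 * gauss k \<xi> :: real)" by (intro integrable_mult_right integrable_gauss)
    show "AE \<xi> in lborel. norm (?F k \<xi>) \<le> norm (?B\<^sup>2 * gauss k \<xi>)"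
      using norm_fourier_le[of f] gauss_bounds(1)[of k]
      by (intro AE_I2) (simp add: abs_mult less_imp_le mult_right_mono power_mono)
  qed measurable
  show "AE \<xi> in lborel. mono (\<lambda>k. ?F k \<xi>)"
    by (intro AE_I2 incseq_SucI mult_left_mono gauss_mono) auto
  show "AE \<xi> in lborel. (\<lambda>k. ?F k \<xi>) \<longlonglongrightarrow> (norm (fourier f \<xi>))\<^sup>2"
    using tendsto_mult_left[OF gauss_tendsto] by (intro AE_I2) fastforce
  have "(\<lambda>k. Re (\<integral>\<xi>. fourier f \<xi> * cnj (fourier f \<xi>) * complex_of_real (gauss k \<xi>) \<partial>lborel))
      \<longlonglongrightarrow> Re (\<integral>x. f x * cnj (f x) \<partial>lborel)"
    by (intro tendsto_Re fourier_gauss_tendsto f)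
  moreover have "(\<integral>\<xi>. fourier f \<xi> * cnj (fourier f \<xi>) * complex_of_real (gauss k \<xi>) \<partial>lborel) = complex_of_real (\<integral>\<xi>. ?F k \<xi> \<partial>lborel)" for k
    unfolding complex_norm_square[symmetric] of_real_mult[symmetric] by (rule integral_complex_of_real)
  ultimately show "(\<lambda>k. \<integral>\<xi>. ?F k \<xi> \<partial>lborel) \<longlonglongrightarrow> Re (\<integral>x. f x * cnj (f x) \<partial>lborel)" by simp
qed (use bounded_integrableD(1)[OF f] in measurable)

theorem plancherel:
  assumes f: "bounded_integrable f" and g: "bounded_integrable g"
  shows "(\<integral>\<xi>. fourier f \<xi> * cnj (fourier g \<xi>) \<partial>lborel) = (\<integral>x. f x * cnj (g x) \<partial>lborel)"
proof (rule LIMSEQ_unique[OF _ fourier_gauss_tendsto[OF f g]])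
  note [measurable] = bounded_integrableD(1)[OF f] bounded_integrableD(1)[OF g]
  have i: "integrable lborel (\<lambda>\<xi>. fourier f \<xi> * cnj (fourier g \<xi>))"
    by (rule integrable_sq_mult) (use fourier_sq_integrable f g in auto)
  show "(\<lambda>k. \<integral>\<xi>. fourier f \<xi> * cnj (fourier g \<xi>) * complex_of_real (gauss k \<xi>) \<partial>lborel)
     \<longlonglongrightarrow> (\<integral>\<xi>. fourier f \<xi> * cnj (fourier g \<xi>) \<partial>lborel)"
  proof (rule integral_dominated_convergence)
    show "integrable lborel (\<lambda>\<xi>. norm (fourier f \<xi> * cnj (fourier g \<xi>)))" using i by (rule integrable_norm)
    show "AE \<xi> in lborel. (\<lambda>k. fourier f \<xi> * cnj (fourier g \<xi>) * complex_of_real (gauss k \<xi>)) \<longlonglongrightarrow> fourier f \<xi> * cnj (fourier g \<xi>)"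
      using tendsto_mult_left[OF tendsto_of_real[OF gauss_tendsto]] by (intro AE_I2) fastforce
    show "AE \<xi> in lborel. norm (fourier f \<xi> * cnj (fourier g \<xi>) * complex_of_real (gauss k \<xi>)) \<le> norm (fourier f \<xi> * cnj (fourier g \<xi>))" for k
      by (intro AE_I2) (simp add: norm_mult abs_of_pos[OF gauss_bounds(1)] mult_left_le gauss_bounds(2))
  qed measurable
qed

section \<open>A common transversal of two equivalence relations\<close>

definition open_cone :: "('n \<Rightarrow> real^'n) \<Rightarrow> (real^'n) set" where
  "open_cone \<alpha> = {v. \<forall>i. v \<bullet> \<alpha> i > 0}"

definition transversal :: "('a \<Rightarrow> 'a \<Rightarrow> bool) \<Rightarrow> 'a set \<Rightarrow> 'a set \<Rightarrow> bool" where
  "transversal R U E \<longleftrightarrow> E \<subseteq> U \<and> (\<forall>x\<in>U. \<exists>!y. y \<in> E \<and> R x y)"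

definition packing :: "('a \<Rightarrow> 'a \<Rightarrow> bool) \<Rightarrow> 'a set \<Rightarrow> bool" where
  "packing R E \<longleftrightarrow> (\<forall>x\<in>E. \<forall>y\<in>E. R x y \<longrightarrow> x = y)"

definition saturation :: "('a \<Rightarrow> 'a \<Rightarrow> bool) \<Rightarrow> 'a set \<Rightarrow> 'a set" where
  "saturation R X = {y. \<exists>x\<in>X. R x y}"

lemma transversal_packing:
  assumes "transversal R U E" "\<And>x. R x x"
  shows "packing R E"
  unfolding packing_def
proof (intro ballI impI)
  fix x y assume "x \<in> E" "y \<in> E" "R x y"
  moreover have "\<exists>!z. z \<in> E \<and> R x z" using assms(1) \<open>x \<in> E\<close> unfolding transversal_def by blast
  ultimately show "x = y" using assms(2)[of x] by blast
qed

text \<open>The argument of Cantor, Schroeder and Bernstein. Starting from \<open>E\<close>, a set \<open>X \<subseteq> E\<close> of representatives is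
  kept, and all \<open>R2\<close>-classes not met by \<open>X\<close> are represented by points of \<open>T\<close>; this is consistent with
  \<open>R1\<close> exactly if \<open>X\<close> is a fixed point of the monotone operator \<Phi>. The union of the iterates
  \<open>\<Phi>\<^sup>n \<emptyset>\<close> is one: as \<open>T\<close> is a packing for \<open>R1\<close>, a point of \<open>E\<close> is related to at most one point of \<open>T\<close>,
  so whether \<Phi> keeps it is decided after finitely many steps. Being a countable union it is measurable.\<close>

lemma common_transversal:
  fixes R1 R2 :: "'a \<Rightarrow> 'a \<Rightarrow> bool"
  assumes R1: "equivp R1" and R2: "equivp R2"
    and E: "transversal R1 U E" "packing R2 E" "E \<in> sets M"
    and T: "transversal R2 UNIV T" "packing R1 T" "T \<subseteq> U" "T \<in> sets M"
    and sat1: "\<And>X. X \<in> sets M \<Longrightarrow> saturation R1 X \<in> sets M"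
    and sat2: "\<And>X. X \<in> sets M \<Longrightarrow> saturation R2 X \<in> sets M"
  shows "\<exists>\<Omega>\<in>sets M. transversal R1 U \<Omega> \<and> transversal R2 UNIV \<Omega>"
proof -
  note s1 = equivp_symp[OF R1] and t1 = equivp_transp[OF R1] and s2 = equivp_symp[OF R2] and t2 = equivp_transp[OF R2]
  have pE1: "packing R1 E" using transversal_packing[OF E(1)] equivp_reflp[OF R1] by blast
  have pT2: "packing R2 T" using transversal_packing[OF T(1)] equivp_reflp[OF R2] by blast
  define \<Phi> where "\<Phi> X = E - saturation R1 (T - saturation R2 X)" for X
  have mono: "X \<subseteq> Y \<Longrightarrow> \<Phi> X \<subseteq> \<Phi> Y" for X Y unfolding \<Phi>_def saturation_def by blast
  define X where "X = (\<Union>n. (\<Phi> ^^ n) {})"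
  have "(\<Phi> ^^ n) {} \<in> sets M" for n
    by (induction n) (auto simp: \<Phi>_def intro!: sets.Diff E T sat1 sat2)
  then have X: "X \<in> sets M" by (auto simp: X_def)
  have "X \<subseteq> \<Phi> X"
  proof -
    have "(\<Phi> ^^ n) {} \<subseteq> \<Phi> X" for n
    proof (cases n)
      case (Suc m)
      have "(\<Phi> ^^ m) {} \<subseteq> X" by (auto simp: X_def)
      from mono[OF this] show ?thesis by (simp add: Suc)
    qed simp
    then show ?thesis by (auto simp: X_def)
  qed
  moreover have "\<Phi> X \<subseteq> X"
  proof
    fix e assume e: "e \<in> \<Phi> X"
    have "\<exists>n. e \<notin> saturation R1 (T - saturation R2 ((\<Phi> ^^ n) {}))"
    proof (cases "\<exists>t\<in>T. R1 t e")
      case True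
      then obtain t where t: "t \<in> T" "R1 t e" by blast
      then have "t \<in> saturation R2 X" using e by (auto simp: \<Phi>_def saturation_def)
      then obtain n where n: "t \<in> saturation R2 ((\<Phi> ^^ n) {})" by (auto simp: X_def saturation_def)
      have "t' = t" if "t' \<in> T" "R1 t' e" for t'
        using T(2) t that s1 t1 unfolding packing_def by blast
      then show ?thesis using n by (auto simp: saturation_def)
    qed (auto simp: saturation_def)
    then obtain n where "e \<in> (\<Phi> ^^ Suc n) {}" using e by (auto simp: \<Phi>_def)
    then show "e \<in> X" unfolding X_def by blast
  qed
  ultimately have fix_X: "X = E - saturation R1 (T - saturation R2 X)" by (simp add: \<Phi>_def)
  let ?\<Omega> = "X \<union> (T - saturation R2 X)"
  have XE: "X \<subseteq> E" using fix_X by blast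
  have "transversal R1 U ?\<Omega>"
    unfolding transversal_def
  proof (intro conjI ballI)
    show "?\<Omega> \<subseteq> U" using XE E(1) T(3) by (auto simp: transversal_def)
    fix z assume "z \<in> U"
    then obtain e where e: "e \<in> E" "R1 z e" using E(1) by (auto simp: transversal_def)
    show "\<exists>!y. y \<in> ?\<Omega> \<and> R1 z y"
    proof (cases "e \<in> X")
      case True
      then have no: "\<not> R1 t e" if "t \<in> T - saturation R2 X" for t
        using that fix_X by (auto simp: saturation_def)
      have "y = e" if "y \<in> X" "R1 z y" for y
        using that e XE pE1 s1 t1 unfolding packing_def by blast
      moreover have "\<not> R1 z y" if "y \<in> T - saturation R2 X" for y
        using no[OF that] e s1 t1 by blast
      ultimately show ?thesis using True e by blast
    next
      case False
      then obtain t where t: "t \<in> T - saturation R2 X" "R1 t e"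
        using e fix_X unfolding saturation_def by blast
      have "y = t" if "y \<in> T - saturation R2 X" "R1 z y" for y
        using that t e T(2) s1 t1 unfolding packing_def by blast
      moreover have "\<not> R1 z y" if "y \<in> X" for y
        using that False e XE pE1 s1 t1 unfolding packing_def by blast
      moreover have "R1 z t" using t e s1 t1 by blast
      ultimately show ?thesis using t by blast
    qed
  qed
  moreover have "transversal R2 UNIV ?\<Omega>"
    unfolding transversal_def
  proof (intro conjI ballI)
    fix z
    obtain t where t: "t \<in> T" "R2 z t" using T(1) unfolding transversal_def by blast
    show "\<exists>!y. y \<in> ?\<Omega> \<and> R2 z y"
    proof (cases "t \<in> saturation R2 X")
      case True
      then obtain x where x: "x \<in> X" "R2 x t" by (auto simp: saturation_def)
      have "y = x" if "y \<in> X" "R2 z y" for y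
      proof -
        have "R2 y z" using that(2) s2 by blast
        then have "R2 y t" using t(2) t2 by blast
        then have "R2 y x" using s2[OF x(2)] t2 by blast
        then show ?thesis using that(1) x(1) XE E(2) unfolding packing_def by blast
      qed
      moreover have "\<not> R2 z y" if y: "y \<in> T - saturation R2 X" for y
      proof
        assume "R2 z y"
        then have "R2 t y" using s2[OF t(2)] t2 by blast
        then have "t = y" using y t(1) pT2 unfolding packing_def by blast
        then show False using True y by blast
      qed
      moreover have "R2 z x" using x t s2 t2 by blast
      ultimately show ?thesis using x by blast
    next
      case False
      have "y = t" if "y \<in> T - saturation R2 X" "R2 z y" for y
      proof -
        have "R2 y t" using s2[OF that(2)] t(2) t2 by blast
        then show ?thesis using that(1) t(1) pT2 unfolding packing_def by blast
      qed
      moreover have "\<not> R2 z y" if "y \<in> X" for y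
      proof
        assume "R2 z y"
        then have "R2 y t" using s2[of z y] t(2) t2[of y z t] by blast
        then show False using False that unfolding saturation_def by blast
      qed
      ultimately show ?thesis using t False by blast
    qed
  qed simp
  moreover have "?\<Omega> \<in> sets M" using X T sat2 by auto
  ultimately show ?thesis by blast
qed

section \<open>Lattices and their unit cells\<close>

definition int_lattice :: "real^'n^'n \<Rightarrow> (real^'n) set" where
  "int_lattice H = {H *v z | z. \<forall>i. z $ i \<in> \<int>}"

definition lattice_rel :: "real^'n^'n \<Rightarrow> real^'n \<Rightarrow> real^'n \<Rightarrow> bool" where
  "lattice_rel H x y \<longleftrightarrow> y - x \<in> int_lattice H"

lemma lattice_zero [simp]: "0 \<in> int_lattice H"
  unfolding int_lattice_def by (auto intro!: exI[of _ 0])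

lemma lattice_minus: "x \<in> int_lattice H \<Longrightarrow> - x \<in> int_lattice H"
proof -
  assume "x \<in> int_lattice H"
  then obtain z where "x = H *v z" "\<forall>i. z $ i \<in> \<int>" by (auto simp: int_lattice_def)
  then show ?thesis
    unfolding int_lattice_def by (auto intro!: exI[of _ "- z"] simp: linear_neg[OF matrix_vector_mul_linear])
qed

lemma lattice_add: "x \<in> int_lattice H \<Longrightarrow> y \<in> int_lattice H \<Longrightarrow> x + y \<in> int_lattice H"
proof -
  assume "x \<in> int_lattice H" "y \<in> int_lattice H"
  then obtain z w where "x = H *v z" "\<forall>i. z $ i \<in> \<int>" "y = H *v w" "\<forall>i. w $ i \<in> \<int>"
    by (auto simp: int_lattice_def)
  then show ?thesis
    unfolding int_lattice_def by (auto intro!: exI[of _ "z + w"] simp: matrix_vector_right_distrib)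
qed

lemma equivp_lattice_rel: "equivp (lattice_rel H)"
proof (rule equivpI)
  show "reflp (lattice_rel H)" by (simp add: reflp_def lattice_rel_def)
  show "symp (lattice_rel H)" using lattice_minus by (fastforce simp: symp_def lattice_rel_def)
  show "transp (lattice_rel H)" using lattice_add by (fastforce simp: transp_def lattice_rel_def)
qed

lemma countable_lattice: "countable (int_lattice (H :: real^'n^'n))"
proof -
  have "int_lattice H \<subseteq> range (\<lambda>f::'n \<Rightarrow> int. H *v (\<chi> i. real_of_int (f i)))"
  proof
    fix x assume "x \<in> int_lattice H"
    then obtain z where z: "x = H *v z" "\<forall>i. z $ i \<in> \<int>" by (auto simp: int_lattice_def)
    then have "z = (\<chi> i. real_of_int \<lfloor>z $ i\<rfloor>)" by (auto simp: vec_eq_iff of_int_floor)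
    then show "x \<in> range (\<lambda>f::'n \<Rightarrow> int. H *v (\<chi> i. real_of_int (f i)))"
      using z(1) by (intro range_eqI[of _ _ "\<lambda>i. \<lfloor>z $ i\<rfloor>"]) simp
  qed
  then show ?thesis by (rule countable_subset) simp
qed

text \<open>The half-open parallelepiped spanned by the columns of \<open>H\<close>.\<close>

definition unit_cell :: "real^'n^'n \<Rightarrow> (real^'n) set" where
  "unit_cell H = {x. \<forall>i. 0 \<le> (matrix_inv H *v x) $ i \<and> (matrix_inv H *v x) $ i < 1}"

lemma measurable_vec_nth [measurable]: "(\<lambda>x::real^'n. x $ i) \<in> borel_measurable borel"
  by (intro borel_measurable_continuous_onI continuous_intros)

lemma sets_unit_cell [measurable]: "unit_cell H \<in> sets borel"
  unfolding unit_cell_def by measurable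

lemma matrix_inv_mult:
  assumes "det (H :: real^'n^'n) \<noteq> 0"
  shows "matrix_inv H ** H = mat 1" "H ** matrix_inv H = mat 1"
proof -
  have "invertible H" using assms by (simp add: invertible_det_nz)
  then have "H ** matrix_inv H = mat 1 \<and> matrix_inv H ** H = mat 1"
    unfolding invertible_def matrix_inv_def by (rule someI_ex)
  then show "matrix_inv H ** H = mat 1" "H ** matrix_inv H = mat 1" by auto
qed

lemma matrix_inv_cancel:
  assumes "det (H :: real^'n^'n) \<noteq> 0"
  shows "matrix_inv H *v (H *v x) = x" "H *v (matrix_inv H *v x) = x"
  by (simp_all add: matrix_vector_mul_assoc matrix_inv_mult[OF assms])

lemma unit_cell_transversal:
  assumes "det H \<noteq> 0"
  shows "transversal (lattice_rel H) UNIV (unit_cell (H :: real^'n^'n))"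
  unfolding transversal_def
proof (intro conjI ballI)
  fix x :: "real^'n"
  let ?w = "matrix_inv H *v x"
  let ?z = "\<chi> i. - real_of_int \<lfloor>?w $ i\<rfloor>"
  let ?y = "x + H *v ?z"
  have y: "matrix_inv H *v ?y = ?w + ?z"
    by (simp add: matrix_vector_right_distrib matrix_inv_cancel assms)
  show "\<exists>!y. y \<in> unit_cell H \<and> lattice_rel H x y"
  proof (rule ex1I[of _ ?y])
    show "?y \<in> unit_cell H \<and> lattice_rel H x ?y"
    proof
      show "?y \<in> unit_cell H" unfolding unit_cell_def using y by (simp, linarith)
      show "lattice_rel H x ?y"
        unfolding lattice_rel_def int_lattice_def by (auto intro!: exI[of _ ?z])
    qed
    fix y' assume "y' \<in> unit_cell H \<and> lattice_rel H x y'"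
    then obtain z where z: "y' = x + H *v z" "\<forall>i. z $ i \<in> \<int>" and u: "y' \<in> unit_cell H"
      by (force simp: lattice_rel_def int_lattice_def algebra_simps)
    have "z $ i = ?z $ i" for i
    proof -
      obtain k where k: "z $ i = real_of_int k" using z(2) by (meson Ints_cases)
      have "(matrix_inv H *v y') $ i = ?w $ i + k"
        by (simp add: z matrix_vector_right_distrib matrix_inv_cancel assms k)
      then have "0 \<le> ?w $ i + k" "?w $ i + k < 1" using u unfolding unit_cell_def by (metis (mono_tags, lifting) mem_Collect_eq)+
      then have "- k = \<lfloor>?w $ i\<rfloor>" by (intro floor_unique[symmetric]) auto
      then show ?thesis by (simp add: k)
    qed
    then have "z = ?z" unfolding vec_eq_iff by blast
    then show "y' = ?y" by (simp add: z)
  qed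
qed simp

lemma sets_translate: "X \<in> sets borel \<Longrightarrow> {y::real^'n. y + c \<in> X} \<in> sets borel"
  using measurable_sets_borel[of "\<lambda>y. y + c" borel X] by (simp add: vimage_def)

lemma sets_lattice_saturation:
  fixes X :: "(real^'n) set"
  assumes "X \<in> sets borel"
  shows "saturation (lattice_rel H) X \<in> sets borel"
proof -
  have "saturation (lattice_rel H) X = (\<Union>l\<in>int_lattice H. {y. y + (- l) \<in> X})"
    by (force simp: saturation_def lattice_rel_def)
  then show ?thesis
    using assms countable_lattice sets_translate by (auto intro!: sets.countable_UN')
qed

text \<open>Nonzero integer vectors have norm at least \<open>1\<close>, and the inverse matrix is bounded.\<close>

lemma lattice_separated:
  assumes "det (H :: real^'n^'n) \<noteq> 0"
  shows "\<exists>\<delta>>0. \<forall>x\<in>int_lattice H. norm x < \<delta> \<longrightarrow> x = 0"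
proof -
  obtain K where K: "K > 0" "\<And>x. norm (matrix_inv H *v x) \<le> norm x * K"
    using bounded_linear.pos_bounded[OF matrix_vector_mul_bounded_linear[of "matrix_inv H"]] by blast
  have "x = 0" if x: "x \<in> int_lattice H" "norm x < 1 / K" for x
  proof -
    obtain z where z: "x = H *v z" "\<forall>i. z $ i \<in> \<int>" using x(1) by (auto simp: int_lattice_def)
    have "norm z < 1"
      using K(2)[of x] that(2) K(1) by (simp add: z(1) matrix_inv_cancel assms field_simps)
    then have "\<bar>z $ i\<bar> < 1" for i using component_le_norm_cart[of z i] by linarith
    then have "z $ i = 0" for i using z(2) Ints_nonzero_abs_less1 by blast
    then have "z = 0" unfolding vec_eq_iff by simp
    then show ?thesis by (simp add: z)
  qed
  then show ?thesis using K(1) by (intro exI[of _ "1 / K"]) auto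
qed

lemma bounded_unit_cell:
  assumes "det (H :: real^'n^'n) \<noteq> 0"
  shows "bounded (unit_cell H)"
proof -
  have "unit_cell H \<subseteq> (\<lambda>x. H *v x) ` cbox 0 1"
  proof
    fix x assume "x \<in> unit_cell H"
    then have "matrix_inv H *v x \<in> cbox 0 1" by (auto simp: unit_cell_def mem_box_cart less_imp_le)
    then show "x \<in> (\<lambda>x. H *v x) ` cbox 0 1"
      using matrix_inv_cancel(2)[OF assms, of x] by force
  qed
  moreover have "bounded ((\<lambda>x. H *v x) ` cbox 0 1)"
    by (intro bounded_linear_image) (auto simp: matrix_vector_mul_bounded_linear)
  ultimately show ?thesis by (rule bounded_subset[rotated])
qed

section \<open>Orbits of the expanding map in the open cone\<close>

locale dilated_cone =
  fixes \<alpha> \<alpha>' :: "'n \<Rightarrow> real^'n" and a :: "'n \<Rightarrow> real"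
  assumes dual: "dual_basis \<alpha> \<alpha>'"
    and expand': "v = (\<Sum>j\<in>UNIV. (v \<bullet> \<alpha> j) *\<^sub>R \<alpha>' j)"
    and expanding: "a j > 1"
begin

text \<open>The \<open>k\<close>-th power of the linear map with eigenvalue \<open>a j\<close> on \<open>\<alpha>' j\<close>, in coordinates, so that negative
  exponents need no inverse matrix.\<close>

definition dilation :: "int \<Rightarrow> real^'n \<Rightarrow> real^'n" where
  "dilation k x = (\<Sum>j\<in>UNIV. (a j powi k * (x \<bullet> \<alpha> j)) *\<^sub>R \<alpha>' j)"

definition dilation_rel :: "real^'n \<Rightarrow> real^'n \<Rightarrow> bool" where
  "dilation_rel x y \<longleftrightarrow> (\<exists>k. y = dilation k x)"

lemma a_pos: "a j > 0" and a_nz: "a j \<noteq> 0"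
  using expanding[of j] by linarith+

lemma coord: "(\<Sum>j\<in>UNIV. t j *\<^sub>R \<alpha>' j) \<bullet> \<alpha> i = t i"
proof -
  have "(\<Sum>j\<in>UNIV. t j *\<^sub>R \<alpha>' j) \<bullet> \<alpha> i = (\<Sum>j\<in>UNIV. t j * (\<alpha> i \<bullet> \<alpha>' j))"
    by (subst inner_commute) (simp add: inner_sum_right)
  also have "\<dots> = (\<Sum>j\<in>UNIV. if i = j then t j else 0)"
    using dual by (intro sum.cong) (auto simp: dual_basis_def)
  finally show ?thesis by simp
qed

lemma coord_dilation: "dilation k x \<bullet> \<alpha> j = a j powi k * (x \<bullet> \<alpha> j)"
  by (simp add: dilation_def coord)

lemma coords_eqI: "(\<And>j. x \<bullet> \<alpha> j = y \<bullet> \<alpha> j) \<Longrightarrow> x = y"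
  by (subst expand'[of x], subst expand'[of y]) simp

lemma dilation_0: "dilation 0 x = x"
  by (rule coords_eqI) (simp add: coord_dilation)

lemma dilation_dilation: "dilation k (dilation l x) = dilation (k + l) x"
  by (rule coords_eqI) (simp add: coord_dilation power_int_add a_nz)

lemma dilation_cone: "dilation k x \<in> open_cone \<alpha> \<longleftrightarrow> x \<in> open_cone \<alpha>"
proof -
  have "a i powi k > 0" for i using a_pos by simp
  then have "0 < a i powi k * (x \<bullet> \<alpha> i) \<longleftrightarrow> 0 < x \<bullet> \<alpha> i" for i
    by (metis mult_pos_pos zero_less_mult_pos)
  then show ?thesis by (simp add: open_cone_def coord_dilation)
qed

lemma equivp_dilation_rel: "equivp dilation_rel"
proof (rule equivpI)
  show "reflp dilation_rel" using dilation_0 by (metis reflp_def dilation_rel_def)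
  show "symp dilation_rel"
    unfolding symp_def dilation_rel_def
    by (metis add.left_inverse dilation_0 dilation_dilation)
  show "transp dilation_rel"
    unfolding transp_def dilation_rel_def by (metis dilation_dilation)
qed

lemma dilation_inject:
  assumes "x \<in> open_cone \<alpha>" "dilation k x = dilation l x"
  shows "k = l"
proof -
  have "a j powi k = a j powi l" for j
  proof -
    have "a j powi k * (x \<bullet> \<alpha> j) = a j powi l * (x \<bullet> \<alpha> j)"
      using assms(2) coord_dilation by metis
    moreover have "x \<bullet> \<alpha> j > 0" using assms(1) by (simp add: open_cone_def)
    ultimately show ?thesis by simp
  qed
  then show ?thesis
    using power_int_strict_increasing[of k l "a undefined"] power_int_strict_increasing[of l k "a undefined"] expanding[of undefined]
    by (metis less_irrefl linorder_neqE)
qed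

lemma measurable_dilation [measurable]: "dilation k \<in> borel_measurable borel"
  unfolding dilation_def[abs_def] by measurable

lemma sets_dilation_saturation:
  assumes "X \<in> sets borel"
  shows "saturation dilation_rel X \<in> sets borel"
proof -
  have "saturation dilation_rel X = (\<Union>k. dilation k -` X)"
    unfolding saturation_def dilation_rel_def
    by (auto simp: vimage_def) (metis add.left_inverse dilation_0 dilation_dilation)+
  moreover have "dilation k -` X \<in> sets borel" for k
    using measurable_sets_borel[OF measurable_dilation assms] by simp
  ultimately show ?thesis by auto
qed

lemma sets_open_cone [measurable]: "open_cone \<alpha> \<in> sets borel"
  unfolding open_cone_def by measurable

text \<open>The corner of all points with coordinates at most \<open>s\<close>, without its image under the contraction
  \<open>dilation (- 1)\<close>.\<close>

definition shell :: "real \<Rightarrow> (real^'n) set" where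
  "shell s = {x \<in> open_cone \<alpha>. (\<forall>j. x \<bullet> \<alpha> j \<le> s) \<and> \<not> (\<forall>j. a j * (x \<bullet> \<alpha> j) \<le> s)}"

lemma sets_shell [measurable]: "shell s \<in> sets borel"
  unfolding shell_def by measurable

text \<open>For fixed \<open>x\<close> the exponents that move \<open>x\<close> into the corner of size \<open>s\<close> are closed downwards and bounded
  above; precisely the largest of them moves \<open>x\<close> into the shell.\<close>

lemma shell_transversal:
  assumes "s > 0"
  shows "transversal dilation_rel (open_cone \<alpha>) (shell s)"
  unfolding transversal_def
proof (intro conjI ballI)
  show "shell s \<subseteq> open_cone \<alpha>" by (auto simp: shell_def)
  fix x assume x: "x \<in> open_cone \<alpha>"
  then have xp: "x \<bullet> \<alpha> j > 0" for j by (simp add: open_cone_def)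
  define P where "P k \<longleftrightarrow> (\<forall>j. dilation k x \<bullet> \<alpha> j \<le> s)" for k
  have down: "P k" if "P l" "k \<le> l" for k l
    unfolding P_def
  proof
    fix j
    have "dilation k x \<bullet> \<alpha> j \<le> dilation l x \<bullet> \<alpha> j"
      using that(2) xp[of j] expanding[of j] power_int_increasing[of k l "a j"]
      by (simp add: coord_dilation mult_right_mono)
    also have "\<dots> \<le> s" using that(1) by (simp add: P_def)
    finally show "dilation k x \<bullet> \<alpha> j \<le> s" .
  qed
  have shell_iff: "dilation k x \<in> shell s \<longleftrightarrow> P k \<and> \<not> P (k + 1)" for k
    using x by (simp add: shell_def P_def dilation_cone coord_dilation power_int_add_1' a_nz mult.assoc)
  \<comment> \<open>One coordinate exceeding \<open>s\<close> suffices to leave the corner.\<close>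
  have "\<exists>m::nat. \<not> P (int m)"
  proof -
    obtain j :: 'n where True by simp
    obtain m where "a j ^ m > s / (x \<bullet> \<alpha> j)" using real_arch_pow[OF expanding] by blast
    then have "a j powi (int m) * (x \<bullet> \<alpha> j) > s" using xp[of j] by (simp add: field_simps)
    then show ?thesis unfolding P_def coord_dilation by (metis not_less)
  qed
  then obtain m where m: "\<not> P (int m)" by blast
  have "\<exists>N::nat. P (- int N)"
  proof -
    have "\<exists>N::nat. dilation (- int N) x \<bullet> \<alpha> j \<le> s" for j
    proof -
      obtain N where "a j ^ N > (x \<bullet> \<alpha> j) / s" using real_arch_pow[OF expanding] by blast
      then have "(x \<bullet> \<alpha> j) / a j ^ N \<le> s" using assms a_pos[of j] by (simp add: field_simps)
      then show ?thesis by (auto simp: coord_dilation power_int_minus divide_inverse mult.commute intro!: exI[of _ N])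
    qed
    then obtain N where N: "\<And>j. dilation (- int (N j)) x \<bullet> \<alpha> j \<le> s" by metis
    have "P (- int (Max (range N)))"
      unfolding P_def
    proof
      fix j
      have "dilation (- int (Max (range N))) x \<bullet> \<alpha> j \<le> dilation (- int (N j)) x \<bullet> \<alpha> j"
        using xp[of j] expanding[of j] power_int_increasing[of "- int (Max (range N))" "- int (N j)" "a j"]
        by (simp add: coord_dilation mult_right_mono)
      then show "dilation (- int (Max (range N))) x \<bullet> \<alpha> j \<le> s" using N[of j] by linarith
    qed
    then show ?thesis by blast
  qed
  then obtain N where N: "P (- int N)" by blast
  \<comment> \<open>The largest admissible exponent is found by counting upwards from the admissible exponent \<open>- N\<close>.\<close>
  define r where "r = (LEAST n::nat. \<not> P (- int N + int n))"
  have "\<not> P (- int N + int (N + m))" using m by simp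
  then have r: "\<not> P (- int N + int r)" unfolding r_def by (rule LeastI)
  then have "r \<noteq> 0" using N by (metis add.right_neutral of_nat_0)
  then obtain r' where r': "r = Suc r'" using not0_implies_Suc by blast
  then have "P (- int N + int r')" using not_less_Least[of r'] unfolding r_def[symmetric]
    by (metis (mono_tags, lifting) lessI not_less_Least r_def)
  moreover have "- int N + int r = - int N + int r' + 1" by (simp add: r')
  ultimately have k: "dilation (- int N + int r') x \<in> shell s"
    using r shell_iff by metis
  show "\<exists>!y. y \<in> shell s \<and> dilation_rel x y"
  proof (rule ex1I[of _ "dilation (- int N + int r') x"])
    show "dilation (- int N + int r') x \<in> shell s \<and> dilation_rel x (dilation (- int N + int r') x)"
      using k by (auto simp: dilation_rel_def)
    fix y assume "y \<in> shell s \<and> dilation_rel x y"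
    then obtain l where l: "y = dilation l x" "P l" "\<not> P (l + 1)" using shell_iff by (auto simp: dilation_rel_def)
    have "P (- int N + int r')" "\<not> P (- int N + int r' + 1)" using k shell_iff[of "- int N + int r'"] by blast+
    with l down have "l = - int N + int r'" by (metis add_le_cancel_right linorder_le_cases not_less zless_imp_add1_zle order.antisym)
    then show "y = dilation (- int N + int r') x" by (simp add: l)
  qed
qed

lemma norm_le_coords:
  assumes "\<And>j. \<bar>x \<bullet> \<alpha> j\<bar> \<le> s"
  shows "norm x \<le> s * (\<Sum>j\<in>UNIV. norm (\<alpha>' j))"
proof -
  have "norm x = norm (\<Sum>j\<in>UNIV. (x \<bullet> \<alpha> j) *\<^sub>R \<alpha>' j)" by (subst expand'[of x]) simp
  also have "\<dots> \<le> (\<Sum>j\<in>UNIV. norm ((x \<bullet> \<alpha> j) *\<^sub>R \<alpha>' j))" by (rule norm_sum)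
  also have "\<dots> \<le> (\<Sum>j\<in>UNIV. s * norm (\<alpha>' j))"
    by (intro sum_mono) (simp add: assms mult_right_mono)
  finally show ?thesis by (simp add: sum_distrib_left)
qed

text \<open>All coordinates of a point of the shell lie between \<open>0\<close> and \<open>s\<close>, so a small shell has diameter less
  than the minimal distance of lattice points.\<close>

lemma small_shell_packing:
  assumes "det H \<noteq> 0"
  shows "\<exists>s>0. packing (lattice_rel H) (shell s)"
proof -
  obtain \<delta> where \<delta>: "\<delta> > 0" "\<And>x. x \<in> int_lattice H \<Longrightarrow> norm x < \<delta> \<Longrightarrow> x = 0"
    using lattice_separated[OF assms] by blast
  define K where "K = (\<Sum>j\<in>UNIV. norm (\<alpha>' j))"
  have "K \<ge> 0" by (auto simp: K_def intro: sum_nonneg)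
  define s where "s = \<delta> / (K + 1)"
  have s: "s > 0" "s * K < \<delta>" using \<delta>(1) \<open>K \<ge> 0\<close> by (auto simp: s_def field_simps)
  have "packing (lattice_rel H) (shell s)"
    unfolding packing_def
  proof (intro ballI impI)
    fix x y assume x: "x \<in> shell s" and y: "y \<in> shell s" and r: "lattice_rel H x y"
    have "\<bar>(y - x) \<bullet> \<alpha> j\<bar> \<le> s" for j
    proof -
      have "x \<bullet> \<alpha> j > 0" "x \<bullet> \<alpha> j \<le> s" "y \<bullet> \<alpha> j > 0" "y \<bullet> \<alpha> j \<le> s"
        using x y by (auto simp: shell_def open_cone_def)
      then show ?thesis by (simp add: inner_diff_left)
    qed
    then have "norm (y - x) \<le> s * K" unfolding K_def by (rule norm_le_coords)
    then have "y - x = 0" using \<delta>(2)[of "y - x"] r s(2) by (simp add: lattice_rel_def)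
    then show "x = y" by simp
  qed
  then show ?thesis using s(1) by blast
qed

text \<open>A unit cell is translated by a lattice vector far out in the cone. If every coordinate of a point of
  the cell lies in \<open>[r - 2 b, r + 2 b]\<close> with \<open>r\<close> large compared with \<open>b\<close>, then already the coordinate \<open>j0\<close>
  shows that a proper dilation leaves the cell.\<close>

lemma far_cell:
  assumes "det H \<noteq> 0"
  shows "\<exists>T. T \<in> sets borel \<and> T \<subseteq> open_cone \<alpha> \<and> transversal (lattice_rel H) UNIV T \<and> packing dilation_rel T"
proof -
  obtain j0 :: 'n where True by simp
  obtain K where K: "K > 0" "\<And>x. x \<in> unit_cell H \<Longrightarrow> norm x \<le> K"
    using bounded_unit_cell[OF assms] by (auto simp: bounded_pos)
  define b where "b = K * (\<Sum>j\<in>UNIV. norm (\<alpha> j))"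
  have b: "\<bar>x \<bullet> \<alpha> j\<bar> \<le> b" if "x \<in> unit_cell H" for x j
  proof -
    have "\<bar>x \<bullet> \<alpha> j\<bar> \<le> norm x * norm (\<alpha> j)" by (rule Cauchy_Schwarz_ineq2)
    also have "\<dots> \<le> K * (\<Sum>j\<in>UNIV. norm (\<alpha> j))"
      using K that by (intro mult_mono member_le_sum) (auto intro: sum_nonneg)
    finally show ?thesis by (simp add: b_def)
  qed
  have "b \<ge> 0" using K(1) by (auto simp: b_def intro!: mult_nonneg_nonneg sum_nonneg)
  \<comment> \<open>The term \<open>4 b / (a j0 - 1)\<close> makes \<open>a j0 * (r - 2 b)\<close> exceed \<open>r + 2 b\<close>.\<close>
  define r where "r = 2 * b + 4 * b / (a j0 - 1) + 1"
  have r1: "r > 2 * b" using \<open>b \<ge> 0\<close> expanding[of j0] by (simp add: r_def add_nonneg_pos)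
  have r2: "a j0 * (r - 2 * b) > r + 2 * b"
  proof -
    have "(a j0 - 1) * (r - 2 * b) = 4 * b + (a j0 - 1)"
      using expanding[of j0] by (simp add: r_def field_simps)
    then have "a j0 * (r - 2 * b) = r + 2 * b + (a j0 - 1)" by (simp add: algebra_simps)
    then show ?thesis using expanding[of j0] by simp
  qed
  define v where "v = (\<Sum>j\<in>UNIV. r *\<^sub>R \<alpha>' j)"
  obtain t where t: "t \<in> unit_cell H" "t - v \<in> int_lattice H"
    using unit_cell_transversal[OF assms] unfolding transversal_def lattice_rel_def by blast
  define \<gamma> where "\<gamma> = v - t"
  have \<gamma>: "\<gamma> \<in> int_lattice H" using lattice_minus[OF t(2)] by (simp add: \<gamma>_def)
  define T where "T = {y. y + (- \<gamma>) \<in> unit_cell H}"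
  have coords: "r - 2 * b \<le> x \<bullet> \<alpha> j" "x \<bullet> \<alpha> j \<le> r + 2 * b" if "x \<in> T" for x j
  proof -
    have "\<bar>(x - \<gamma>) \<bullet> \<alpha> j\<bar> \<le> b" using that b by (auto simp: T_def)
    moreover have "\<bar>t \<bullet> \<alpha> j\<bar> \<le> b" using t b by auto
    moreover have "v \<bullet> \<alpha> j = r" by (simp add: v_def coord)
    ultimately show "r - 2 * b \<le> x \<bullet> \<alpha> j" "x \<bullet> \<alpha> j \<le> r + 2 * b"
      unfolding \<gamma>_def by (auto simp: inner_diff_left abs_le_iff)
  qed
  have TU: "T \<subseteq> open_cone \<alpha>"
  proof
    fix x assume "x \<in> T"
    then show "x \<in> open_cone \<alpha>" using coords(1)[of x] r1 by (auto simp: open_cone_def intro: less_le_trans[of 0 "r - 2 * b"])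
  qed
  have "packing dilation_rel T"
  proof -
    have no: False if "x \<in> T" "dilation k x \<in> T" "k > 0" for x k
    proof -
      have "a j0 * (r - 2 * b) \<le> a j0 powi k * (x \<bullet> \<alpha> j0)"
        using coords(1)[OF that(1), of j0] power_int_increasing[of 1 k "a j0"] expanding[of j0] that(3) r1
        by (intro mult_mono) auto
      also have "\<dots> \<le> r + 2 * b" using coords(2)[OF that(2), of j0] by (simp add: coord_dilation)
      finally show False using r2 by simp
    qed
    have "dilation k x = x" if "x \<in> T" "dilation k x \<in> T" for x k
    proof -
      have "\<not> k > 0" using no that by blast
      moreover have "\<not> k < 0"
        using no[of "dilation k x" "- k"] that by  (auto simp: dilation_dilation dilation_0)
      ultimately have "k = 0" by simp
      then show ?thesis by (simp add: dilation_0)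
    qed
    then show ?thesis unfolding packing_def dilation_rel_def by metis
  qed
  moreover have "transversal (lattice_rel H) UNIV T"
    unfolding transversal_def
  proof (intro conjI ballI)
    fix x
    obtain y where y: "y \<in> unit_cell H" "lattice_rel H x y"
      and uniq: "\<And>z. z \<in> unit_cell H \<Longrightarrow> lattice_rel H x z \<Longrightarrow> z = y"
      using unit_cell_transversal[OF assms] unfolding transversal_def by (metis UNIV_I)
    show "\<exists>!z. z \<in> T \<and> lattice_rel H x z"
    proof (rule ex1I[of _ "y + \<gamma>"])
      show "y + \<gamma> \<in> T \<and> lattice_rel H x (y + \<gamma>)"
        using y lattice_add[OF _ \<gamma>, of "y - x"] by (simp add: T_def lattice_rel_def algebra_simps)
      fix z assume z: "z \<in> T \<and> lattice_rel H x z"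
      then have "lattice_rel H x (z - \<gamma>)"
        using lattice_add[OF _ lattice_minus[OF \<gamma>], of "z - x"] by (simp add: lattice_rel_def algebra_simps)
      then have "z - \<gamma> = y" using z uniq by (simp add: T_def)
      then show "z = y + \<gamma>" by (simp add: algebra_simps)
    qed
  qed simp
  moreover have "T \<in> sets borel" unfolding T_def by (rule sets_translate) measurable
  ultimately show ?thesis using TU by blast
qed

theorem dilation_lattice_transversal:
  assumes "det H \<noteq> 0"
  shows "\<exists>\<Omega>\<in>sets borel. transversal dilation_rel (open_cone \<alpha>) \<Omega> \<and> transversal (lattice_rel H) UNIV \<Omega>"
proof -
  obtain s where s: "s > 0" "packing (lattice_rel H) (shell s)" using small_shell_packing[OF assms] by blast
  obtain T where T: "T \<in> sets borel" "T \<subseteq> open_cone \<alpha>" "transversal (lattice_rel H) UNIV T" "packing dilation_rel T"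
    using far_cell[OF assms] by blast
  show ?thesis
    by (rule common_transversal[OF equivp_dilation_rel equivp_lattice_rel shell_transversal[OF s(1)] s(2) _ T(3,4,2,1)])
       (auto intro: sets_dilation_saturation sets_lattice_saturation)
qed

end

section \<open>The Weyl group acts simply transitively on chambers\<close>

lemma linear_reflection: "linear (reflection a)"
  by (rule linearI) (auto simp: reflection_def inner_add_left algebra_simps add_divide_distrib)

lemma reflection_reflection: "a \<noteq> 0 \<Longrightarrow> reflection a (reflection a x) = x"
proof -
  assume "a \<noteq> 0"
  define c where "c = 2 * (x \<bullet> a) / (a \<bullet> a)"
  have "(x - c *\<^sub>R a) \<bullet> a = - (x \<bullet> a)"
    using \<open>a \<noteq> 0\<close> by (simp add: c_def inner_diff_left)
  then show ?thesis unfolding reflection_def c_def[symmetric] by (simp add: c_def)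
qed

lemma inner_reflection_left: "reflection a x \<bullet> y = x \<bullet> reflection a y"
  by (simp add: reflection_def inner_diff_left inner_diff_right inner_commute)

lemma inner_reflection: "a \<noteq> 0 \<Longrightarrow> reflection a x \<bullet> reflection a y = x \<bullet> y"
  by (simp add: inner_reflection_left reflection_reflection)

lemma reflection_self: "reflection a a = - a"
  by (cases "a = 0") (simp_all add: reflection_def scaleR_2)

lemma reflection_minus: "reflection (- a) = reflection a"
  by (simp add: reflection_def fun_eq_iff)

lemma reflection_of_isometry:
  assumes "linear f" and "\<And>x y. f x \<bullet> f y = x \<bullet> y"
  shows "reflection (f b) (f x) = f (reflection b x)"
  using assms by (simp add: reflection_def linear_diff linear_cmul)

definition word_act :: "(real^'n) list \<Rightarrow> real^'n \<Rightarrow> real^'n" where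
  "word_act bs = foldr reflection bs"

lemma word_act_simps [simp]:
  "word_act [] x = x"
  "word_act (b # bs) x = reflection b (word_act bs x)"
  "word_act (bs @ cs) x = word_act bs (word_act cs x)"
  by (simp_all add: word_act_def)

lemma linear_word_act: "linear (word_act bs)"
proof (induction bs)
  case Nil
  show ?case by (simp add: linear_iff)
next
  case (Cons b bs)
  then show ?case
    using linear_compose[OF Cons linear_reflection, of b] by (simp add: o_def word_act_def)
qed

lemma word_act_isometry: "0 \<notin> set bs \<Longrightarrow> word_act bs x \<bullet> word_act bs y = x \<bullet> y"
  by (induction bs) (auto simp: inner_reflection)

lemma word_act_rev: "0 \<notin> set bs \<Longrightarrow> word_act (rev bs) (word_act bs x) = x"
  by (induction bs) (auto simp: reflection_reflection)

lemma weyl_group_words: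
  assumes "0 \<notin> \<Delta>"
  shows "w \<in> weyl_group \<Delta> \<longleftrightarrow> (\<exists>bs. set bs \<subseteq> \<Delta> \<and> w = matrix (word_act bs))"
proof
  assume "w \<in> weyl_group \<Delta>"
  then show "\<exists>bs. set bs \<subseteq> \<Delta> \<and> w = matrix (word_act bs)"
    unfolding weyl_group_def
  proof (induction rule: generate.induct)
    case one
    then show ?case
      by (intro exI[of _ "[]"]) (simp add: GL_def word_act_def matrix_id_mat_1[unfolded id_def] id_def)
  next
    case (incl h)
    then obtain b where "b \<in> \<Delta>" "h = matrix (reflection b)" by auto
    then show ?case by (intro exI[of _ "[b]"]) (simp add: word_act_def)
  next
    case (inv h)
    then obtain b where b: "b \<in> \<Delta>" "h = matrix (reflection b)" by auto
    have hh: "h ** h = mat 1"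
    proof -
      have "reflection b \<circ> reflection b = id"
        using b assms by (metis (no_types, lifting) comp_apply eq_id_iff reflection_reflection)
      then show ?thesis
        by (simp add: b matrix_compose[symmetric] linear_reflection matrix_id_mat_1)
    qed
    then have "inv\<^bsub>GL\<^esub> h = h"
      using group.inv_equality[OF group_GL, of h h] by (auto simp: GL_def invertible_def)
    then show ?case using b by (intro exI[of _ "[b]"]) (simp add: word_act_def)
  next
    case (eng h1 h2)
    then obtain bs cs where "set bs \<subseteq> \<Delta>" "h1 = matrix (word_act bs)" "set cs \<subseteq> \<Delta>" "h2 = matrix (word_act cs)"
      by auto
    then show ?case
      by (intro exI[of _ "bs @ cs"])
         (simp add: GL_def matrix_compose[symmetric] linear_word_act, simp add: word_act_def fun_eq_iff comp_def)
  qed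
next
  assume "\<exists>bs. set bs \<subseteq> \<Delta> \<and> w = matrix (word_act bs)"
  then obtain bs where bs: "set bs \<subseteq> \<Delta>" "w = matrix (word_act bs)" by auto
  have "matrix (word_act bs) \<in> weyl_group \<Delta>" using bs(1)
  proof (induction bs)
    case Nil
    then show ?case
      using generate.one[of GL] by (simp add: weyl_group_def GL_def word_act_def matrix_id_mat_1[unfolded id_def] id_def)
  next
    case (Cons b bs)
    have "matrix (word_act (b # bs)) = matrix (reflection b) ** matrix (word_act bs)"
      by (simp add: matrix_compose[symmetric] linear_reflection linear_word_act) (simp add: word_act_def o_def)
    moreover have "matrix (reflection b) \<in> weyl_group \<Delta>"
      unfolding weyl_group_def using Cons.prems by (intro generate.incl) auto
    moreover have "matrix (word_act bs) \<in> weyl_group \<Delta>" using Cons by simp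
    ultimately show ?case unfolding weyl_group_def
      using generate.eng[of "matrix (reflection b)" GL _ "matrix (word_act bs)"] by (simp only: GL_def monoid.simps)
  qed
  then show "w \<in> weyl_group \<Delta>" by (simp add: bs)
qed

text \<open>A root is handled through its coefficients with respect to the simple roots; the coefficient of
  \<open>\<alpha> j\<close> in \<beta> is \<open>\<beta> \<bullet> \<alpha>' j\<close>.\<close>

locale simple_roots =
  fixes \<Delta> :: "(real^'n) set" and \<alpha> \<alpha>' :: "'n \<Rightarrow> real^'n"
  assumes root_system: "root_system \<Delta>"
    and simple: "\<alpha> i \<in> \<Delta>"
    and dual: "dual_basis \<alpha> \<alpha>'"
    and same_sign: "\<beta> \<in> \<Delta> \<Longrightarrow> (\<forall>j. \<beta> \<bullet> \<alpha>' j \<ge> 0) \<or> (\<forall>j. \<beta> \<bullet> \<alpha>' j \<le> 0)"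
    and expand: "v = (\<Sum>j\<in>UNIV. (v \<bullet> \<alpha>' j) *\<^sub>R \<alpha> j)"
begin

definition pos_root :: "real^'n \<Rightarrow> bool" where
  "pos_root \<beta> \<longleftrightarrow> \<beta> \<in> \<Delta> \<and> (\<forall>j. \<beta> \<bullet> \<alpha>' j \<ge> 0)"

lemma finite_roots: "finite \<Delta>" and zero_not_root: "0 \<notin> \<Delta>"
  using root_system by (auto simp: root_system_def)

lemma root_multiple: "\<beta> \<in> \<Delta> \<Longrightarrow> c *\<^sub>R \<beta> \<in> \<Delta> \<Longrightarrow> c *\<^sub>R \<beta> = \<beta> \<or> c *\<^sub>R \<beta> = - \<beta>"
  using root_system unfolding root_system_def by blast

lemma minus_root: "\<beta> \<in> \<Delta> \<Longrightarrow> - \<beta> \<in> \<Delta>"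
  using root_system unfolding root_system_def by blast

lemma reflection_root: "\<beta> \<in> \<Delta> \<Longrightarrow> \<gamma> \<in> \<Delta> \<Longrightarrow> reflection \<beta> \<gamma> \<in> \<Delta>"
  using root_system by (auto simp: root_system_def)

lemma word_root: "set bs \<subseteq> \<Delta> \<Longrightarrow> \<gamma> \<in> \<Delta> \<Longrightarrow> word_act bs \<gamma> \<in> \<Delta>"
  by (induction bs) (auto intro: reflection_root)

lemma simple_dual [simp]: "\<alpha> i \<bullet> \<alpha>' j = (if i = j then 1 else 0)"
  using dual by (simp add: dual_basis_def)

lemma inner_expand: "v \<bullet> w = (\<Sum>j\<in>UNIV. (v \<bullet> \<alpha>' j) * (\<alpha> j \<bullet> w))"
  by (subst expand[of v]) (simp add: inner_sum_left)

lemma eq_zeroI: "(\<And>j. v \<bullet> \<alpha>' j = 0) \<Longrightarrow> v = 0"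
  by (subst expand[of v]) simp

lemma pos_or_neg: "\<beta> \<in> \<Delta> \<Longrightarrow> pos_root \<beta> \<or> pos_root (- \<beta>)"
  using same_sign[of \<beta>] minus_root[of \<beta>] by (auto simp: pos_root_def)

lemma not_pos_neg: "pos_root \<beta> \<Longrightarrow> \<not> pos_root (- \<beta>)"
  using eq_zeroI[of \<beta>] zero_not_root by (auto simp: pos_root_def intro: antisym)

lemma pos_simple: "pos_root (\<alpha> i)"
  by (simp add: pos_root_def simple)

lemma pos_inner_chamber:
  assumes "pos_root \<beta>" and "v \<in> open_cone \<alpha>"
  shows "v \<bullet> \<beta> > 0"
proof -
  obtain j where "\<beta> \<bullet> \<alpha>' j \<noteq> 0"
    using assms(1) eq_zeroI[of \<beta>] zero_not_root by (auto simp: pos_root_def)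
  then have "\<beta> \<bullet> \<alpha>' j > 0" using assms(1) by (auto simp: pos_root_def less_le)
  then have "(\<Sum>j\<in>UNIV. (\<beta> \<bullet> \<alpha>' j) * (\<alpha> j \<bullet> v)) > 0"
  proof (intro sum_pos2[of _ j])
    have v: "\<alpha> k \<bullet> v > 0" for k using assms(2) by (simp add: open_cone_def inner_commute)
    show "0 < (\<beta> \<bullet> \<alpha>' j) * (\<alpha> j \<bullet> v)" using \<open>\<beta> \<bullet> \<alpha>' j > 0\<close> v by simp
    show "0 \<le> (\<beta> \<bullet> \<alpha>' k) * (\<alpha> k \<bullet> v)" for k
      using assms(1) less_imp_le[OF v[of k]] by (simp add: pos_root_def)
  qed auto
  then show ?thesis by (simp add: inner_expand[of \<beta> v] inner_commute)
qed

text \<open>A simple reflection changes only one coefficient of a root. A positive root other than \<open>\<alpha> i\<close> is no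
  multiple of \<open>\<alpha> i\<close>, hence has another positive coefficient, which keeps its sign; and all coefficients of
  a root have the same sign.\<close>

lemma pos_reflection:
  assumes "pos_root \<beta>" and "\<beta> \<noteq> \<alpha> i"
  shows "pos_root (reflection (\<alpha> i) \<beta>)"
proof -
  have root: "reflection (\<alpha> i) \<beta> \<in> \<Delta>"
    using assms by (auto simp: pos_root_def intro: reflection_root simple)
  have coef: "reflection (\<alpha> i) \<beta> \<bullet> \<alpha>' j = \<beta> \<bullet> \<alpha>' j" if "j \<noteq> i" for j
    using that by (simp add: reflection_def inner_diff_left)
  have "\<exists>j. j \<noteq> i \<and> \<beta> \<bullet> \<alpha>' j \<noteq> 0"
  proof (rule ccontr)
    assume no: "\<not> ?thesis"
    have "\<beta> = (\<Sum>j\<in>UNIV. (if j = i then (\<beta> \<bullet> \<alpha>' i) *\<^sub>R \<alpha> i else 0))"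
      by (subst expand[of \<beta>], rule sum.cong) (use no in auto)
    then have b: "\<beta> = (\<beta> \<bullet> \<alpha>' i) *\<^sub>R \<alpha> i" by simp
    then have "\<beta> = \<alpha> i \<or> \<beta> = - \<alpha> i"
      using root_multiple[OF simple, of "\<beta> \<bullet> \<alpha>' i" i] assms(1) by (auto simp: pos_root_def)
    then show False
      using assms not_pos_neg[OF pos_simple[of i]] by auto
  qed
  then obtain j where "j \<noteq> i" "\<beta> \<bullet> \<alpha>' j \<noteq> 0" by blast
  then have "reflection (\<alpha> i) \<beta> \<bullet> \<alpha>' j > 0"
    using assms(1) coef[of j] by (auto simp: pos_root_def less_le)
  then show ?thesis using same_sign[OF root] root unfolding pos_root_def by (meson not_less)
qed

abbreviation simple_word :: "'n list \<Rightarrow> real^'n \<Rightarrow> real^'n" where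
  "simple_word is \<equiv> word_act (map \<alpha> is)"

lemma simple_word_nonzero: "0 \<notin> set (map \<alpha> is)"
  using simple zero_not_root by (auto simp: image_iff) metis

text \<open>By induction on the height \<open>\<beta> \<bullet> (\<Sum>j. \<alpha>' j)\<close>. Since \<open>\<beta> \<bullet> \<beta> > 0\<close>, some simple root \<open>\<alpha> i\<close> with a positive
  coefficient has \<open>\<beta> \<bullet> \<alpha> i > 0\<close>; reflecting in it lowers the height and conjugates the reflections.\<close>

lemma reflection_pos_is_simple_word:
  assumes "pos_root \<beta>"
  shows "\<exists>is. reflection \<beta> = simple_word is"
  using assms
proof (induction "card {\<gamma> \<in> \<Delta>. \<gamma> \<bullet> sum \<alpha>' UNIV < \<beta> \<bullet> sum \<alpha>' UNIV}" arbitrary: \<beta> rule: less_induct)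
  case less
  show ?case
  proof (cases "\<exists>i. \<beta> = \<alpha> i")
    case True
    then obtain i where "\<beta> = \<alpha> i" by auto
    then show ?thesis by (intro exI[of _ "[i]"]) (simp add: word_act_def)
  next
    case False
    let ?\<rho> = "sum \<alpha>' UNIV"
    have "\<beta> \<noteq> 0" using less.prems zero_not_root by (auto simp: pos_root_def)
    then have "(\<Sum>j\<in>UNIV. (\<beta> \<bullet> \<alpha>' j) * (\<alpha> j \<bullet> \<beta>)) > 0"
      using inner_expand[of \<beta> \<beta>] by (metis inner_gt_zero_iff)
    then have "\<exists>i. (\<beta> \<bullet> \<alpha>' i) * (\<alpha> i \<bullet> \<beta>) > 0"
      by (rule contrapos_pp) (simp add: not_less sum_nonpos)
    then obtain i where i: "(\<beta> \<bullet> \<alpha>' i) * (\<alpha> i \<bullet> \<beta>) > 0" by blast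
    have "\<beta> \<bullet> \<alpha>' i \<ge> 0" using less.prems by (auto simp: pos_root_def)
    then have ip: "\<beta> \<bullet> \<alpha> i > 0" using i by (simp add: zero_less_mult_iff inner_commute)
    define \<gamma> where "\<gamma> = reflection (\<alpha> i) \<beta>"
    have a0: "\<alpha> i \<noteq> 0" using simple zero_not_root by metis
    have \<gamma>: "pos_root \<gamma>" unfolding \<gamma>_def using less.prems False by (intro pos_reflection) auto
    have "\<alpha> i \<bullet> ?\<rho> = 1" by (simp add: inner_sum_right)
    then have "\<gamma> \<bullet> ?\<rho> < \<beta> \<bullet> ?\<rho>"
      using ip a0 by (simp add: \<gamma>_def reflection_def inner_diff_left)
    moreover have "\<gamma> \<in> \<Delta>" using \<gamma> by (simp add: pos_root_def)
    ultimately have "card {\<delta> \<in> \<Delta>. \<delta> \<bullet> ?\<rho> < \<gamma> \<bullet> ?\<rho>} < card {\<delta> \<in> \<Delta>. \<delta> \<bullet> ?\<rho> < \<beta> \<bullet> ?\<rho>}"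
      by (intro psubset_card_mono) (use finite_roots in auto)
    from less.hyps[OF this \<gamma>] obtain us where us: "reflection \<gamma> = simple_word us" by auto
    have "reflection \<beta> x = simple_word (i # us @ [i]) x" for x
    proof -
      have "reflection \<gamma> (reflection (\<alpha> i) x) = reflection (\<alpha> i) (reflection \<beta> x)"
        unfolding \<gamma>_def by (rule reflection_of_isometry) (auto simp: linear_reflection inner_reflection a0)
      then show ?thesis by (simp add: us[symmetric] reflection_reflection a0)
    qed
    then show ?thesis by (intro exI[of _ "i # us @ [i]"]) (simp add: fun_eq_iff)
  qed
qed

lemma word_is_simple_word: "set bs \<subseteq> \<Delta> \<Longrightarrow> \<exists>is. word_act bs = simple_word is"
proof (induction bs)
  case Nil
  show ?case by (intro exI[of _ "[]"]) simp
next
  case (Cons b bs)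
  then obtain us where us: "word_act bs = simple_word us" by auto
  obtain vs where "reflection b = simple_word vs"
    using reflection_pos_is_simple_word[of b] reflection_pos_is_simple_word[of "- b"] pos_or_neg[of b] Cons.prems
    by (auto simp: reflection_minus)
  then have "word_act (b # bs) = simple_word (vs @ us)" using us by (auto simp: fun_eq_iff)
  then show ?case by blast
qed

text \<open>Reading the word from the right, \<gamma> becomes negative at some letter \<open>i\<close>; just before that it must be
  \<open>\<alpha> i\<close>, the only positive root that the \<open>i\<close>-th reflection makes negative.\<close>

lemma exchange:
  assumes "pos_root \<gamma>" and "\<not> pos_root (simple_word is \<gamma>)"
  shows "\<exists>us i vs. is = us @ i # vs \<and> simple_word vs \<gamma> = \<alpha> i"
  using assms(2)
proof (induction "is")
  case Nil
  then show ?case using assms(1) by simp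
next
  case (Cons x xs)
  show ?case
  proof (cases "pos_root (simple_word xs \<gamma>)")
    case True
    then have "simple_word xs \<gamma> = \<alpha> x" using Cons.prems pos_reflection by auto
    then show ?thesis by (intro exI[of _ "[]"]) auto
  next
    case False
    then obtain us i vs where "xs = us @ i # vs" "simple_word vs \<gamma> = \<alpha> i" using Cons.IH by auto
    then show ?thesis by (intro exI[of _ "x # us"]) auto
  qed
qed

text \<open>If the last letter is \<open>k\<close>, then \<open>\<alpha> k\<close> is first made negative and has to become positive again; the
  exchange lemma names the letter at which this happens, and that letter cancels against \<open>k\<close>. So the
  word can be shortened by two letters.\<close>

lemma simple_word_trivial:
  assumes "\<And>\<beta>. pos_root \<beta> \<Longrightarrow> pos_root (simple_word is \<beta>)"
  shows "simple_word is x = x"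
  using assms
proof (induction "length is" arbitrary: "is" x rule: less_induct)
  case less
  show ?case
  proof (cases "is" rule: rev_exhaust)
    case Nil
    then show ?thesis by simp
  next
    case (snoc xs k)
    have "simple_word is (\<alpha> k) = - simple_word xs (\<alpha> k)"
      by (simp add: snoc reflection_self linear_neg[OF linear_word_act])
    then have "\<not> pos_root (simple_word xs (\<alpha> k))"
      using less.prems[OF pos_simple[of k]] not_pos_neg by force
    from exchange[OF pos_simple this] obtain us i vs
      where xs: "xs = us @ i # vs" and vs: "simple_word vs (\<alpha> k) = \<alpha> i" by blast
    have drop: "simple_word is y = simple_word (us @ vs) y" for y
    proof -
      have "reflection (\<alpha> i) (simple_word vs y) = simple_word vs (reflection (\<alpha> k) y)"
        unfolding vs[symmetric]
        by (rule reflection_of_isometry) (use simple_word_nonzero in \<open>auto simp: linear_word_act word_act_isometry\<close>)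
      moreover have "\<alpha> i \<noteq> 0" using simple zero_not_root by metis
      ultimately show ?thesis by (simp add: snoc xs) (metis reflection_reflection)
    qed
    show ?thesis
      unfolding drop by (rule less.hyps) (use less.prems drop snoc xs in auto)
  qed
qed

text \<open>An isometry in the group that maps one point of the open chamber to another maps positive roots to
  positive roots, because a root is positive exactly if it has positive inner product with such a point.\<close>

lemma word_fixing_chamber_trivial:
  assumes "set bs \<subseteq> \<Delta>" and "v \<in> open_cone \<alpha>" and "word_act bs v \<in> open_cone \<alpha>"
  shows "word_act bs x = x"
proof -
  have nz: "0 \<notin> set bs" using assms(1) zero_not_root by auto
  have "pos_root (word_act bs \<beta>)" if "pos_root \<beta>" for \<beta>
  proof (rule ccontr)
    assume "\<not> pos_root (word_act bs \<beta>)"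
    moreover have "word_act bs \<beta> \<in> \<Delta>" using word_root[OF assms(1)] that by (auto simp: pos_root_def)
    ultimately have "pos_root (- word_act bs \<beta>)" using pos_or_neg by blast
    then have "word_act bs v \<bullet> (- word_act bs \<beta>) > 0" using assms(3) pos_inner_chamber by blast
    moreover have "v \<bullet> \<beta> > 0" using that assms(2) pos_inner_chamber by blast
    ultimately show False by (simp add: word_act_isometry[OF nz])
  qed
  moreover obtain "is" where "word_act bs = simple_word is" using word_is_simple_word assms(1) by blast
  ultimately show ?thesis using simple_word_trivial by metis
qed

lemma weyl_wordE:
  assumes "w \<in> weyl_group \<Delta>"
  obtains bs where "set bs \<subseteq> \<Delta>" "0 \<notin> set bs" "\<And>x. w *v x = word_act bs x" 
    "\<And>x. transpose w *v x = word_act (rev bs) x"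
proof -
  obtain bs where bs: "set bs \<subseteq> \<Delta>" "w = matrix (word_act bs)"
    using assms weyl_group_words[OF zero_not_root] by auto
  have w: "w *v x = word_act bs x" for x by (simp add: bs matrix_works linear_word_act)
  have nz: "0 \<notin> set bs" using bs zero_not_root by auto
  have wt: "transpose w *v x = word_act (rev bs) x" for x
  proof -
    have "(transpose w *v x) \<bullet> y = word_act (rev bs) x \<bullet> y" for y
    proof -
      have "(transpose w *v x) \<bullet> y = x \<bullet> word_act bs y"
        by (simp add: dot_lmul_matrix w[symmetric])
      also have "\<dots> = word_act (rev bs) x \<bullet> word_act (rev bs) (word_act bs y)"
        using nz by (subst word_act_isometry) auto
      finally show ?thesis using nz by (simp add: word_act_rev)
    qed
    then show ?thesis by (metis vector_eq_rdot)
  qed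
  show thesis by (rule that[OF bs(1) nz w wt])
qed

lemma finite_weyl_group: "finite (weyl_group \<Delta>)"
proof -
  have "inj_on (\<lambda>w. restrict ((*v) w) \<Delta>) (weyl_group \<Delta>)"
  proof (rule inj_onI)
    fix w w' assume "restrict ((*v) w) \<Delta> = restrict ((*v) w') \<Delta>"
    then have eq: "w *v \<beta> = w' *v \<beta>" if "\<beta> \<in> \<Delta>" for \<beta>
      using that by (metis restrict_apply')
    have "w *v x = w' *v x" for x
      by (subst (1 2) expand[of x]) (simp add: linear_sum[OF matrix_vector_mul_linear] matrix_vector_mult_scaleR eq simple)
    then show "w = w'" by (simp add: matrix_eq)
  qed
  moreover have "(\<lambda>w. restrict ((*v) w) \<Delta>) ` weyl_group \<Delta> \<subseteq> \<Delta> \<rightarrow>\<^sub>E \<Delta>"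
    by (auto elim!: weyl_wordE intro!: word_root)
  ultimately show ?thesis
    by (meson finite_PiE finite_roots finite_subset finite_imageD)
qed

lemma weyl_group_invertible:
  assumes "w \<in> weyl_group \<Delta>"
  shows "det w \<noteq> 0"
proof -
  obtain bs where bs: "set bs \<subseteq> \<Delta>" "0 \<notin> set bs" "\<And>x. w *v x = word_act bs x" 
    "\<And>x. transpose w *v x = word_act (rev bs) x" by (rule weyl_wordE[OF assms]) blast
  have "transpose w ** w = mat 1"
    by (simp add: matrix_eq matrix_vector_mul_assoc[symmetric] bs word_act_rev del: transpose_matrix_vector)
  then show ?thesis by (metis invertible_det_nz invertible_left_inverse)
qed

lemma weyl_chambers_disjoint:
  assumes "w1 \<in> weyl_group \<Delta>" "w2 \<in> weyl_group \<Delta>" "x1 \<in> open_cone \<alpha>" "x2 \<in> open_cone \<alpha>"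
    and eq: "transpose w1 *v x1 = transpose w2 *v x2"
  shows "w1 = w2"
proof -
  obtain bs where bs: "set bs \<subseteq> \<Delta>" "0 \<notin> set bs" "\<And>x. w1 *v x = word_act bs x" 
    "\<And>x. transpose w1 *v x = word_act (rev bs) x" by (rule weyl_wordE[OF assms(1)]) blast
  obtain cs where cs: "set cs \<subseteq> \<Delta>" "0 \<notin> set cs" "\<And>x. w2 *v x = word_act cs x" 
    "\<And>x. transpose w2 *v x = word_act (rev cs) x" by (rule weyl_wordE[OF assms(2)]) blast
  have cr: "word_act cs (word_act (rev cs) x) = x" for x
    using word_act_rev[of "rev cs" x] cs(2) by simp
  have "word_act (cs @ rev bs) x1 = x2"
    using eq bs(4) cs(4) cr by simp
  then have triv: "word_act cs (word_act (rev bs) x) = x" for x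
    using word_fixing_chamber_trivial[of "cs @ rev bs" x1 x] assms(3,4) bs(1) cs(1) by simp
  have "w1 *v x = w2 *v x" for x
    using triv[of "word_act bs x"] bs(2) by (simp add: bs(3) cs(3) word_act_rev)
  then show ?thesis by (simp add: matrix_eq)
qed

text \<open>Choose \<open>w\<close> such that \<open>w x\<close> has the largest inner product with \<open>\<rho> = (\<Sum>j. \<alpha>' j)\<close>. Reflecting in \<open>\<alpha> i\<close>
  cannot increase this product, which means \<open>(w x) \<bullet> \<alpha> i \<ge> 0\<close>.\<close>

lemma weyl_chamber_cover:
  "\<exists>w \<in> weyl_group \<Delta>. \<forall>i. (w *v x) \<bullet> \<alpha> i \<ge> 0"
proof -
  let ?\<rho> = "sum \<alpha>' UNIV" and ?f = "\<lambda>w. (w *v x) \<bullet> sum \<alpha>' UNIV"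
  have "mat 1 \<in> weyl_group \<Delta>"
    using generate.one[of GL] by (simp add: weyl_group_def GL_def)
  then have "Max (?f ` weyl_group \<Delta>) \<in> ?f ` weyl_group \<Delta>"
    using finite_weyl_group by (intro Max_in) auto
  then obtain w where w: "w \<in> weyl_group \<Delta>" and "Max (?f ` weyl_group \<Delta>) = ?f w" by blast
  then have max: "?f w' \<le> ?f w" if "w' \<in> weyl_group \<Delta>" for w'
    using that finite_weyl_group \<open>Max (?f ` weyl_group \<Delta>) = ?f w\<close> Max_ge[of "?f ` weyl_group \<Delta>" "?f w'"] by auto
  have "(w *v x) \<bullet> \<alpha> i \<ge> 0" for i
  proof -
    let ?r = "matrix (reflection (\<alpha> i))"
    have "?r \<in> weyl_group \<Delta>" unfolding weyl_group_def by (intro generate.incl) (simp add: simple)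
    then have "?r ** w \<in> weyl_group \<Delta>"
      using generate.eng[of ?r GL _ w] w unfolding weyl_group_def by (simp only: GL_def monoid.simps)
    from max[OF this] have "reflection (\<alpha> i) (w *v x) \<bullet> ?\<rho> \<le> (w *v x) \<bullet> ?\<rho>"
      by (simp add: matrix_vector_mul_assoc[symmetric] matrix_works linear_reflection)
    moreover have "\<alpha> i \<bullet> ?\<rho> = 1" by (simp add: inner_sum_right)
    moreover have "\<alpha> i \<bullet> \<alpha> i > 0" using simple zero_not_root by (metis inner_gt_zero_iff)
    ultimately show ?thesis by (simp add: reflection_def inner_diff_left zero_le_divide_iff)
  qed
  then show ?thesis using w by blast
qed

text \<open>The exceptional set consists of the hyperplanes orthogonal to roots; off them the inequalities of the
  covering lemma are strict.\<close>

lemma AE_weyl_chambers: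
  "AE x in lborel. \<exists>w\<in>weyl_group \<Delta>. \<exists>y\<in>open_cone \<alpha>. x = transpose w *v y"
proof -
  have "AE x in lborel. \<forall>\<beta>\<in>\<Delta>. x \<bullet> \<beta> \<noteq> 0"
  proof (rule AE_finite_allI[OF finite_roots])
    fix \<beta> assume "\<beta> \<in> \<Delta>"
    then have "negligible {x. \<beta> \<bullet> x = 0}"
      using zero_not_root by (intro negligible_hyperplane) auto
    then have "AE x in lebesgue. \<not> \<beta> \<bullet> x = 0"
      by (subst AE_iff_null) (auto simp: negligible_iff_null_sets)
    then show "AE x in lborel. x \<bullet> \<beta> \<noteq> 0" by (simp add: AE_completion_iff inner_commute)
  qed
  then show ?thesis
  proof (rule AE_mp, intro AE_I2 impI)
    fix x assume reg: "\<forall>\<beta>\<in>\<Delta>. x \<bullet> \<beta> \<noteq> 0"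
    obtain w where w: "w \<in> weyl_group \<Delta>" and ge: "\<And>i. (w *v x) \<bullet> \<alpha> i \<ge> 0"
      using weyl_chamber_cover by blast
    obtain bs where bs: "set bs \<subseteq> \<Delta>" "0 \<notin> set bs" "\<And>x. w *v x = word_act bs x" 
      "\<And>x. transpose w *v x = word_act (rev bs) x" by (rule weyl_wordE[OF w]) blast
    have "(w *v x) \<bullet> \<alpha> i \<noteq> 0" for i
    proof -
      have "(w *v x) \<bullet> \<alpha> i = word_act (rev bs) (word_act bs x) \<bullet> word_act (rev bs) (\<alpha> i)"
        using bs by (simp add: word_act_isometry)
      also have "\<dots> = x \<bullet> word_act (rev bs) (\<alpha> i)" using bs by (simp add: word_act_rev)
      finally show ?thesis using reg word_root[of "rev bs" "\<alpha> i"] bs simple by auto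
    qed
    then have "w *v x \<in> open_cone \<alpha>" using ge by (auto simp: open_cone_def less_le)
    moreover have "x = transpose w *v (w *v x)" by (simp add: bs word_act_rev del: transpose_matrix_vector)
    ultimately show "\<exists>w\<in>weyl_group \<Delta>. \<exists>y\<in>open_cone \<alpha>. x = transpose w *v y" using w by blast
  qed
qed

end

section \<open>Integrals of periodic functions over transversals\<close>

definition periodic :: "real^'n^'n \<Rightarrow> (real^'n \<Rightarrow> 'b) \<Rightarrow> bool" where
  "periodic H F \<longleftrightarrow> (\<forall>x. \<forall>l\<in>int_lattice H. F (x + l) = F x)"

lemma count_space_single:
  assumes "\<exists>!l. l \<in> A \<and> P l"
  shows "(\<integral>\<^sup>+l. of_bool (P l) \<partial>count_space A) = (1 :: ennreal)"
proof -
  obtain l0 where l0: "l0 \<in> A" "P l0" "\<And>l. l \<in> A \<Longrightarrow> P l \<Longrightarrow> l = l0" using assms by blast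
  have "(\<integral>\<^sup>+l. of_bool (P l) \<partial>count_space A) = (\<integral>\<^sup>+l. indicator {l0} l \<partial>count_space A)"
  proof (rule nn_integral_cong)
    fix l assume "l \<in> space (count_space A)"
    then have "P l \<longleftrightarrow> l = l0" using l0(2) l0(3)[of l] by (simp, blast)
    then show "of_bool (P l) = (indicator {l0} l :: ennreal)" by simp
  qed
  also have "\<dots> = emeasure (count_space A) {l0}" by (rule nn_integral_indicator) (use l0(1) in auto)
  also have "\<dots> = 1" using l0(1) by (subst emeasure_count_space_finite) auto
  finally show ?thesis .
qed

text \<open>Every point of \<open>E1\<close> has exactly one lattice translate in \<open>E2\<close> and conversely. Inserting the resulting
  partitions of unity and translating each summand exchanges the two sets.\<close>

lemma transversal_nn_integral:
  fixes F :: "real^'n \<Rightarrow> ennreal"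
  assumes [measurable]: "E1 \<in> sets borel" "E2 \<in> sets borel" "F \<in> borel_measurable borel"
    and T1: "transversal (lattice_rel H) UNIV E1" and T2: "transversal (lattice_rel H) UNIV E2"
    and F: "periodic H F"
  shows "(\<integral>\<^sup>+x. F x * indicator E1 x \<partial>lborel) = (\<integral>\<^sup>+x. F x * indicator E2 x \<partial>lborel)"
proof -
  let ?L = "int_lattice H"
  have one2: "(\<integral>\<^sup>+l. indicator E2 (x + l) \<partial>count_space ?L) = (1 :: ennreal)" for x
  proof -
    obtain y where y: "y \<in> E2" "y - x \<in> ?L" "\<And>z. z \<in> E2 \<Longrightarrow> z - x \<in> ?L \<Longrightarrow> z = y"
      using T2 unfolding transversal_def lattice_rel_def by (metis UNIV_I)
    have "\<exists>!l. l \<in> ?L \<and> x + l \<in> E2"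
    proof (rule ex1I[of _ "y - x"])
      fix l assume "l \<in> ?L \<and> x + l \<in> E2"
      then have "x + l = y" using y(3)[of "x + l"] by simp
      then show "l = y - x" by (simp add: algebra_simps)
    qed (use y(1,2) in simp)
    from count_space_single[OF this] show ?thesis by (simp add: indicator_def)
  qed
  have one1: "(\<integral>\<^sup>+l. indicator E1 (x - l) \<partial>count_space ?L) = (1 :: ennreal)" for x
  proof -
    obtain y where y: "y \<in> E1" "y - x \<in> ?L" "\<And>z. z \<in> E1 \<Longrightarrow> z - x \<in> ?L \<Longrightarrow> z = y"
      using T1 unfolding transversal_def lattice_rel_def by (metis UNIV_I)
    have "\<exists>!l. l \<in> ?L \<and> x - l \<in> E1"
    proof (rule ex1I[of _ "x - y"])
      show "x - y \<in> ?L \<and> x - (x - y) \<in> E1" using y(1) lattice_minus[OF y(2)] by simp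
      fix l assume "l \<in> ?L \<and> x - l \<in> E1"
      then have "x - l = y" using y(3)[of "x - l"] lattice_minus[of l H] by simp
      then show "l = x - y" by (simp add: algebra_simps)
    qed
    from count_space_single[OF this] show ?thesis by (simp add: indicator_def)
  qed
  have "(\<integral>\<^sup>+x. F x * indicator E1 x \<partial>lborel)
      = (\<integral>\<^sup>+x. (\<integral>\<^sup>+l. F x * indicator E1 x * indicator E2 (x + l) \<partial>count_space ?L) \<partial>lborel)"
    by (simp add: nn_integral_cmult one2)
  also have "\<dots> = (\<integral>\<^sup>+l. (\<integral>\<^sup>+x. F x * indicator E1 x * indicator E2 (x + l) \<partial>lborel) \<partial>count_space ?L)"
    by (rule nn_integral_count_space_nn_integral[OF countable_lattice]) measurable
  also have "\<dots> = (\<integral>\<^sup>+l. (\<integral>\<^sup>+x. F x * indicator E1 (x - l) * indicator E2 x \<partial>lborel) \<partial>count_space ?L)"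
  proof (rule nn_integral_cong)
    fix l assume "l \<in> space (count_space ?L)"
    then have l: "F (x - l) = F x" for x
      using F lattice_minus[of l H] by (auto simp: periodic_def dest!: spec[of _ x] bspec[of _ _ "- l"])
    have "(\<integral>\<^sup>+x. F x * indicator E1 x * indicator E2 (x + l) \<partial>lborel)
        = (\<integral>\<^sup>+x. F (x + (- l)) * indicator E1 (x + (- l)) * indicator E2 (x + (- l) + l) \<partial>lborel)"
      by (rule nn_integral_shift[symmetric, where f = "\<lambda>x. F x * indicator E1 x * indicator E2 (x + l)"]) measurable
    then show "(\<integral>\<^sup>+x. F x * indicator E1 x * indicator E2 (x + l) \<partial>lborel)
        = (\<integral>\<^sup>+x. F x * indicator E1 (x - l) * indicator E2 x \<partial>lborel)" by (simp add: l)
  qed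
  also have "\<dots> = (\<integral>\<^sup>+x. (\<integral>\<^sup>+l. F x * indicator E1 (x - l) * indicator E2 x \<partial>count_space ?L) \<partial>lborel)"
    by (rule nn_integral_count_space_nn_integral[OF countable_lattice, symmetric]) measurable
  also have "\<dots> = (\<integral>\<^sup>+x. F x * indicator E2 x \<partial>lborel)"
    by (simp add: nn_integral_cmult nn_integral_multc one1)
  finally show ?thesis .
qed

lemma emeasure_unit_cell:
  assumes "det (H :: real^'n^'n) \<noteq> 0"
  shows "emeasure lborel (unit_cell H) = ennreal \<bar>det H\<bar>"
proof -
  define Q where "Q = {x::real^'n. \<forall>i. 0 \<le> x $ i \<and> x $ i < 1}"
  have [measurable]: "Q \<in> sets borel" unfolding Q_def by measurable
  have basis: "(\<Prod>b\<in>Basis. (1 - 0 :: real^'n) \<bullet> b) = 1"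
    by (rule prod.neutral) (auto simp: Basis_vec_def inner_axis)
  have "emeasure lborel (box 0 (1::real^'n)) \<le> emeasure lborel Q"
    by (rule emeasure_mono) (auto simp: Q_def mem_box_cart less_imp_le)
  moreover have "emeasure lborel Q \<le> emeasure lborel (cbox 0 (1::real^'n))"
    by (rule emeasure_mono) (auto simp: Q_def mem_box_cart less_imp_le)
  moreover have "emeasure lborel (box 0 (1::real^'n)) = 1" "emeasure lborel (cbox 0 (1::real^'n)) = 1"
    using basis by (auto simp: emeasure_lborel_box_eq emeasure_lborel_cbox_eq Basis_vec_def inner_axis)
  ultimately have Q1: "emeasure lborel Q = 1" by auto
  have inv: "det (matrix_inv H) * det H = 1"
    using matrix_inv_mult(1)[OF assms] det_mul[of "matrix_inv H" H] by simp
  then have nz: "det (matrix_inv H) \<noteq> 0" by auto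
  have "ennreal \<bar>det (matrix_inv H)\<bar> * (\<integral>\<^sup>+x. indicator Q (matrix_inv H *v x) \<partial>lborel) = (\<integral>\<^sup>+x. indicator Q x \<partial>lborel)"
    by (rule nn_integral_linear[OF nz]) measurable
  also have "(\<lambda>x. indicator Q (matrix_inv H *v x) :: ennreal) = indicator (unit_cell H)"
    by (auto simp: fun_eq_iff indicator_def Q_def unit_cell_def)
  finally have "ennreal \<bar>det (matrix_inv H)\<bar> * emeasure lborel (unit_cell H) = 1"
    by (simp add: Q1)
  then have "ennreal \<bar>det H\<bar> * (ennreal \<bar>det (matrix_inv H)\<bar> * emeasure lborel (unit_cell H)) = ennreal \<bar>det H\<bar>" by simp
  moreover have "ennreal \<bar>det H\<bar> * ennreal \<bar>det (matrix_inv H)\<bar> = 1"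
    using inv by (simp add: ennreal_mult[symmetric] abs_mult[symmetric] mult.commute)
  ultimately show ?thesis by (simp add: mult.assoc[symmetric])
qed

lemma emeasure_transversal:
  assumes "det (H :: real^'n^'n) \<noteq> 0" "E \<in> sets borel" "transversal (lattice_rel H) UNIV E"
  shows "emeasure lborel E = ennreal \<bar>det H\<bar>"
  using transversal_nn_integral[OF assms(2) sets_unit_cell _ assms(3) unit_cell_transversal[OF assms(1)], of "\<lambda>_. 1"] 
    assms(2) emeasure_unit_cell[OF assms(1)] by (simp add: periodic_def)

text \<open>Adding the bound \<open>B\<close> makes the integrand nonnegative, at the cost of the same constant for both sets.\<close>

lemma transversal_integral_real:
  fixes f :: "real^'n \<Rightarrow> real"
  assumes H: "det H \<noteq> 0" and [measurable]: "E1 \<in> sets borel" "E2 \<in> sets borel" "f \<in> borel_measurable borel"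
    and T1: "transversal (lattice_rel H) UNIV E1" and T2: "transversal (lattice_rel H) UNIV E2"
    and f: "periodic H f" and B: "\<And>x. \<bar>f x\<bar> \<le> B"
  shows "(\<integral>x. f x * indicator E1 x \<partial>lborel) = (\<integral>x. f x * indicator E2 x \<partial>lborel)"
proof -
  have B0: "B \<ge> 0" using B[of 0] by linarith
  have eq: "(\<integral>x. f x * indicator E x \<partial>lborel) =
      enn2real (\<integral>\<^sup>+x. ennreal (f x + B) * indicator E x \<partial>lborel) - B * \<bar>det H\<bar>"
    if [measurable]: "E \<in> sets borel" and "transversal (lattice_rel H) UNIV E" for E
  proof -
    have em: "emeasure lborel E = ennreal \<bar>det H\<bar>" by (rule emeasure_transversal[OF H that])
    have iE: "integrable lborel (\<lambda>x. B * indicator E x :: real)" using em by (intro integrable_mult_right) simp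
    have i: "integrable lborel (\<lambda>x. f x * indicator E x)"
      by (rule Bochner_Integration.integrable_bound[OF iE]) (use B B0 in \<open>auto simp: abs_mult split: split_indicator\<close>)
    have "(\<integral>x. f x * indicator E x \<partial>lborel) + B * \<bar>det H\<bar> = (\<integral>x. f x * indicator E x + B * indicator E x \<partial>lborel)"
      using i iE em by (simp add: measure_def)
    also have "\<dots> = enn2real (\<integral>\<^sup>+x. ennreal (f x * indicator E x + B * indicator E x) \<partial>lborel)"
    proof (rule integral_eq_nn_integral)
      show "AE x in lborel. 0 \<le> f x * indicator E x + B * indicator E x"
        using B by (intro AE_I2) (auto split: split_indicator simp: abs_le_iff, smt (verit))
    qed measurable
    also have "(\<integral>\<^sup>+x. ennreal (f x * indicator E x + B * indicator E x) \<partial>lborel) = (\<integral>\<^sup>+x. ennreal (f x + B) * indicator E x \<partial>lborel)"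
      by (intro nn_integral_cong) (auto split: split_indicator)
    finally show ?thesis by simp
  qed
  have "(\<integral>\<^sup>+x. ennreal (f x + B) * indicator E1 x \<partial>lborel) = (\<integral>\<^sup>+x. ennreal (f x + B) * indicator E2 x \<partial>lborel)"
    by (rule transversal_nn_integral[OF _ _ _ T1 T2]) (use f in \<open>auto simp: periodic_def\<close>)
  then show ?thesis using eq[OF _ T1] eq[OF _ T2] by simp
qed

lemma transversal_translate:
  assumes "transversal (lattice_rel H) UNIV E"
  shows "transversal (lattice_rel H) UNIV {x. x + v \<in> E}"
  unfolding transversal_def
proof (intro conjI ballI)
  fix x
  obtain y where y: "y \<in> E" "y - (x + v) \<in> int_lattice H" "\<And>z. z \<in> E \<Longrightarrow> z - (x + v) \<in> int_lattice H \<Longrightarrow> z = y"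
    using assms unfolding transversal_def lattice_rel_def by (metis UNIV_I)
  show "\<exists>!z. z \<in> {x. x + v \<in> E} \<and> lattice_rel H x z"
  proof (rule ex1I[of _ "y - v"])
    show "y - v \<in> {x. x + v \<in> E} \<and> lattice_rel H x (y - v)"
      using y(1,2) by (simp add: lattice_rel_def algebra_simps)
    fix z assume "z \<in> {x. x + v \<in> E} \<and> lattice_rel H x z"
    then have "z + v = y" by (intro y(3)) (simp_all add: lattice_rel_def)
    then show "z = y - v" by (simp add: algebra_simps)
  qed
qed simp

text \<open>Its columns are the basis dual to the columns of \<open>G\<close>, so it generates the lattice dual to that of \<open>G\<close>.\<close>

definition dual_lattice_matrix :: "real^'n^'n \<Rightarrow> real^'n^'n" where
  "dual_lattice_matrix G = transpose (matrix_inv G)"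

lemma det_dual_lattice_matrix: "det (dual_lattice_matrix G) * det G = 1" if "det G \<noteq> 0"
  using matrix_inv_mult(1)[OF that] det_mul[of "matrix_inv G" G] by (simp add: dual_lattice_matrix_def det_transpose)

lemma inner_dual_lattice:
  assumes "det G \<noteq> 0"
  shows "(G *v z) \<bullet> (dual_lattice_matrix G *v w) = z \<bullet> w"
proof -
  have "(G *v z) \<bullet> (dual_lattice_matrix G *v w) = (w v* matrix_inv G) \<bullet> (G *v z)"
    by (simp add: dual_lattice_matrix_def inner_commute)
  also have "\<dots> = w \<bullet> (matrix_inv G *v (G *v z))" by (rule dot_lmul_matrix)
  finally show ?thesis by (simp add: matrix_inv_cancel[OF assms] inner_commute)
qed

definition wave :: "real^'n \<Rightarrow> real^'n \<Rightarrow> complex" where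
  "wave t \<xi> = cis (2 * pi * (t \<bullet> \<xi>))"

lemma measurable_wave [measurable]: "wave t \<in> borel_measurable borel"
  unfolding wave_def[abs_def] by measurable

lemma norm_wave [simp]: "norm (wave t \<xi>) = 1" by (simp add: wave_def)

lemma wave_add: "wave t (x + y) = wave t x * wave t y"
  by (simp add: wave_def cis_mult inner_add_right distrib_left)

lemma wave_add_left: "wave (s + t) x = wave s x * wave t x"
  by (simp add: wave_def cis_mult inner_add_left distrib_left)

lemma wave_minus: "wave (- t) x = cnj (wave t x)"
  by (simp add: wave_def cis_cnj)

lemma wave_zero [simp]: "wave 0 x = 1" by (simp add: wave_def)

text \<open>The inner product of a point of the lattice with a point of the dual lattice is an integer.\<close>

lemma wave_periodic:
  assumes "det G \<noteq> 0" "t \<in> int_lattice G"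
  shows "periodic (dual_lattice_matrix G) (wave t)"
  unfolding periodic_def
proof (intro allI ballI)
  fix x l assume "l \<in> int_lattice (dual_lattice_matrix G)"
  then obtain z w where zw: "t = G *v z" "\<forall>i. z $ i \<in> \<int>" "l = dual_lattice_matrix G *v w" "\<forall>i. w $ i \<in> \<int>"
    using assms(2) by (auto simp: int_lattice_def)
  have "t \<bullet> l = (\<Sum>i\<in>UNIV. z $ i * w $ i)"
    using zw inner_dual_lattice[OF assms(1)] by (simp add: inner_vec_def)
  then have "t \<bullet> l \<in> \<int>" using zw by auto
  then have "wave t l = 1"
    by (auto simp: wave_def elim!: Ints_cases)
  then show "wave t (x + l) = wave t x" by (simp add: wave_add)
qed

lemma integrable_complex_indicator:
  assumes "E \<in> sets M" "emeasure M E < \<infinity>"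
  shows "integrable M (indicator E :: 'a \<Rightarrow> complex)"
proof -
  have "integrable M (\<lambda>x. complex_of_real (indicator E x))"
    using assms by (intro integrable_of_real integrable_real_indicator)
  moreover have "(\<lambda>x. complex_of_real (indicator E x)) = indicator E"
    by (auto simp: fun_eq_iff split: split_indicator)
  ultimately show ?thesis by simp
qed

text \<open>Let \<open>t \<bullet> v = 1/2\<close>. Translation by \<open>v\<close> changes the sign of the character and maps \<open>E\<close> to another
  transversal, over which the periodic character has the same integral. So the integral equals its own
  negative.\<close>

lemma integral_wave_transversal:
  fixes G :: "real^'n^'n"
  assumes G: "det G \<noteq> 0" and t: "t \<in> int_lattice G" "t \<noteq> 0"
    and [measurable]: "E \<in> sets borel" and T: "transversal (lattice_rel (dual_lattice_matrix G)) UNIV E"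
  shows "(\<integral>\<xi>. wave t \<xi> * indicator E \<xi> \<partial>lborel) = 0"
proof -
  define v where "v = (1 / (2 * (t \<bullet> t))) *\<^sub>R t"
  have tv: "t \<bullet> v = 1 / 2" using t(2) by (simp add: v_def)
  have "wave t v = - 1" unfolding wave_def tv by simp
  then have wv: "wave t (\<xi> + v) = - wave t \<xi>" for \<xi> by (simp add: wave_add)
  let ?E' = "{x. x + v \<in> E}"
  have [measurable]: "?E' \<in> sets borel" by (rule sets_translate) measurable
  have H: "det (dual_lattice_matrix G) \<noteq> 0" using det_dual_lattice_matrix[OF G] by auto
  have per: "periodic (dual_lattice_matrix G) (wave t)" by (rule wave_periodic[OF G t(1)])
  have em: "emeasure lborel E = ennreal \<bar>det (dual_lattice_matrix G)\<bar>" by (rule emeasure_transversal[OF H _ T]) measurable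
  have i: "integrable lborel (\<lambda>\<xi>. wave t \<xi> * indicator E \<xi>)"
    by (rule integrable_bounded_mult(2)[where B = 1]) (use em in \<open>auto intro!: integrable_complex_indicator\<close>)
  have part: "(\<integral>\<xi>. f (wave t \<xi> * indicator E \<xi>) \<partial>lborel) = 0"
    if f: "bounded_linear f" and ff: "\<And>z. \<bar>f z\<bar> \<le> norm z" for f :: "complex \<Rightarrow> real"
  proof -
    interpret f: bounded_linear f by fact
    have [measurable]: "f \<in> borel_measurable borel"
      by (intro borel_measurable_continuous_onI) (rule f.continuous_on[OF continuous_on_id])
    have fi: "f (wave t \<xi> * indicator A \<xi>) = f (wave t \<xi>) * indicator A \<xi>" for \<xi> A
      by (auto split: split_indicator simp: f.zero)
    have "(\<integral>\<xi>. f (wave t \<xi>) * indicator E \<xi> \<partial>lborel) = (\<integral>\<xi>. f (wave t \<xi>) * indicator ?E' \<xi> \<partial>lborel)"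
    proof (rule transversal_integral_real[OF H _ _ _ T transversal_translate[OF T]])
      show "\<bar>f (wave t \<xi>)\<bar> \<le> 1" for \<xi> using ff[of "wave t \<xi>"] by simp
    qed (use per in \<open>auto simp: periodic_def\<close>)
    also have "\<dots> = (\<integral>\<xi>. - f (wave t (\<xi> + v)) * indicator E (\<xi> + v) \<partial>lborel)"
      by (simp add: wv f.neg indicator_def)
    also have "\<dots> = (\<integral>\<xi>. - f (wave t \<xi>) * indicator E \<xi> \<partial>lborel)"
      by (rule integral_shift[where f = "\<lambda>\<xi>. - f (wave t \<xi>) * indicator E \<xi>"]) measurable
    finally show ?thesis by (simp add: fi)
  qed
  show ?thesis
  proof (rule complex_eqI)
    show "Re (\<integral>\<xi>. wave t \<xi> * indicator E \<xi> \<partial>lborel) = Re 0"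
      using part[of Re] abs_Re_le_cmod bounded_linear_Re i by (simp add: integral_Re[symmetric] del: Re_complex_of_real)
    show "Im (\<integral>\<xi>. wave t \<xi> * indicator E \<xi> \<partial>lborel) = Im 0"
      using part[of Im] abs_Im_le_cmod bounded_linear_Im i by (simp add: integral_Im[symmetric])
  qed
qed

section \<open>Density of trigonometric polynomials\<close>

text \<open>Finite linear combinations are generated inductively, so that closure properties are proved without
  handling families of coefficients.\<close>

inductive lin_comb :: "('i \<Rightarrow> 'a \<Rightarrow> complex) \<Rightarrow> 'i set \<Rightarrow> ('a \<Rightarrow> complex) \<Rightarrow> bool" for e I where
  zero: "lin_comb e I (\<lambda>x. 0)"
| monomial: "i \<in> I \<Longrightarrow> lin_comb e I (\<lambda>x. c * e i x)"
| add: "lin_comb e I p \<Longrightarrow> lin_comb e I q \<Longrightarrow> lin_comb e I (\<lambda>x. p x + q x)"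

lemma lin_comb_scale:
  assumes "lin_comb e I p"
  shows "lin_comb e I (\<lambda>x. c * p x)"
  using assms
proof induction
  case zero
  then show ?case by (simp add: lin_comb.zero)
next
  case (monomial i d)
  then show ?case using lin_comb.monomial[of i I e "c * d"] by (simp add: mult.assoc)
next
  case (add p q)
  then show ?case using lin_comb.add[OF add.IH] by (simp add: distrib_left)
qed

lemma lin_comb_coefficients:
  assumes "lin_comb e I p"
  shows "\<exists>J c. finite J \<and> J \<subseteq> I \<and> p = (\<lambda>x. \<Sum>i\<in>J. c i * e i x)"
  using assms
proof induction
  case zero
  show ?case by (intro exI[of _ "{}"]) simp
next
  case (monomial i c)
  then show ?case by (intro exI[of _ "{i}"] exI[of _ "\<lambda>_. c"]) auto
next
  case (add p q)
  then obtain J c K d where J: "finite J" "J \<subseteq> I" "p = (\<lambda>x. \<Sum>i\<in>J. c i * e i x)"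
    and K: "finite K" "K \<subseteq> I" "q = (\<lambda>x. \<Sum>i\<in>K. d i * e i x)" by blast
  let ?c = "\<lambda>i. (if i \<in> J then c i else 0) + (if i \<in> K then d i else 0)"
  have "(\<Sum>i\<in>J \<union> K. ?c i * e i x) = p x + q x" for x
  proof -
    have "(\<Sum>i\<in>J \<union> K. ?c i * e i x) = (\<Sum>i\<in>J \<union> K. (if i \<in> J then c i * e i x else 0))
        + (\<Sum>i\<in>J \<union> K. (if i \<in> K then d i * e i x else 0))"
      unfolding sum.distrib[symmetric] by (intro sum.cong) (auto simp: distrib_right)
    also have "(\<Sum>i\<in>J \<union> K. (if i \<in> J then c i * e i x else 0)) = p x"
      using J K by (simp add: sum.If_cases Int_absorb1)
    also have "(\<Sum>i\<in>J \<union> K. (if i \<in> K then d i * e i x else 0)) = q x"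
      using J K by (simp add: sum.If_cases Int_absorb1)
    finally show ?thesis .
  qed
  then show ?case using J K by (intro exI[of _ "J \<union> K"] exI[of _ ?c]) (auto simp: fun_eq_iff)
qed

abbreviation trig_poly :: "(real^'n) set \<Rightarrow> (real^'n \<Rightarrow> complex) \<Rightarrow> bool" where
  "trig_poly \<equiv> lin_comb wave"

lemma trig_poly_const: "trig_poly (int_lattice G) (\<lambda>\<xi>. c)"
  using lin_comb.monomial[of 0 "int_lattice G" wave c] by simp

lemma trig_poly_mult:
  assumes "trig_poly (int_lattice G) p" "trig_poly (int_lattice G) q"
  shows "trig_poly (int_lattice G) (\<lambda>\<xi>. p \<xi> * q \<xi>)"
  using assms(1)
proof induction
  case zero
  show ?case by (simp add: lin_comb.zero)
next
  case (monomial t c)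
  from assms(2) show ?case
  proof induction
    case zero
    show ?case by (simp add: lin_comb.zero)
  next
    case (monomial s d)
    have "trig_poly (int_lattice G) (\<lambda>\<xi>. (c * d) * wave (t + s) \<xi>)"
      by (intro lin_comb.monomial lattice_add \<open>t \<in> int_lattice G\<close> \<open>s \<in> int_lattice G\<close>)
    then show ?case by (simp add: wave_add_left mult_ac)
  next
    case (add p q)
    then show ?case using lin_comb.add[OF add.IH] by (simp add: distrib_left)
  qed
next
  case (add p q)
  then show ?case using lin_comb.add[OF add.IH] by (simp add: distrib_right)
qed

lemma trig_poly_sum:
  assumes "\<And>i. i \<in> I \<Longrightarrow> trig_poly (int_lattice G) (f i)"
  shows "trig_poly (int_lattice G) (\<lambda>\<xi>. \<Sum>i\<in>I. f i \<xi>)"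
  using assms by (induction I rule: infinite_finite_induct) (auto intro: trig_poly_const lin_comb.add)

lemma measurable_trig_poly:
  assumes "trig_poly \<Gamma> p"
  shows "p \<in> borel_measurable borel"
  using assms by induction measurable

definition torus :: "real^'n \<Rightarrow> complex^'n" where
  "torus x = (\<chi> i. cis (2 * pi * x $ i))"

lemma continuous_torus: "continuous_on A torus"
  unfolding torus_def by (intro continuous_intros)

text \<open>The real and imaginary parts of the coordinates of \<open>torus\<close> are combinations of a character and its
  conjugate, and trigonometric polynomials form an algebra.\<close>

lemma trig_poly_of_real_polynomial:
  fixes G :: "real^'n^'n" and r :: "complex^'n \<Rightarrow> real"
  assumes "real_polynomial_function r"
  shows "trig_poly (int_lattice G) (\<lambda>\<xi>. complex_of_real (r (torus (transpose G *v \<xi>))))"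
  using assms
proof induction
  case (linear f)
  then interpret f: bounded_linear f .
  let ?e = "\<lambda>i. G *v axis i 1"
  have e: "?e i \<in> int_lattice G" for i by (auto simp: int_lattice_def axis_def)
  have coord: "(transpose G *v \<xi>) $ i = ?e i \<bullet> \<xi>" for i \<xi>
  proof -
    have "?e i \<bullet> \<xi> = \<xi> \<bullet> (G *v axis i 1)" by (rule inner_commute)
    also have "\<dots> = (\<xi> v* G) \<bullet> axis i 1" by (rule dot_lmul_matrix[symmetric])
    finally show ?thesis by (simp add: inner_axis)
  qed
  have f: "complex_of_real (f (torus (transpose G *v \<xi>))) =
      (\<Sum>i\<in>UNIV. complex_of_real (f (axis i 1)) * ((1/2) * wave (?e i) \<xi> + (1/2) * wave (- ?e i) \<xi>)
         + complex_of_real (f (axis i \<i>)) * ((1/(2*\<i>)) * wave (?e i) \<xi> + (- 1/(2*\<i>)) * wave (- ?e i) \<xi>))" for \<xi>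
  proof -
    let ?z = "torus (transpose G *v \<xi>)"
    have zi: "?z $ i = wave (?e i) \<xi>" for i unfolding torus_def wave_def by (simp add: coord del: transpose_matrix_vector)
    have "?z = (\<Sum>i\<in>UNIV. Re (?z $ i) *\<^sub>R axis i 1 + Im (?z $ i) *\<^sub>R axis i \<i>)"
      by (auto simp: vec_eq_iff axis_def complex_eq_iff if_distrib[of "\<lambda>x. _ *\<^sub>R x"] if_distrib[of Re] if_distrib[of Im] cong: if_cong)
    then have "f ?z = (\<Sum>i\<in>UNIV. Re (?z $ i) * f (axis i 1) + Im (?z $ i) * f (axis i \<i>))"
      using f.sum f.add f.scale by (metis (mono_tags, lifting) real_scaleR_def sum.cong)
    then have "complex_of_real (f ?z) = (\<Sum>i\<in>UNIV. complex_of_real (Re (?z $ i)) * complex_of_real (f (axis i 1))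
         + complex_of_real (Im (?z $ i)) * complex_of_real (f (axis i \<i>)))" by simp
    also have "\<dots> = (\<Sum>i\<in>UNIV. complex_of_real (f (axis i 1)) * ((1/2) * wave (?e i) \<xi> + (1/2) * wave (- ?e i) \<xi>)
         + complex_of_real (f (axis i \<i>)) * ((1/(2*\<i>)) * wave (?e i) \<xi> + (- 1/(2*\<i>)) * wave (- ?e i) \<xi>))"
    proof (rule sum.cong[OF refl])
      fix i
      have "complex_of_real (Re w) = (1/2) * w + (1/2) * cnj w" "complex_of_real (Im w) = (1/(2*\<i>)) * w + (- 1/(2*\<i>)) * cnj w" for w
        by (auto simp: complex_eq_iff)
      then show "complex_of_real (Re (?z $ i)) * complex_of_real (f (axis i 1))
         + complex_of_real (Im (?z $ i)) * complex_of_real (f (axis i \<i>)) = complex_of_real (f (axis i 1)) * ((1/2) * wave (?e i) \<xi> + (1/2) * wave (- ?e i) \<xi>)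
         + complex_of_real (f (axis i \<i>)) * ((1/(2*\<i>)) * wave (?e i) \<xi> + (- 1/(2*\<i>)) * wave (- ?e i) \<xi>)"
        unfolding zi wave_minus by (simp only: mult.commute)
    qed
    finally show ?thesis .
  qed
  show ?case unfolding f
    by (intro trig_poly_sum lin_comb.add trig_poly_mult trig_poly_const lin_comb.monomial e lattice_minus)
next
  case (const c)
  show ?case by (rule trig_poly_const)
next
  case (add f g)
  then show ?case using lin_comb.add[OF add.IH] by simp
next
  case (mult f g)
  then show ?case using trig_poly_mult[OF mult.IH] by simp
qed

lemma cis_eq_imp_int_diff: "cis (2 * pi * a) = cis (2 * pi * b) \<Longrightarrow> a - b \<in> \<int>"
proof -
  assume "cis (2 * pi * a) = cis (2 * pi * b)"
  then have "exp (\<i> * complex_of_real (2 * pi * a)) = exp (\<i> * complex_of_real (2 * pi * b))" by (simp only: cis_conv_exp)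
  then obtain n :: int where "\<i> * complex_of_real (2 * pi * a) = \<i> * complex_of_real (2 * pi * b) + (of_int (2 * n) * pi) * \<i>"
    using exp_eq by metis
  then have "\<i> * complex_of_real (2 * pi * a) = \<i> * complex_of_real (2 * pi * b + 2 * n * pi)" by (simp add: algebra_simps)
  then have "2 * pi * a = 2 * pi * b + 2 * n * pi" by (metis complex_i_not_zero mult_cancel_left of_real_eq_iff)
  then have "2 * pi * (a - b) = 2 * pi * n" by (simp add: algebra_simps)
  then have "a - b = n" by simp
  then show ?thesis by simp
qed

text \<open>The map \<open>torus\<close> identifies distinct points of the cube only on the boundary, where \<open>g\<close> vanishes, so \<open>g\<close>
  factors through it. The factor is continuous because its graph is the continuous image of the compact
  cube.\<close>

lemma continuous_torus_lift:
  fixes g :: "real^'n \<Rightarrow> real"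
  assumes cont: "continuous_on (cbox 0 1) g"
    and bd: "\<And>x i. x \<in> cbox 0 1 \<Longrightarrow> x $ i = 0 \<or> x $ i = 1 \<Longrightarrow> g x = 0"
  shows "\<exists>q. continuous_on (torus ` cbox 0 1) q \<and> (\<forall>x\<in>cbox 0 1. q (torus x) = g x)"
proof -
  define q where "q z = g (SOME x. x \<in> cbox 0 1 \<and> torus x = z)" for z :: "complex^'n"
  have q: "q (torus x) = g x" if x: "x \<in> cbox 0 1" for x
  proof -
    define y where "y = (SOME y. y \<in> cbox 0 1 \<and> torus y = torus x)"
    have y: "y \<in> cbox 0 1 \<and> torus y = torus x" unfolding y_def by (rule someI[of _ x]) (simp add: x)
    have "g y = g x"
    proof (cases "y = x")
      case False
      then obtain i where i: "y $ i \<noteq> x $ i" by (auto simp: vec_eq_iff)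
      have "cis (2 * pi * y $ i) = cis (2 * pi * x $ i)" using y by (auto simp: torus_def vec_eq_iff)
      then have "y $ i - x $ i \<in> \<int>" by (rule cis_eq_imp_int_diff)
      then obtain n :: int where n: "y $ i - x $ i = n" by (auto elim: Ints_cases)
      have b: "0 \<le> x $ i" "x $ i \<le> 1" "0 \<le> y $ i" "y $ i \<le> 1" using x y by (auto simp: mem_box_cart)
      then have "real_of_int n \<le> 1" "real_of_int n \<ge> - 1" "n \<noteq> 0" using n i by auto
      then have "n = 1 \<or> n = - 1" by linarith
      then have "(y $ i = 0 \<or> y $ i = 1) \<and> (x $ i = 0 \<or> x $ i = 1)" using n b by auto
      then show ?thesis using bd[OF x] bd[of y] y by metis
    qed simp
    then show ?thesis by (simp add: q_def y_def)
  qed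
  have "continuous_on (torus ` cbox 0 1) q"
  proof (rule continuous_from_closed_graph)
    show "compact (g ` cbox 0 1)" by (rule compact_continuous_image[OF cont compact_cbox])
    show "q \<in> torus ` cbox 0 1 \<rightarrow> g ` cbox 0 1" using q by auto
    have "(\<lambda>z. (z, q z)) ` torus ` cbox 0 1 = (\<lambda>x. (torus x, g x)) ` cbox 0 1"
      using q by (force simp: image_image)
    moreover have "compact ((\<lambda>x. (torus x, g x)) ` cbox 0 1)"
      by (intro compact_continuous_image compact_cbox continuous_on_Pair continuous_torus cont)
    ultimately show "closed ((\<lambda>z. (z, q z)) ` torus ` cbox 0 1)" by (simp add: compact_imp_closed)
  qed
  then show ?thesis using q by blast
qed

lemma dual_lattice_transpose_cancel:
  assumes "det (G :: real^'n^'n) \<noteq> 0"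
  shows "dual_lattice_matrix G *v (transpose G *v x) = x" "transpose G *v (dual_lattice_matrix G *v x) = x"
    "matrix_inv (dual_lattice_matrix G) *v x = transpose G *v x"
proof -
  have "dual_lattice_matrix G ** transpose G = mat 1" "transpose G ** dual_lattice_matrix G = mat 1"
    unfolding dual_lattice_matrix_def matrix_transpose_mul[symmetric] by (simp_all add: matrix_inv_mult[OF assms])
  then show 1: "dual_lattice_matrix G *v (transpose G *v x) = x" "transpose G *v (dual_lattice_matrix G *v x) = x" for x
    by (simp_all add: matrix_vector_mul_assoc del: transpose_matrix_vector)
  have "det (dual_lattice_matrix G) \<noteq> 0" using det_dual_lattice_matrix[OF assms] by auto
  from matrix_inv_cancel(1)[OF this, of "transpose G *v x"] show "matrix_inv (dual_lattice_matrix G) *v x = transpose G *v x"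
    by (simp only: 1(1))
qed

text \<open>The part of \<open>A\<close> in the interior of the cell is approximated by a Urysohn function with values in
  \<open>[0, 1]\<close> that vanishes outside the interior. That function descends to a continuous function on the
  torus, which is uniformly close to a polynomial in the real and imaginary parts of the coordinates.\<close>

lemma trig_poly_dense_unit_cell:
  fixes G :: "real^'n^'n"
  assumes G: "det G \<noteq> 0" and A [measurable]: "A \<in> sets borel" and e: "e > 0"
  shows "\<exists>p. trig_poly (int_lattice G) p \<and>
    (\<integral>\<^sup>+\<xi>. ennreal ((norm (indicator A \<xi> - p \<xi>))\<^sup>2) * indicator (unit_cell (dual_lattice_matrix G)) \<xi> \<partial>lborel) < ennreal e"
proof -
  let ?H = "dual_lattice_matrix G"
  let ?T = "unit_cell ?H"
  have H: "det ?H \<noteq> 0" using det_dual_lattice_matrix[OF G] by auto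
  define m where "m = \<bar>det ?H\<bar>"
  have emT: "emeasure lborel ?T = ennreal m" unfolding m_def by (rule emeasure_unit_cell[OF H])
  define T' where "T' = {\<xi>. \<forall>i. 0 < (transpose G *v \<xi>) $ i \<and> (transpose G *v \<xi>) $ i < 1}"
  have T_alt: "?T = {\<xi>. \<forall>i. 0 \<le> (transpose G *v \<xi>) $ i \<and> (transpose G *v \<xi>) $ i < 1}"
    unfolding unit_cell_def dual_lattice_transpose_cancel(3)[OF G] ..
  have cont: "continuous_on UNIV (\<lambda>\<xi>. (transpose G *v \<xi>) $ i)" for i
    by (intro continuous_intros linear_continuous_on) (simp add: linear_linear matrix_vector_mul_linear del: transpose_matrix_vector)
  have "T' = (\<Inter>i. {\<xi>. 0 < (transpose G *v \<xi>) $ i} \<inter> {\<xi>. (transpose G *v \<xi>) $ i < 1})" by (auto simp: T'_def)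
  also have "open \<dots>" by (intro open_INT ballI open_Int open_Collect_less continuous_on_const cont finite)
  finally have T': "open T'" .
  have T'T: "AE \<xi> in lborel. \<xi> \<in> ?T \<longrightarrow> \<xi> \<in> T'"
  proof -
    have "AE \<xi> in lborel. \<forall>i\<in>UNIV. (transpose G *v \<xi>) $ i \<noteq> 0"
    proof (rule AE_finite_allI[OF finite])
      fix i :: 'n
      have ax: "G *v axis i 1 \<noteq> 0"
      proof
        assume "G *v axis i 1 = 0"
        then have "axis i (1::real) = 0" using matrix_inv_cancel(1)[OF G, of "axis i 1"] by simp
        then show False by (simp add: axis_eq_0_iff)
      qed
      have eq: "(transpose G *v \<xi>) $ i = (G *v axis i 1) \<bullet> \<xi>" for \<xi>
      proof -
        have "(G *v axis i 1) \<bullet> \<xi> = \<xi> \<bullet> (G *v axis i 1)" by (rule inner_commute)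
        also have "\<dots> = (\<xi> v* G) \<bullet> axis i 1" by (rule dot_lmul_matrix[symmetric])
        finally show ?thesis by (simp add: inner_axis)
      qed
      have "negligible {\<xi>. (G *v axis i 1) \<bullet> \<xi> = 0}" using ax by (intro negligible_hyperplane) auto
      then have "AE \<xi> in lebesgue. \<not> (G *v axis i 1) \<bullet> \<xi> = 0"
        by (subst AE_iff_null) (auto simp: negligible_iff_null_sets)
      then show "AE \<xi> in lborel. (transpose G *v \<xi>) $ i \<noteq> 0" unfolding eq by (simp add: AE_completion_iff)
    qed
    then show ?thesis
      by (rule AE_mp) (intro AE_I2 impI, auto simp: T_alt T'_def less_le simp del: transpose_matrix_vector)
  qed
  define A' where "A' = A \<inter> T'"
  have [measurable]: "T' \<in> sets borel" using T' by simp
  have A' [measurable]: "A' \<in> sets borel" unfolding A'_def by measurable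
  define \<delta> where "\<delta> = e / 8"
  have \<delta>: "\<delta> > 0" using e by (simp add: \<delta>_def)
  obtain U where U: "open U" "A' \<subseteq> U" "emeasure lborel (U - A') < ennreal \<delta>"
    using outer_regular_lborel[OF A' \<delta>] by blast
  obtain V where V: "open V" "- A' \<subseteq> V" "emeasure lborel (V - (- A')) < ennreal \<delta>"
    using outer_regular_lborel[of "- A'" \<delta>] \<delta> A' by (metis borel_comp)
  \<comment> \<open>Outside \<open>N\<close> a point lies in \<open>A'\<close> and off \<open>V\<close>, where the Urysohn function is \<open>1\<close>, or off \<open>U\<close>, where it is \<open>0\<close>.\<close>
  define N where "N = (U - A') \<union> (V - (- A'))"
  have [measurable]: "U \<in> sets borel" "V \<in> sets borel" using U V by auto
  have Nm [measurable]: "N \<in> sets borel" unfolding N_def by measurable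
  have N: "emeasure lborel N \<le> ennreal (2 * \<delta>)"
  proof -
    have "emeasure lborel N \<le> emeasure lborel (U - A') + emeasure lborel (V - (- A'))"
      unfolding N_def by (rule emeasure_subadditive) measurable
    also have "\<dots> \<le> ennreal \<delta> + ennreal \<delta>" using U(3) V(3) by (intro add_mono less_imp_le)
    also have "\<dots> = ennreal (2 * \<delta>)" using \<delta> by (simp flip: ennreal_plus)
    finally show ?thesis .
  qed
  have "closed (- V)" "closed (- (U \<inter> T'))" "- V \<inter> - (U \<inter> T') = {}"
    using V(1,2) U(1,2) T' by (auto simp: A'_def)
  then obtain f :: "real^'n \<Rightarrow> real" where f: "continuous_on UNIV f" "\<And>x. f x \<in> closed_segment 1 0"
    "\<And>x. x \<in> - V \<Longrightarrow> f x = 1" "\<And>x. x \<in> - (U \<inter> T') \<Longrightarrow> f x = 0"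
    using Urysohn[of "- V" "- (U \<inter> T')" "1::real" 0] by metis
  have f01: "0 \<le> f x" "f x \<le> 1" for x using f(2)[of x] by (auto simp: closed_segment_eq_real_ivl split: if_splits)
  have fA: "\<bar>indicator A x - f x\<bar> \<le> indicator N x" if "x \<in> T'" for x
  proof -
    have "x \<in> A" if "x \<notin> V" using V(2) that unfolding A'_def by blast
    then have "x \<in> - V \<Longrightarrow> indicator A x = (1::real)" by simp
    moreover have "x \<notin> A" if "x \<notin> U" using U(2) \<open>x \<in> T'\<close> that unfolding A'_def by blast
    then have "x \<notin> U \<Longrightarrow> indicator A x = (0::real)" by simp
    moreover have "x \<in> N" if "x \<in> V" "x \<in> U" using that by (auto simp: N_def)
    moreover have "\<bar>indicator A x - f x\<bar> \<le> 1" using f01[of x] by (auto split: split_indicator)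
    ultimately show ?thesis using f(3,4)[of x] by (cases "x \<in> V"; cases "x \<in> U") auto
  qed
  \<comment> \<open>The error is at most \<open>2 * (2 * \<delta>) + 2 * \<eta>\<^sup>2 * m \<le> e / 2 + e / 4\<close>.\<close>
  define \<eta> where "\<eta> = sqrt (e / (8 * (m + 1)))"
  have m0: "m \<ge> 0" by (simp add: m_def)
  have \<eta>: "\<eta> > 0" "\<eta>\<^sup>2 = e / (8 * (m + 1))" using e m0 by (auto simp: \<eta>_def)
  have "\<exists>q. continuous_on (torus ` cbox 0 1) q \<and> (\<forall>x\<in>cbox 0 1. q (torus x) = f (?H *v x))"
  proof (rule continuous_torus_lift)
    show "continuous_on (cbox 0 1) (\<lambda>x. f (?H *v x))"
      by (rule continuous_on_compose2[OF f(1)]) (auto intro!: linear_continuous_on simp: linear_linear)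
    fix x :: "real^'n" and i assume "x $ i = 0 \<or> x $ i = 1"
    then have "?H *v x \<notin> T'"
      unfolding T'_def mem_Collect_eq dual_lattice_transpose_cancel(2)[OF G] by (metis less_irrefl)
    then show "f (?H *v x) = 0" by (intro f(4)) auto
  qed
  then obtain q where q: "continuous_on (torus ` cbox 0 1) q" "\<And>x. x \<in> cbox 0 1 \<Longrightarrow> q (torus x) = f (?H *v x)" by blast
  have "compact (torus ` (cbox 0 1 :: (real^'n) set))" by (intro compact_continuous_image continuous_torus compact_cbox)
  from Stone_Weierstrass_real_polynomial_function[OF this q(1) \<eta>(1)]
  obtain r where r: "real_polynomial_function r" "\<And>z. z \<in> torus ` cbox 0 1 \<Longrightarrow> \<bar>q z - r z\<bar> < \<eta>" by metis
  define p where "p \<xi> = complex_of_real (r (torus (transpose G *v \<xi>)))" for \<xi>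
  have p: "trig_poly (int_lattice G) p" unfolding p_def by (rule trig_poly_of_real_polynomial[OF r(1)])
  note [measurable] = measurable_trig_poly[OF p]
  have fp: "\<bar>f \<xi> - r (torus (transpose G *v \<xi>))\<bar> < \<eta>" if "\<xi> \<in> ?T" for \<xi>
  proof -
    have "transpose G *v \<xi> \<in> cbox 0 1" using that by (auto simp: T_alt mem_box_cart less_imp_le simp del: transpose_matrix_vector)
    then show ?thesis using q(2)[of "transpose G *v \<xi>"] r(2)[of "torus (transpose G *v \<xi>)"]
      unfolding dual_lattice_transpose_cancel(1)[OF G] by (metis imageI)
  qed
  have bound: "(norm (indicator A \<xi> - p \<xi>))\<^sup>2 \<le> 2 * indicator N \<xi> + 2 * \<eta>\<^sup>2" if "\<xi> \<in> ?T" "\<xi> \<in> T'" for \<xi>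
  proof -
    let ?r = "r (torus (transpose G *v \<xi>))"
    have "norm (indicator A \<xi> - p \<xi>) = \<bar>indicator A \<xi> - ?r\<bar>"
    proof -
      have "indicator A \<xi> - p \<xi> = complex_of_real (indicator A \<xi> - ?r)" by (simp add: p_def split: split_indicator)
      then show ?thesis by (simp only: norm_of_real)
    qed
    also have "\<dots> \<le> indicator N \<xi> + \<eta>" using fA[OF that(2)] fp[OF that(1)] by linarith
    finally have "(norm (indicator A \<xi> - p \<xi>))\<^sup>2 \<le> (indicator N \<xi> + \<eta>)\<^sup>2" by (intro power_mono) auto
    also have "\<dots> \<le> 2 * (indicator N \<xi>)\<^sup>2 + 2 * \<eta>\<^sup>2"
      using sum_squares_bound[of "indicator N \<xi>" \<eta>] by (simp add: power2_sum)
    also have "(indicator N \<xi>)\<^sup>2 = (indicator N \<xi> :: real)" by (simp split: split_indicator)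
    finally show ?thesis .
  qed
  have "(\<integral>\<^sup>+\<xi>. ennreal ((norm (indicator A \<xi> - p \<xi>))\<^sup>2) * indicator ?T \<xi> \<partial>lborel)
      \<le> (\<integral>\<^sup>+\<xi>. 2 * indicator N \<xi> + ennreal (2 * \<eta>\<^sup>2) * indicator ?T \<xi> \<partial>lborel)"
  proof (rule nn_integral_mono_AE, rule AE_mp[OF T'T], intro AE_I2 impI)
    fix \<xi> assume "\<xi> \<in> ?T \<longrightarrow> \<xi> \<in> T'"
    then show "ennreal ((norm (indicator A \<xi> - p \<xi>))\<^sup>2) * indicator ?T \<xi> \<le> 2 * indicator N \<xi> + ennreal (2 * \<eta>\<^sup>2) * indicator ?T \<xi>"
    proof (cases "\<xi> \<in> ?T")
      case True
      then have "ennreal ((norm (indicator A \<xi> - p \<xi>))\<^sup>2) \<le> ennreal (2 * indicator N \<xi> + 2 * \<eta>\<^sup>2)"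
        using bound \<open>\<xi> \<in> ?T \<longrightarrow> \<xi> \<in> T'\<close> by (intro ennreal_leI) blast
      also have "\<dots> = 2 * indicator N \<xi> + ennreal (2 * \<eta>\<^sup>2)"
        by (subst ennreal_plus) (auto split: split_indicator)
      finally show ?thesis using True by simp
    qed simp
  qed
  also have "\<dots> = 2 * emeasure lborel N + ennreal (2 * \<eta>\<^sup>2) * ennreal m"
    by (subst nn_integral_add) (auto simp: nn_integral_cmult emT)
  also have "\<dots> \<le> 2 * ennreal (2 * \<delta>) + ennreal (2 * \<eta>\<^sup>2) * ennreal m"
    by (intro add_mono mult_left_mono N) auto
  also have "\<dots> = ennreal (4 * \<delta> + 2 * \<eta>\<^sup>2 * m)"
    using \<delta> m0 by (simp add: ennreal_mult[symmetric] ennreal_plus[symmetric] ennreal_numeral[symmetric] del: ennreal_plus ennreal_numeral)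
  also have "\<dots> < ennreal e"
  proof (rule ennreal_lessI[OF e])
    have "2 * \<eta>\<^sup>2 * m \<le> e / 4" using e m0 unfolding \<eta>(2) by (simp add: field_simps)
    then show "4 * \<delta> + 2 * \<eta>\<^sup>2 * m < e" using e by (simp add: \<delta>_def)
  qed
  finally show ?thesis using p by blast
qed

text \<open>Saturate \<open>E\<close> under the lattice. The difference between the indicator of the saturation and a
  trigonometric polynomial is periodic, so its square has the same integral over \<Omega> as over the unit
  cell; and the saturation meets the transversal \<Omega> only in \<open>E\<close>.\<close>

lemma trig_poly_dense_transversal:
  fixes G :: "real^'n^'n"
  assumes G: "det G \<noteq> 0" and [measurable]: "\<Omega> \<in> sets borel"
    and T: "transversal (lattice_rel (dual_lattice_matrix G)) UNIV \<Omega>"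
    and E [measurable]: "E \<in> sets borel" and E\<Omega>: "E \<subseteq> \<Omega>" and e: "e > 0"
  shows "\<exists>p. trig_poly (int_lattice G) p \<and>
    (\<integral>\<^sup>+\<xi>. ennreal ((norm (indicator E \<xi> - p \<xi>))\<^sup>2) * indicator \<Omega> \<xi> \<partial>lborel) < ennreal e"
proof -
  let ?H = "dual_lattice_matrix G"
  let ?T = "unit_cell ?H"
  define S where "S = saturation (lattice_rel ?H) E"
  have [measurable]: "S \<in> sets borel" unfolding S_def by (rule sets_lattice_saturation) measurable
  have H: "det ?H \<noteq> 0" using det_dual_lattice_matrix[OF G] by auto
  obtain p where p: "trig_poly (int_lattice G) p"
    and pT: "(\<integral>\<^sup>+\<xi>. ennreal ((norm (indicator S \<xi> - p \<xi>))\<^sup>2) * indicator ?T \<xi> \<partial>lborel) < ennreal e"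
    using trig_poly_dense_unit_cell[OF G _ e, of S] by auto
  note [measurable] = measurable_trig_poly[OF p]
  have pp: "periodic ?H p" using p
    by induction (use wave_periodic[OF G] in \<open>auto simp: periodic_def\<close>)
  have S: "x + l \<in> S \<longleftrightarrow> x \<in> S" if "l \<in> int_lattice ?H" for x l
  proof
    assume "x + l \<in> S"
    then obtain y where "y \<in> E" "x + l - y \<in> int_lattice ?H" by (auto simp: S_def saturation_def lattice_rel_def)
    then show "x \<in> S" using lattice_add[OF _ lattice_minus[OF that], of "x + l - y"]
      by (auto simp: S_def saturation_def lattice_rel_def intro!: bexI[of _ y])
  next
    assume "x \<in> S"
    then obtain y where "y \<in> E" "x - y \<in> int_lattice ?H" by (auto simp: S_def saturation_def lattice_rel_def)
    then show "x + l \<in> S" using lattice_add[OF _ that, of "x - y"]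
      by (auto simp: S_def saturation_def lattice_rel_def algebra_simps intro!: bexI[of _ y])
  qed
  have SE: "x \<in> S \<longleftrightarrow> x \<in> E" if "x \<in> \<Omega>" for x
  proof
    assume "x \<in> S"
    then obtain y where y: "y \<in> E" "lattice_rel ?H y x" by (auto simp: S_def saturation_def)
    have "packing (lattice_rel ?H) \<Omega>"
      by (rule transversal_packing[OF T]) (simp add: lattice_rel_def)
    then have "y = x" using y that E\<Omega> by (auto simp: packing_def)
    then show "x \<in> E" using y by simp
  qed (auto simp: S_def saturation_def lattice_rel_def intro!: bexI[of _ x])
  let ?F = "\<lambda>\<xi>. ennreal ((norm (indicator S \<xi> - p \<xi>))\<^sup>2)"
  have "(\<integral>\<^sup>+\<xi>. ennreal ((norm (indicator E \<xi> - p \<xi>))\<^sup>2) * indicator \<Omega> \<xi> \<partial>lborel) = (\<integral>\<^sup>+\<xi>. ?F \<xi> * indicator \<Omega> \<xi> \<partial>lborel)"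
    by (intro nn_integral_cong) (use SE in \<open>auto split: split_indicator\<close>)
  also have "\<dots> = (\<integral>\<^sup>+\<xi>. ?F \<xi> * indicator ?T \<xi> \<partial>lborel)"
    by (rule transversal_nn_integral[OF _ _ _ T unit_cell_transversal[OF H]])
       (use pp S in \<open>auto simp: periodic_def indicator_def\<close>)
  finally show ?thesis using p pT by auto
qed

section \<open>Approximation in the mean and inversion\<close>

definition sqint :: "(real^'n \<Rightarrow> complex) \<Rightarrow> bool" where
  "sqint f \<longleftrightarrow> f \<in> borel_measurable borel \<and> integrable lborel (\<lambda>x. (norm (f x))\<^sup>2)"

lemma sqintD:
  assumes "sqint f"
  shows "f \<in> borel_measurable borel" "integrable lborel (\<lambda>x. (norm (f x))\<^sup>2)"
  using assms by (auto simp: sqint_def)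

lemma norm_add_sq_le: "(norm (a + b :: complex))\<^sup>2 \<le> 2 * (norm a)\<^sup>2 + 2 * (norm b)\<^sup>2"
proof -
  have "(norm (a + b))\<^sup>2 \<le> (norm a + norm b)\<^sup>2" by (intro power_mono norm_triangle_ineq) simp
  also have "\<dots> \<le> 2 * (norm a)\<^sup>2 + 2 * (norm b)\<^sup>2"
    using sum_squares_bound[of "norm a" "norm b"] by (simp add: power2_sum)
  finally show ?thesis .
qed

lemma sqint_add:
  assumes "sqint f" "sqint g"
  shows "sqint (\<lambda>x. f x + g x)"
    and "(\<integral>x. (norm (f x + g x))\<^sup>2 \<partial>lborel) \<le> 2 * (\<integral>x. (norm (f x))\<^sup>2 \<partial>lborel) + 2 * (\<integral>x. (norm (g x))\<^sup>2 \<partial>lborel)"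
proof -
  note [measurable] = sqintD(1)[OF assms(1)] sqintD(1)[OF assms(2)]
  have i: "integrable lborel (\<lambda>x. 2 * (norm (f x))\<^sup>2 + 2 * (norm (g x))\<^sup>2)"
    using sqintD(2)[OF assms(1)] sqintD(2)[OF assms(2)] by simp
  have s: "integrable lborel (\<lambda>x. (norm (f x + g x))\<^sup>2)"
    by (rule Bochner_Integration.integrable_bound[OF i]) (use norm_add_sq_le in auto)
  then show "sqint (\<lambda>x. f x + g x)" by (simp add: sqint_def)
  have "(\<integral>x. (norm (f x + g x))\<^sup>2 \<partial>lborel) \<le> (\<integral>x. 2 * (norm (f x))\<^sup>2 + 2 * (norm (g x))\<^sup>2 \<partial>lborel)"
    by (rule integral_mono[OF s i]) (rule norm_add_sq_le)
  then show "(\<integral>x. (norm (f x + g x))\<^sup>2 \<partial>lborel) \<le> 2 * (\<integral>x. (norm (f x))\<^sup>2 \<partial>lborel) + 2 * (\<integral>x. (norm (g x))\<^sup>2 \<partial>lborel)"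
    using sqintD(2)[OF assms(1)] sqintD(2)[OF assms(2)] by simp
qed

lemma sqint_scale:
  assumes "sqint f"
  shows "sqint (\<lambda>x. c * f x)"
  using assms by (auto simp: sqint_def norm_mult power_mult_distrib)

lemma sqint_diff: "sqint f \<Longrightarrow> sqint g \<Longrightarrow> sqint (\<lambda>x. f x - g x)"
  using sqint_add(1)[of f "\<lambda>x. (- 1) * g x"] sqint_scale[of g "- 1"] by simp

lemma sqint_zero: "sqint (\<lambda>x. 0)" by (simp add: sqint_def)

lemma sqint_bounded_integrable: "bounded_integrable f \<Longrightarrow> sqint f"
  by (simp add: sqint_def bounded_integrable_sq bounded_integrableD)

lemma sqint_fourier: "bounded_integrable f \<Longrightarrow> sqint (fourier f)"
  by (simp add: sqint_def fourier_sq_integrable measurable_fourier bounded_integrableD)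

lemma bounded_integrable_indicator:
  assumes "E \<in> sets borel" "emeasure lborel E < \<infinity>"
  shows "bounded_integrable (indicator E)"
  unfolding bounded_integrable_def
  using assms by (auto intro!: integrable_complex_indicator exI[of _ 1] simp: indicator_def)

lemma bounded_integrable_scale:
  assumes "bounded_integrable f"
  shows "bounded_integrable (\<lambda>x. c * f x)"
proof -
  obtain B where "\<And>x. norm (f x) \<le> B" using assms by (auto simp: bounded_integrable_def)
  then have "\<And>x. norm (c * f x) \<le> norm c * B" by (simp add: norm_mult mult_left_mono)
  then show ?thesis using assms by (auto simp: bounded_integrable_def)
qed

lemma bounded_integrable_add:
  assumes "bounded_integrable f" "bounded_integrable g"
  shows "bounded_integrable (\<lambda>x. f x + g x)"
proof -
  obtain B C where "\<And>x. norm (f x) \<le> B" "\<And>x. norm (g x) \<le> C" using assms by (auto simp: bounded_integrable_def)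
  then have "\<And>x. norm (f x + g x) \<le> B + C" by (meson add_mono norm_triangle_le)
  then show ?thesis using assms by (auto simp: bounded_integrable_def)
qed

text \<open>A square integrable function is the limit in the mean of simple functions, since a sequence of simple
  functions with \<open>norm (F i x) \<le> 2 * norm (f x)\<close> converges with a
  square integrable bound. The level sets of nonzero values have finite measure.\<close>

lemma sqint_induct [consumes 1, case_names indicator add scale closed]:
  fixes f :: "real^'n \<Rightarrow> complex"
  assumes f: "sqint f"
    and ind: "\<And>E. E \<in> sets borel \<Longrightarrow> emeasure lborel E < \<infinity> \<Longrightarrow> P (indicator E)"
    and add: "\<And>f g. sqint f \<Longrightarrow> sqint g \<Longrightarrow> P f \<Longrightarrow> P g \<Longrightarrow> P (\<lambda>x. f x + g x)"
    and scale: "\<And>f c. sqint f \<Longrightarrow> P f \<Longrightarrow> P (\<lambda>x. c * f x)"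
    and closed: "\<And>f. sqint f \<Longrightarrow> (\<And>\<epsilon>. \<epsilon> > 0 \<Longrightarrow> \<exists>g. sqint g \<and> P g \<and> (\<integral>x. (norm (f x - g x))\<^sup>2 \<partial>lborel) < \<epsilon>) \<Longrightarrow> P f"
  shows "P f"
proof (rule closed[OF f])
  note [measurable] = sqintD(1)[OF f]
  obtain F where F: "\<And>i. simple_function lborel (F i)" "\<And>x. (\<lambda>i. F i x) \<longlonglongrightarrow> f x" "\<And>i x. norm (F i x) \<le> 2 * norm (f x)"
    using borel_measurable_implies_sequence_metric[of f lborel 0] by (auto simp: dist_norm)
  have [measurable]: "F i \<in> borel_measurable borel" for i
    using borel_measurable_simple_function[OF F(1), of i] by simp
  have sF: "sqint (F i)" for i
    unfolding sqint_def
  proof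
    show "integrable lborel (\<lambda>x. (norm (F i x))\<^sup>2)"
    proof (rule Bochner_Integration.integrable_bound)
      show "integrable lborel (\<lambda>x. 4 * (norm (f x))\<^sup>2)" using sqintD(2)[OF f] by simp
      show "AE x in lborel. norm ((norm (F i x))\<^sup>2) \<le> norm (4 * (norm (f x))\<^sup>2)"
        using power_mono[OF F(3) norm_ge_zero, of i _ 2] by (auto simp: power_mult_distrib)
    qed measurable
  qed measurable
  have PF: "P (F i)" for i
  proof -
    have fin: "finite (range (F i))" using simple_functionD(1)[OF F(1)[of i]] by simp
    have zero: "P (\<lambda>x. 0)" using ind[of "{}"] by (simp add: indicator_def[abs_def])
    let ?A = "\<lambda>y. {x. F i x = y}"
    have A: "?A y \<in> sets borel" for y by measurable
    have fA: "emeasure lborel (?A y) < \<infinity>" if "y \<noteq> 0" for y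
    proof -
      have "ennreal ((norm y)\<^sup>2) * emeasure lborel (?A y) = (\<integral>\<^sup>+x. ennreal ((norm y)\<^sup>2) * indicator (?A y) x \<partial>lborel)"
        by (simp add: nn_integral_cmult A)
      also have "\<dots> \<le> (\<integral>\<^sup>+x. ennreal ((norm (F i x))\<^sup>2) \<partial>lborel)"
        by (intro nn_integral_mono) (auto split: split_indicator)
      also have "\<dots> < \<infinity>" using sqintD(2)[OF sF[of i]] by (simp add: integrable_iff_bounded)
      finally show ?thesis using that by (auto simp: ennreal_mult_less_top)
    qed
    have sy: "sqint (\<lambda>x. y * indicator (?A y) x)" if "y \<noteq> 0" for y
      by (intro sqint_scale sqint_bounded_integrable bounded_integrable_indicator A fA that)
    have "sqint (\<lambda>x. \<Sum>y\<in>Y. y * indicator (?A y) x) \<and> P (\<lambda>x. \<Sum>y\<in>Y. y * indicator (?A y) x)"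
      if "finite Y" "0 \<notin> Y" for Y using that
    proof (induction Y)
      case empty
      then show ?case using zero sqint_zero by simp
    next
      case (insert y Y)
      then have y0: "y \<noteq> 0" by auto
      have "P (\<lambda>x. y * indicator (?A y) x)"
        by (intro scale sqint_bounded_integrable bounded_integrable_indicator ind A fA y0)
      moreover have "sqint (\<lambda>x. \<Sum>y\<in>Y. y * indicator (?A y) x) \<and> P (\<lambda>x. \<Sum>y\<in>Y. y * indicator (?A y) x)"
        using insert.IH insert.prems by blast
      ultimately show ?case
        unfolding sum.insert[OF insert.hyps] using sy[OF y0] add sqint_add(1) by blast
    qed
    from this[of "range (F i) - {0}"] fin
    have "P (\<lambda>x. \<Sum>y\<in>range (F i) - {0}. y * indicator (?A y) x)" by simp
    also have "(\<lambda>x. \<Sum>y\<in>range (F i) - {0}. y * indicator (?A y) x) = F i"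
    proof
      fix x
      have "(\<Sum>y\<in>range (F i) - {0}. y * indicator (?A y) x) = (\<Sum>y\<in>range (F i) - {0}. if y = F i x then y else 0)"
        by (intro sum.cong) (auto simp: indicator_def)
      also have "\<dots> = F i x" using fin by (simp add: sum.delta)
      finally show "(\<Sum>y\<in>range (F i) - {0}. y * indicator (?A y) x) = F i x" .
    qed
    finally show ?thesis .
  qed
  have "(\<lambda>i. \<integral>x. (norm (f x - F i x))\<^sup>2 \<partial>lborel) \<longlonglongrightarrow> (\<integral>x. 0 \<partial>(lborel :: (real^'n) measure))"
  proof (rule integral_dominated_convergence)
    show "integrable lborel (\<lambda>x. 9 * (norm (f x))\<^sup>2)" using sqintD(2)[OF f] by simp
    show "AE x in lborel. (\<lambda>i. (norm (f x - F i x))\<^sup>2) \<longlonglongrightarrow> 0"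
    proof (intro AE_I2)
      fix x
      have "(\<lambda>i. (norm (f x - F i x))\<^sup>2) \<longlonglongrightarrow> (norm (f x - f x))\<^sup>2" by (intro tendsto_intros F(2))
      then show "(\<lambda>i. (norm (f x - F i x))\<^sup>2) \<longlonglongrightarrow> 0" by simp
    qed
    show "AE x in lborel. norm ((norm (f x - F i x))\<^sup>2) \<le> 9 * (norm (f x))\<^sup>2" for i
    proof (intro AE_I2)
      fix x
      have "norm (f x - F i x) \<le> 3 * norm (f x)" using norm_triangle_ineq4[of "f x" "F i x"] F(3)[of i x] by linarith
      from power_mono[OF this norm_ge_zero, of 2]
      show "norm ((norm (f x - F i x))\<^sup>2) \<le> 9 * (norm (f x))\<^sup>2" by (simp add: power_mult_distrib)
    qed
  qed measurable
  then have lim: "(\<lambda>i. \<integral>x. (norm (f x - F i x))\<^sup>2 \<partial>lborel) \<longlonglongrightarrow> 0" by simp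
  fix \<epsilon> :: real assume "\<epsilon> > 0"
  from order_tendstoD(2)[OF lim this] obtain i where "(\<integral>x. (norm (f x - F i x))\<^sup>2 \<partial>lborel) < \<epsilon>"
    by (auto simp: eventually_sequentially)
  then show "\<exists>g. sqint g \<and> P g \<and> (\<integral>x. (norm (f x - g x))\<^sup>2 \<partial>lborel) < \<epsilon>" using sF PF by blast
qed

definition approximable :: "('i \<Rightarrow> real^'n \<Rightarrow> complex) \<Rightarrow> 'i set \<Rightarrow> (real^'n \<Rightarrow> complex) \<Rightarrow> bool" where
  "approximable e I f \<longleftrightarrow> (\<forall>\<epsilon>>0. \<exists>p. lin_comb e I p \<and> (\<integral>x. (norm (f x - p x))\<^sup>2 \<partial>lborel) < \<epsilon>)"

lemma sqint_lin_comb: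
  assumes "lin_comb e I p" "\<And>i. i \<in> I \<Longrightarrow> sqint (e i)"
  shows "sqint p"
  using assms(1) by induction (auto intro: sqint_zero sqint_scale sqint_add assms(2))

lemma approximable_add:
  assumes e: "\<And>i. i \<in> I \<Longrightarrow> sqint (e i)" and "sqint f" "sqint g" "approximable e I f" "approximable e I g"
  shows "approximable e I (\<lambda>x. f x + g x)"
  unfolding approximable_def
proof (intro allI impI)
  fix \<epsilon> :: real assume "\<epsilon> > 0"
  then have "\<epsilon> / 4 > 0" by simp
  then obtain p q where p: "lin_comb e I p" "(\<integral>x. (norm (f x - p x))\<^sup>2 \<partial>lborel) < \<epsilon> / 4"
    and q: "lin_comb e I q" "(\<integral>x. (norm (g x - q x))\<^sup>2 \<partial>lborel) < \<epsilon> / 4"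
    using assms(4,5) unfolding approximable_def by blast
  have "sqint p" "sqint q" using sqint_lin_comb e p(1) q(1) by blast+
  then have "sqint (\<lambda>x. f x - p x)" "sqint (\<lambda>x. g x - q x)"
    using assms(2,3) by (auto intro: sqint_diff)
  from sqint_add(2)[OF this] have "(\<integral>x. (norm ((f x + g x) - (p x + q x)))\<^sup>2 \<partial>lborel) < \<epsilon>"
    using p(2) q(2) by (simp add: algebra_simps)
  then show "\<exists>p. lin_comb e I p \<and> (\<integral>x. (norm ((f x + g x) - p x))\<^sup>2 \<partial>lborel) < \<epsilon>"
    using lin_comb.add[OF p(1) q(1)] by blast
qed

lemma approximable_scale:
  assumes "approximable e I f"
  shows "approximable e I (\<lambda>x. c * f x)"
  unfolding approximable_def
proof (intro allI impI)
  fix \<epsilon> :: real assume "\<epsilon> > 0"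
  define \<epsilon>' where "\<epsilon>' = \<epsilon> / ((norm c)\<^sup>2 + 1)"
  have pos: "(norm c)\<^sup>2 + 1 > 0" by (simp add: add_nonneg_pos)
  then have "\<epsilon>' > 0" using \<open>\<epsilon> > 0\<close> by (simp add: \<epsilon>'_def)
  then obtain p where p: "lin_comb e I p" "(\<integral>x. (norm (f x - p x))\<^sup>2 \<partial>lborel) < \<epsilon>'"
    using assms unfolding approximable_def by blast
  have "(\<integral>x. (norm (c * f x - c * p x))\<^sup>2 \<partial>lborel) = (norm c)\<^sup>2 * (\<integral>x. (norm (f x - p x))\<^sup>2 \<partial>lborel)"
    by (simp add: right_diff_distrib[symmetric] norm_mult power_mult_distrib)
  also have "\<dots> \<le> (norm c)\<^sup>2 * \<epsilon>'" using p(2) by (intro mult_left_mono) auto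
  also have "\<dots> < ((norm c)\<^sup>2 + 1) * \<epsilon>'" using \<open>\<epsilon>' > 0\<close> by simp
  also have "\<dots> = \<epsilon>" using pos by (simp add: \<epsilon>'_def)
  finally show "\<exists>p. lin_comb e I p \<and> (\<integral>x. (norm (c * f x - p x))\<^sup>2 \<partial>lborel) < \<epsilon>"
    using lin_comb_scale[OF p(1)] by blast
qed

lemma approximable_closed:
  assumes e: "\<And>i. i \<in> I \<Longrightarrow> sqint (e i)" and f: "sqint f"
    and close: "\<And>\<epsilon>. \<epsilon> > 0 \<Longrightarrow> \<exists>g. sqint g \<and> approximable e I g \<and> (\<integral>x. (norm (f x - g x))\<^sup>2 \<partial>lborel) < \<epsilon>"
  shows "approximable e I f"
  unfolding approximable_def
proof (intro allI impI)
  fix \<epsilon> :: real assume "\<epsilon> > 0"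
  then have e4: "\<epsilon> / 4 > 0" by simp
  obtain g where g: "sqint g" "approximable e I g" "(\<integral>x. (norm (f x - g x))\<^sup>2 \<partial>lborel) < \<epsilon> / 4"
    using close[OF e4] by blast
  obtain p where p: "lin_comb e I p" "(\<integral>x. (norm (g x - p x))\<^sup>2 \<partial>lborel) < \<epsilon> / 4"
    using g(2) e4 unfolding approximable_def by blast
  have "sqint p" using sqint_lin_comb e p(1) by blast
  then have "sqint (\<lambda>x. f x - g x)" "sqint (\<lambda>x. g x - p x)"
    using f g(1) by (auto intro: sqint_diff)
  from sqint_add(2)[OF this] have "(\<integral>x. (norm (f x - p x))\<^sup>2 \<partial>lborel) < \<epsilon>"
    using p(2) g(3) by simp
  then show "\<exists>p. lin_comb e I p \<and> (\<integral>x. (norm (f x - p x))\<^sup>2 \<partial>lborel) < \<epsilon>" using p(1) by blast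
qed

lemma approximable_by_indicators:
  assumes e: "\<And>i. i \<in> I \<Longrightarrow> sqint (e i)" and f: "sqint f"
    and ind: "\<And>E. E \<in> sets borel \<Longrightarrow> emeasure lborel E < \<infinity> \<Longrightarrow> approximable e I (indicator E)"
  shows "approximable e I f"
  using f
proof (induction rule: sqint_induct)
  case (indicator E)
  then show ?case by (rule ind)
next
  case (add f g)
  then show ?case by (intro approximable_add e)
next
  case (scale f c)
  then show ?case by (intro approximable_scale)
next
  case (closed f)
  show ?case by (rule approximable_closed[OF e closed])
qed

lemma
  fixes f :: "'a::euclidean_space \<Rightarrow> 'b::{banach, second_countable_topology}"
  assumes [measurable]: "f \<in> borel_measurable borel"
  shows integrable_reflect: "integrable lborel (\<lambda>x. f (- x)) \<longleftrightarrow> integrable lborel f"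
    and integral_reflect: "(\<integral>x. f (- x) \<partial>lborel) = (\<integral>x. f x \<partial>lborel)"
  using integrable_scale[OF assms, of "- 1"] integral_scale[OF assms, of "- 1"] by simp_all

definition inverse_fourier :: "(real^'n \<Rightarrow> complex) \<Rightarrow> real^'n \<Rightarrow> complex" where
  "inverse_fourier f x = fourier f (- x)"

lemma measurable_inverse_fourier [measurable]:
  assumes [measurable]: "f \<in> borel_measurable borel"
  shows "inverse_fourier f \<in> borel_measurable borel"
  unfolding inverse_fourier_def[abs_def] by measurable

lemma inverse_fourier_lborel:
  assumes "f \<in> borel_measurable borel"
  shows "inverse_fourier f x = (\<integral>\<xi>. f \<xi> * cis (2 * pi * (\<xi> \<bullet> x)) \<partial>lborel)"
  by (simp add: inverse_fourier_def fourier_lborel[OF assms])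

lemma sqint_inverse_fourier:
  assumes "bounded_integrable f"
  shows "sqint (inverse_fourier f)"
  using sqint_fourier[OF assms] integrable_reflect[of "\<lambda>x. (norm (fourier f x))\<^sup>2"]
  by (auto simp: sqint_def inverse_fourier_def[abs_def])

lemma plancherel_inverse:
  assumes f: "bounded_integrable f" and g: "bounded_integrable g"
  shows "(\<integral>x. inverse_fourier f x * cnj (inverse_fourier g x) \<partial>lborel) = (\<integral>\<xi>. f \<xi> * cnj (g \<xi>) \<partial>lborel)"
proof -
  note [measurable] = bounded_integrableD(1)[OF f] bounded_integrableD(1)[OF g]
  show ?thesis
    unfolding inverse_fourier_def plancherel[OF f g, symmetric]
    by (rule integral_reflect[where f = "\<lambda>x. fourier f x * cnj (fourier g x)"]) measurable
qed

lemma integral_norm_diff_sq: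
  assumes f: "sqint f" and g: "sqint g"
  shows "complex_of_real (\<integral>x. (norm (f x - g x))\<^sup>2 \<partial>lborel) =
    (\<integral>x. f x * cnj (f x) \<partial>lborel) - (\<integral>x. f x * cnj (g x) \<partial>lborel)
    - cnj (\<integral>x. f x * cnj (g x) \<partial>lborel) + (\<integral>x. g x * cnj (g x) \<partial>lborel)"
proof -
  note [measurable] = sqintD(1)[OF f] sqintD(1)[OF g]
  have i: "integrable lborel (\<lambda>x. f x * cnj (f x))" "integrable lborel (\<lambda>x. f x * cnj (g x))"
     "integrable lborel (\<lambda>x. g x * cnj (f x))" "integrable lborel (\<lambda>x. g x * cnj (g x))"
    using f g by (auto intro!: integrable_sq_mult simp: sqint_def)
  have "complex_of_real (\<integral>x. (norm (f x - g x))\<^sup>2 \<partial>lborel) = (\<integral>x. complex_of_real ((norm (f x - g x))\<^sup>2) \<partial>lborel)"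
    by (rule integral_complex_of_real[symmetric])
  also have "\<dots> = (\<integral>x. f x * cnj (f x) - f x * cnj (g x) - g x * cnj (f x) + g x * cnj (g x) \<partial>lborel)"
    unfolding complex_norm_square by (simp add: algebra_simps)
  also have "\<dots> = (\<integral>x. f x * cnj (f x) \<partial>lborel) - (\<integral>x. f x * cnj (g x) \<partial>lborel)
    - (\<integral>x. g x * cnj (f x) \<partial>lborel) + (\<integral>x. g x * cnj (g x) \<partial>lborel)"
    using i by simp
  also have "(\<integral>x. g x * cnj (f x) \<partial>lborel) = (\<integral>x. cnj (f x * cnj (g x)) \<partial>lborel)"
    by (simp add: mult.commute del: Bochner_Integration.integral_cnj)
  also have "\<dots> = cnj (\<integral>x. f x * cnj (g x) \<partial>lborel)" by (rule Bochner_Integration.integral_cnj)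
  finally show ?thesis .
qed

text \<open>Expand both squares: the norms agree by Plancherel and the mixed terms by the multiplication formula.
  The identity makes it unnecessary to give a meaning to the inverse transform of \<open>fourier f\<close>, which
  need not be integrable.\<close>

lemma fourier_duality:
  assumes f: "bounded_integrable f" and p: "bounded_integrable p"
  shows "(\<integral>x. (norm (f x - inverse_fourier p x))\<^sup>2 \<partial>lborel) = (\<integral>\<xi>. (norm (fourier f \<xi> - p \<xi>))\<^sup>2 \<partial>lborel)"
proof -
  note [measurable] = bounded_integrableD(1)[OF f] bounded_integrableD(1)[OF p]
  have cp: "integrable lborel (\<lambda>\<xi>. cnj (p \<xi>))" using bounded_integrableD(2)[OF p] by simp
  have "fourier (\<lambda>\<xi>. cnj (p \<xi>)) x = cnj (inverse_fourier p x)" for x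
    by (subst fourier_lborel, measurable, subst inverse_fourier_lborel, measurable, subst Bochner_Integration.integral_cnj[symmetric])
       (simp add: cis_cnj del: Bochner_Integration.integral_cnj)
  then have cross: "(\<integral>x. f x * cnj (inverse_fourier p x) \<partial>lborel) = (\<integral>\<xi>. fourier f \<xi> * cnj (p \<xi>) \<partial>lborel)"
    using fourier_multiplication_formula[OF bounded_integrableD(2)[OF f] cp] by simp
  have "complex_of_real (\<integral>x. (norm (f x - inverse_fourier p x))\<^sup>2 \<partial>lborel)
      = complex_of_real (\<integral>\<xi>. (norm (fourier f \<xi> - p \<xi>))\<^sup>2 \<partial>lborel)"
    unfolding integral_norm_diff_sq[OF sqint_bounded_integrable[OF f] sqint_inverse_fourier[OF p]]
      integral_norm_diff_sq[OF sqint_fourier[OF f] sqint_bounded_integrable[OF p]]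
      cross plancherel[OF f f] plancherel_inverse[OF p p] ..
  then show ?thesis by (simp only: of_real_eq_iff)
qed

lemma square_integrable_sqint: "sqint f \<Longrightarrow> square_integrable f"
  unfolding sqint_def square_integrable_def
  by (auto intro: measurable_completion simp: integrable_completion)

lemma L2_norm_lborel: "f \<in> borel_measurable borel \<Longrightarrow> L2_norm f = sqrt (\<integral>x. (norm (f x))\<^sup>2 \<partial>lborel)"
  unfolding L2_norm_def by (subst integral_completion) auto

lemma L2_inner_lborel:
  assumes [measurable]: "f \<in> borel_measurable borel" "g \<in> borel_measurable borel"
  shows "L2_inner f g = (\<integral>x. f x * cnj (g x) \<partial>lborel)"
  unfolding L2_inner_def by (rule integral_completion) measurable

text \<open>The functions \<open>F k = gauss k \<cdot> inverse_fourier f\<close> are bounded and integrable and converge in the mean to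
  \<open>inverse_fourier f\<close>; by duality their transforms converge to \<open>f\<close> at the same rate.\<close>

lemma has_L2_fourier_inverse:
  fixes f :: "real^'n \<Rightarrow> complex"
  assumes f: "bounded_integrable f"
  shows "has_L2_fourier (inverse_fourier f) f"
proof -
  note [measurable] = bounded_integrableD(1)[OF f]
  define F where "F k x = complex_of_real (gauss k x) * inverse_fourier f x" for k :: nat and x
  have [measurable]: "F k \<in> borel_measurable borel" for k unfolding F_def[abs_def] by measurable
  define B where "B = (\<integral>x. norm (f x) \<partial>lborel)"
  have B: "norm (inverse_fourier f x) \<le> B" for x
    unfolding inverse_fourier_def B_def by (rule norm_fourier_le) measurable
  have F: "bounded_integrable (F k)" for k
    unfolding bounded_integrable_def
  proof (intro conjI exI allI)
    show "integrable lborel (F k)"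
      unfolding F_def[abs_def] by (rule integrable_bounded_mult(1)[where B = B]) (auto simp: B integrable_gauss)
    have B0: "B \<ge> 0" unfolding B_def by simp
    fix x
    have "norm (F k x) = gauss k x * norm (inverse_fourier f x)"
      by (simp add: F_def norm_mult abs_of_pos[OF gauss_bounds(1)])
    also have "\<dots> \<le> 1 * B" using B B0 gauss_bounds(2) by (intro mult_mono) auto
    finally show "norm (F k x) \<le> B" by simp
  qed measurable
  have si: "sqint (inverse_fourier f)" by (rule sqint_inverse_fourier[OF f])
  have "(\<lambda>k. \<integral>x. (norm (F k x - inverse_fourier f x))\<^sup>2 \<partial>lborel) \<longlonglongrightarrow> (\<integral>x. 0 \<partial>(lborel :: (real^'n) measure))"
  proof (rule integral_dominated_convergence)
    show "integrable lborel (\<lambda>x. (norm (inverse_fourier f x))\<^sup>2)" using si by (simp add: sqint_def)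
    have eq: "F k x - inverse_fourier f x = (complex_of_real (gauss k x) - 1) * inverse_fourier f x" for k x
      by (simp add: F_def algebra_simps)
    show "AE x in lborel. (\<lambda>k. (norm (F k x - inverse_fourier f x))\<^sup>2) \<longlonglongrightarrow> 0"
    proof (intro AE_I2)
      fix x :: "real^'n"
      have "(\<lambda>k. (norm ((complex_of_real (gauss k x) - 1) * inverse_fourier f x))\<^sup>2)
          \<longlonglongrightarrow> (norm ((complex_of_real 1 - 1) * inverse_fourier f x))\<^sup>2"
        by (intro tendsto_intros gauss_tendsto)
      then show "(\<lambda>k. (norm (F k x - inverse_fourier f x))\<^sup>2) \<longlonglongrightarrow> 0" by (simp add: eq)
    qed
    show "AE x in lborel. norm ((norm (F k x - inverse_fourier f x))\<^sup>2) \<le> (norm (inverse_fourier f x))\<^sup>2" for k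
    proof (intro AE_I2)
      fix x :: "real^'n"
      have "norm (complex_of_real (gauss k x) - 1) = \<bar>gauss k x - 1\<bar>"
        by (metis norm_of_real of_real_1 of_real_diff)
      also have "\<dots> \<le> 1" using gauss_bounds(1,2)[of k x] by linarith
      finally have "norm (F k x - inverse_fourier f x) \<le> norm (inverse_fourier f x)"
        unfolding eq norm_mult by (intro mult_left_le_one_le) auto
      then show "norm ((norm (F k x - inverse_fourier f x))\<^sup>2) \<le> (norm (inverse_fourier f x))\<^sup>2"
        by (simp add: power_mono)
    qed
  qed measurable
  then have lim: "(\<lambda>k. \<integral>x. (norm (F k x - inverse_fourier f x))\<^sup>2 \<partial>lborel) \<longlonglongrightarrow> 0" by simp
  have sq: "(\<lambda>k. sqrt (h k)) \<longlonglongrightarrow> 0" if "h \<longlonglongrightarrow> 0" for h :: "nat \<Rightarrow> real"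
    using tendsto_real_sqrt[OF that] by simp
  show ?thesis
    unfolding has_L2_fourier_def
  proof (intro exI[of _ F] conjI allI)
    show "integrable lebesgue (F k)" for k
      using bounded_integrableD(2)[OF F] by (simp add: integrable_completion)
    show "L2_tendsto F (inverse_fourier f)"
      unfolding L2_tendsto_def
      using sq[OF lim] F si by (simp add: L2_norm_lborel square_integrable_sqint sqint_bounded_integrable)
    show "L2_tendsto (\<lambda>k. fourier (F k)) f"
      unfolding L2_tendsto_def
      using sq[OF lim[unfolded fourier_duality[OF F f]]] F f
      by (simp add: L2_norm_lborel square_integrable_sqint sqint_bounded_integrable sqint_fourier)
  qed
qed

section \<open>Wavelets from tilings\<close>

(* Below, products with a transposed matrix stay in the form in which the tiling hypotheses are stated. *)
declare transpose_matrix_vector [simp del]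

lemma inner_transpose: "(transpose M *v x) \<bullet> y = x \<bullet> ((M :: real^'n^'n) *v y)"
  by (simp add: dot_lmul_matrix transpose_matrix_vector)

lemma transpose_matrix_inv_cancel:
  assumes "det (d :: real^'n^'n) \<noteq> 0"
  shows "transpose (matrix_inv d) *v (transpose d *v x) = x" "transpose d *v (transpose (matrix_inv d) *v x) = x"
  unfolding matrix_vector_mul_assoc matrix_transpose_mul[symmetric] matrix_inv_mult[OF assms]
  by (simp_all add: transpose_mat)

lemma nn_integral_transpose_inv:
  fixes d :: "real^'n^'n"
  assumes d: "det d \<noteq> 0" and [measurable]: "F \<in> borel_measurable borel"
  shows "(\<integral>\<^sup>+\<eta>. F (transpose (matrix_inv d) *v \<eta>) \<partial>lborel) = ennreal \<bar>det d\<bar> * (\<integral>\<^sup>+\<xi>. F \<xi> \<partial>lborel)"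
proof -
  have "(\<integral>\<^sup>+\<eta>. F (transpose (matrix_inv d) *v \<eta>) \<partial>lborel)
      = ennreal \<bar>det (transpose d)\<bar> * (\<integral>\<^sup>+\<xi>. F (transpose (matrix_inv d) *v (transpose d *v \<xi>)) \<partial>lborel)"
    by (rule nn_integral_linear[symmetric, where f = "\<lambda>\<eta>. F (transpose (matrix_inv d) *v \<eta>)"])
       (use d in \<open>simp_all add: det_transpose del: transpose_matrix_vector\<close>)
  then show ?thesis by (simp only: transpose_matrix_inv_cancel(1)[OF d] det_transpose)
qed

text \<open>The geometric conditions that make \<Omega> a wavelet set: it represents the cosets of the dual lattice, and
  its images under the transposed dilations tile space up to a null set.\<close>

locale lattice_dilation_tiling =
  fixes G :: "real^'n^'n" and \<D> :: "(real^'n^'n) set" and \<Omega> :: "(real^'n) set"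
  assumes det_G: "det G = 1"
    and countable_\<D>: "countable \<D>"
    and det_\<D>: "d \<in> \<D> \<Longrightarrow> det d \<noteq> 0"
    and sets_\<Omega> [measurable]: "\<Omega> \<in> sets borel"
    and transversal_\<Omega>: "transversal (lattice_rel (dual_lattice_matrix G)) UNIV \<Omega>"
    and disjoint: "d \<in> \<D> \<Longrightarrow> d' \<in> \<D> \<Longrightarrow> x \<in> \<Omega> \<Longrightarrow> x' \<in> \<Omega> \<Longrightarrow> transpose d *v x = transpose d' *v x' \<Longrightarrow> d = d'"
    and cover: "AE \<eta> in lborel. \<exists>d\<in>\<D>. \<exists>x\<in>\<Omega>. \<eta> = transpose d *v x"
begin

lemma det_G_nz: "det G \<noteq> 0" using det_G by simp

lemma emeasure_\<Omega>: "emeasure lborel \<Omega> = 1"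
proof -
  have "det (dual_lattice_matrix G) = 1" using det_dual_lattice_matrix[OF det_G_nz] det_G by simp
  then show ?thesis using emeasure_transversal[OF _ sets_\<Omega> transversal_\<Omega>] by simp
qed

definition \<psi> :: "real^'n \<Rightarrow> complex" where
  "\<psi> = inverse_fourier (indicator \<Omega>)"

text \<open>The Fourier transform of \<open>time_wavelet\<close> up to a reflection: a normalised character restricted to
  \<open>d\<^sup>T \<Omega>\<close>.\<close>

definition freq_wavelet :: "(real^'n^'n) \<times> (real^'n) \<Rightarrow> real^'n \<Rightarrow> complex" where
  "freq_wavelet i \<eta> = complex_of_real (1 / sqrt \<bar>det (fst i)\<bar>) * wave (matrix_inv (fst i) *v snd i) \<eta>
     * indicator \<Omega> (transpose (matrix_inv (fst i)) *v \<eta>)"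

definition time_wavelet :: "(real^'n^'n) \<times> (real^'n) \<Rightarrow> real^'n \<Rightarrow> complex" where
  "time_wavelet = (\<lambda>(d, t) x. complex_of_real (sqrt \<bar>det d\<bar>) * \<psi> (d *v x + t))"

lemma measurable_freq_wavelet [measurable]: "freq_wavelet i \<in> borel_measurable borel"
  unfolding freq_wavelet_def[abs_def] by measurable

lemma bounded_integrable_\<Omega>: "bounded_integrable (indicator \<Omega>)"
  by (rule bounded_integrable_indicator) (auto simp: emeasure_\<Omega>)

lemma bounded_integrable_freq_wavelet:
  assumes "i \<in> \<D> \<times> \<Gamma>"
  shows "bounded_integrable (freq_wavelet i)"
proof -
  define d where "d = fst i"
  have d: "det d \<noteq> 0" using assms det_\<D> by (auto simp: d_def)
  have em: "emeasure lborel {\<eta>. transpose (matrix_inv d) *v \<eta> \<in> \<Omega>} < \<infinity>"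
  proof -
    have "emeasure lborel {\<eta>. transpose (matrix_inv d) *v \<eta> \<in> \<Omega>}
        = (\<integral>\<^sup>+\<eta>. indicator \<Omega> (transpose (matrix_inv d) *v \<eta>) \<partial>lborel)"
      by (subst nn_integral_indicator[symmetric], measurable) (rule nn_integral_cong, simp add: indicator_def)
    also have "\<dots> = ennreal \<bar>det d\<bar>" by (simp only: nn_integral_transpose_inv[OF d] borel_measurable_indicator sets_\<Omega> nn_integral_indicator sets_lborel emeasure_\<Omega>) simp
    finally show ?thesis by simp
  qed
  have bi: "bounded_integrable (indicator {\<eta>. transpose (matrix_inv d) *v \<eta> \<in> \<Omega>})"
    by (rule bounded_integrable_indicator[OF _ em]) measurable
  have eq: "freq_wavelet i = (\<lambda>\<eta>. indicator {\<eta>. transpose (matrix_inv d) *v \<eta> \<in> \<Omega>} \<eta> *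
      (complex_of_real (1 / sqrt \<bar>det d\<bar>) * wave (matrix_inv d *v snd i) \<eta>))"
    by (auto simp: fun_eq_iff freq_wavelet_def d_def indicator_def)
  show ?thesis
    unfolding bounded_integrable_def
  proof (intro conjI exI allI)
    show "integrable lborel (freq_wavelet i)"
      unfolding eq by (rule integrable_bounded_mult(1)[OF bounded_integrableD(2)[OF bi], where B = "1 / sqrt \<bar>det d\<bar>"])
        (auto simp: norm_mult norm_divide)
    show "norm (freq_wavelet i x) \<le> 1 / sqrt \<bar>det d\<bar>" for x
      by (auto simp: eq norm_mult norm_divide indicator_def)
  qed measurable
qed

text \<open>The change of variables \<open>\<eta> = d\<^sup>T \<xi>\<close> in the integral for the inverse transform.\<close>

lemma time_wavelet_eq:
  assumes "i \<in> \<D> \<times> \<Gamma>"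
  shows "time_wavelet i = inverse_fourier (freq_wavelet i)"
proof
  fix x
  obtain d t where i: "i = (d, t)" by (cases i)
  have d: "det d \<noteq> 0" using assms det_\<D> by (auto simp: i)
  have [measurable]: "freq_wavelet i \<in> borel_measurable borel" by measurable
  let ?f = "\<lambda>\<eta>. freq_wavelet i \<eta> * cis (2 * pi * (\<eta> \<bullet> x))"
  have "inverse_fourier (freq_wavelet i) x = (\<integral>\<eta>. ?f \<eta> \<partial>lborel)"
    by (rule inverse_fourier_lborel) measurable
  also have "\<dots> = \<bar>det (transpose d)\<bar> *\<^sub>R (\<integral>\<xi>. ?f (transpose d *v \<xi>) \<partial>lborel)"
    by (rule integral_linear[where f = ?f]) (use d in \<open>simp_all add: det_transpose\<close>)
  also have "(\<lambda>\<xi>. ?f (transpose d *v \<xi>)) = (\<lambda>\<xi>. complex_of_real (1 / sqrt \<bar>det d\<bar>) * (indicator \<Omega> \<xi> * cis (2 * pi * (\<xi> \<bullet> (d *v x + t)))))"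
  proof
    fix \<xi>
    have "(matrix_inv d *v t) \<bullet> (transpose d *v \<xi>) = \<xi> \<bullet> (d *v (matrix_inv d *v t))"
      by (subst inner_commute) (rule inner_transpose)
    then have e1: "(matrix_inv d *v t) \<bullet> (transpose d *v \<xi>) = \<xi> \<bullet> t" by (simp only: matrix_inv_cancel(2)[OF d])
    have e2: "cis (2 * pi * (\<xi> \<bullet> t)) * cis (2 * pi * (\<xi> \<bullet> (d *v x))) = cis (2 * pi * (\<xi> \<bullet> (d *v x + t)))"
      by (simp add: cis_mult inner_add_right algebra_simps)
    show "?f (transpose d *v \<xi>) = complex_of_real (1 / sqrt \<bar>det d\<bar>) * (indicator \<Omega> \<xi> * cis (2 * pi * (\<xi> \<bullet> (d *v x + t))))"
      unfolding freq_wavelet_def wave_def i fst_conv snd_conv transpose_matrix_inv_cancel(1)[OF d] e1 e2[symmetric]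
      by (simp only: inner_transpose ac_simps)
  qed
  also have "(\<integral>\<xi>. complex_of_real (1 / sqrt \<bar>det d\<bar>) * (indicator \<Omega> \<xi> * cis (2 * pi * (\<xi> \<bullet> (d *v x + t)))) \<partial>lborel)
      = complex_of_real (1 / sqrt \<bar>det d\<bar>) * \<psi> (d *v x + t)"
    unfolding \<psi>_def inverse_fourier_lborel[OF bounded_integrableD(1)[OF bounded_integrable_\<Omega>]]
    by (rule integral_mult_right_zero)
  also have "\<bar>det (transpose d)\<bar> *\<^sub>R \<dots> = complex_of_real (\<bar>det d\<bar> * (1 / sqrt \<bar>det d\<bar>)) * \<psi> (d *v x + t)"
    by (simp add: det_transpose scaleR_conv_of_real)
  also have "\<bar>det d\<bar> * (1 / sqrt \<bar>det d\<bar>) = sqrt \<bar>det d\<bar>" by (simp add: real_div_sqrt)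
  finally show "time_wavelet i x = inverse_fourier (freq_wavelet i) x" by (simp add: time_wavelet_def i)
qed

text \<open>For different dilations the supports are disjoint; for equal dilations the change of variables
  \<open>\<eta> = d\<^sup>T \<xi>\<close> leads to the integral of a character over \<Omega>.\<close>

lemma orthonormal_freq_wavelet:
  assumes i: "i \<in> \<D> \<times> int_lattice G" and j: "j \<in> \<D> \<times> int_lattice G"
  shows "(\<integral>\<eta>. freq_wavelet i \<eta> * cnj (freq_wavelet j \<eta>) \<partial>lborel) = (if i = j then 1 else 0)"
proof -
  obtain d t d' t' where ij: "i = (d, t)" "j = (d', t')" by (cases i, cases j)
  have dd: "d \<in> \<D>" "d' \<in> \<D>" "t \<in> int_lattice G" "t' \<in> int_lattice G" using i j by (auto simp: ij)
  have d: "det d \<noteq> 0" "det d' \<noteq> 0" using dd det_\<D> by auto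
  show ?thesis
  proof (cases "d = d'")
    case False
    have "freq_wavelet i \<eta> * cnj (freq_wavelet j \<eta>) = 0" for \<eta>
    proof -
      have "\<not> (transpose (matrix_inv d) *v \<eta> \<in> \<Omega> \<and> transpose (matrix_inv d') *v \<eta> \<in> \<Omega>)"
        using disjoint[OF dd(1,2)] False transpose_matrix_inv_cancel(2) d by metis
      then show ?thesis by (auto simp: freq_wavelet_def ij indicator_def simp del: transpose_matrix_vector)
    qed
    then have "(\<lambda>\<eta>. freq_wavelet i \<eta> * cnj (freq_wavelet j \<eta>)) = (\<lambda>\<eta>. 0)" by (rule ext)
    then have "(\<integral>\<eta>. freq_wavelet i \<eta> * cnj (freq_wavelet j \<eta>) \<partial>lborel) = 0" by (simp only: integral_zero)
    then show ?thesis using False by (simp add: ij)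
  next
    case True
    let ?f = "\<lambda>\<eta>. freq_wavelet i \<eta> * cnj (freq_wavelet j \<eta>)"
    have tt: "t - t' \<in> int_lattice G" using lattice_add[OF dd(3) lattice_minus[OF dd(4)]] by simp
    have "(\<integral>\<eta>. ?f \<eta> \<partial>lborel) = \<bar>det (transpose d)\<bar> *\<^sub>R (\<integral>\<xi>. ?f (transpose d *v \<xi>) \<partial>lborel)"
      by (rule integral_linear[where f = ?f]) (use d in \<open>simp_all add: det_transpose\<close>)
    also have "(\<lambda>\<xi>. ?f (transpose d *v \<xi>)) = (\<lambda>\<xi>. complex_of_real (1 / \<bar>det d\<bar>) * (wave (t - t') \<xi> * indicator \<Omega> \<xi>))"
    proof
      fix \<xi>
      have w: "wave (matrix_inv d *v s) (transpose d *v \<xi>) = wave s \<xi>" for s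
      proof -
        have "(matrix_inv d *v s) \<bullet> (transpose d *v \<xi>) = \<xi> \<bullet> (d *v (matrix_inv d *v s))"
          by (subst inner_commute) (rule inner_transpose)
        then show ?thesis unfolding wave_def by (simp only: matrix_inv_cancel(2)[OF d(1)] inner_commute)
      qed
      have e1: "complex_of_real (1 / sqrt \<bar>det d\<bar>) * complex_of_real (1 / sqrt \<bar>det d\<bar>) = complex_of_real (1 / \<bar>det d\<bar>)"
        unfolding of_real_mult[symmetric] by simp
      have e2: "wave t \<xi> * cnj (wave t' \<xi>) = wave (t - t') \<xi>"
        using wave_add_left[of t "- t'" \<xi>] by (simp add: wave_minus)
      have e3: "indicator \<Omega> \<xi> * cnj (indicator \<Omega> \<xi>) = (indicator \<Omega> \<xi> :: complex)" by (simp add: indicator_def)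
      have "?f (transpose d *v \<xi>) = (complex_of_real (1 / sqrt \<bar>det d\<bar>) * complex_of_real (1 / sqrt \<bar>det d\<bar>))
          * ((wave t \<xi> * cnj (wave t' \<xi>)) * (indicator \<Omega> \<xi> * cnj (indicator \<Omega> \<xi>)))"
        unfolding freq_wavelet_def ij True[symmetric] fst_conv snd_conv transpose_matrix_inv_cancel(1)[OF d(1)] w
          complex_cnj_mult complex_cnj_complex_of_real
        by (simp only: ac_simps)
      then show "?f (transpose d *v \<xi>) = complex_of_real (1 / \<bar>det d\<bar>) * (wave (t - t') \<xi> * indicator \<Omega> \<xi>)"
        unfolding e1 e2 e3 .
    qed
    also have "(\<integral>\<xi>. complex_of_real (1 / \<bar>det d\<bar>) * (wave (t - t') \<xi> * indicator \<Omega> \<xi>) \<partial>lborel)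
        = complex_of_real (1 / \<bar>det d\<bar>) * (\<integral>\<xi>. wave (t - t') \<xi> * indicator \<Omega> \<xi> \<partial>lborel)"
      by (rule integral_mult_right_zero)
    also have "\<bar>det (transpose d)\<bar> *\<^sub>R \<dots> = (\<integral>\<xi>. wave (t - t') \<xi> * indicator \<Omega> \<xi> \<partial>lborel)"
      using d(1) by (simp add: det_transpose scaleR_conv_of_real)
    also have "\<dots> = (if t = t' then 1 else 0)"
    proof (cases "t = t'")
      case True
      have "(\<integral>\<xi>. complex_of_real (indicator \<Omega> \<xi>) \<partial>lborel) = complex_of_real (measure lborel \<Omega>)"
        by (subst integral_complex_of_real) simp
      then have "(\<integral>\<xi>. indicator \<Omega> \<xi> \<partial>lborel) = (1::complex)"
        by (simp add: measure_def emeasure_\<Omega> indicator_def of_bool_def if_distrib[of complex_of_real] cong: if_cong)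
      then show ?thesis using True by simp
    next
      case False
      then show ?thesis using integral_wave_transversal[OF det_G_nz tt _ sets_\<Omega> transversal_\<Omega>] by simp
    qed
    finally show ?thesis using True by (simp add: ij)
  qed
qed

text \<open>Within a single image \<open>d\<^sup>T \<Omega>\<close> the question is, after a linear change of variables, the density of
  trigonometric polynomials on \<Omega>.\<close>

lemma approximable_freq_piece:
  assumes dD: "d \<in> \<D>" and [measurable]: "E \<in> sets borel"
  shows "approximable freq_wavelet (\<D> \<times> int_lattice G) (indicator (E \<inter> {\<eta>. transpose (matrix_inv d) *v \<eta> \<in> \<Omega>}))"
  unfolding approximable_def
proof (intro allI impI)
  fix \<epsilon> :: real assume "\<epsilon> > 0"
  have d: "det d \<noteq> 0" by (rule det_\<D>[OF dD])
  let ?d' = "transpose (matrix_inv d)"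
  define E' where "E' = {\<xi> \<in> \<Omega>. transpose d *v \<xi> \<in> E}"
  have E' [measurable]: "E' \<in> sets borel" unfolding E'_def by measurable
  have "\<epsilon> / \<bar>det d\<bar> > 0" using d \<open>\<epsilon> > 0\<close> by simp
  then obtain p where p: "trig_poly (int_lattice G) p"
    and lt: "(\<integral>\<^sup>+\<xi>. ennreal ((norm (indicator E' \<xi> - p \<xi>))\<^sup>2) * indicator \<Omega> \<xi> \<partial>lborel) < ennreal (\<epsilon> / \<bar>det d\<bar>)"
    using trig_poly_dense_transversal[OF det_G_nz sets_\<Omega> transversal_\<Omega> E' _ \<open>\<epsilon> / \<bar>det d\<bar> > 0\<close>]
    unfolding E'_def by blast
  note [measurable] = measurable_trig_poly[OF p]
  let ?q = "\<lambda>\<eta>. p (?d' *v \<eta>) * indicator \<Omega> (?d' *v \<eta>)"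
  have q: "lin_comb freq_wavelet (\<D> \<times> int_lattice G) ?q"
    using p
  proof induction
    case zero
    show ?case by (simp add: lin_comb.zero)
  next
    case (monomial t c)
    have "(\<lambda>\<eta>. c * wave t (?d' *v \<eta>) * indicator \<Omega> (?d' *v \<eta>)) = (\<lambda>\<eta>. (c * complex_of_real (sqrt \<bar>det d\<bar>)) * freq_wavelet (d, t) \<eta>)"
    proof
      fix \<eta>
      have "t \<bullet> (?d' *v \<eta>) = (matrix_inv d *v t) \<bullet> \<eta>"
        by (subst (1 2) inner_commute) (rule inner_transpose)
      then have w: "wave t (?d' *v \<eta>) = wave (matrix_inv d *v t) \<eta>" by (simp only: wave_def)
      have e1: "complex_of_real (sqrt \<bar>det d\<bar>) * complex_of_real (1 / sqrt \<bar>det d\<bar>) = 1"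
        unfolding of_real_mult[symmetric] using d by simp
      have "(c * complex_of_real (sqrt \<bar>det d\<bar>)) * freq_wavelet (d, t) \<eta>
          = (complex_of_real (sqrt \<bar>det d\<bar>) * complex_of_real (1 / sqrt \<bar>det d\<bar>)) * (c * wave (matrix_inv d *v t) \<eta> * indicator \<Omega> (?d' *v \<eta>))"
        unfolding freq_wavelet_def fst_conv snd_conv by (simp only: ac_simps)
      then show "c * wave t (?d' *v \<eta>) * indicator \<Omega> (?d' *v \<eta>) = (c * complex_of_real (sqrt \<bar>det d\<bar>)) * freq_wavelet (d, t) \<eta>"
        unfolding e1 w by (simp only: mult_1_left)
    qed
    then show ?case using lin_comb.monomial[of "(d, t)" "\<D> \<times> int_lattice G" freq_wavelet] monomial dD by auto
  next
    case (add p q)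
    then show ?case using lin_comb.add[OF add.IH] by (simp add: distrib_right del: transpose_matrix_vector)
  qed
  let ?h = "\<lambda>\<eta>. (norm (indicator (E \<inter> {\<eta>. ?d' *v \<eta> \<in> \<Omega>}) \<eta> - ?q \<eta>))\<^sup>2"
  have "(\<integral>\<^sup>+\<eta>. ennreal (?h \<eta>) \<partial>lborel) = (\<integral>\<^sup>+\<eta>. (\<lambda>\<xi>. ennreal ((norm (indicator E' \<xi> - p \<xi>))\<^sup>2) * indicator \<Omega> \<xi>) (?d' *v \<eta>) \<partial>lborel)"
  proof (intro nn_integral_cong)
    fix \<eta>
    show "ennreal (?h \<eta>) = (\<lambda>\<xi>. ennreal ((norm (indicator E' \<xi> - p \<xi>))\<^sup>2) * indicator \<Omega> \<xi>) (?d' *v \<eta>)"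
    proof (cases "?d' *v \<eta> \<in> \<Omega>")
      case True
      then have "?d' *v \<eta> \<in> E' \<longleftrightarrow> \<eta> \<in> E" by (simp only: E'_def mem_Collect_eq transpose_matrix_inv_cancel(2)[OF d]) simp
      then show ?thesis using True by (simp add: indicator_def del: transpose_matrix_vector)
    qed (simp del: transpose_matrix_vector)
  qed
  also have "\<dots> = ennreal \<bar>det d\<bar> * (\<integral>\<^sup>+\<xi>. ennreal ((norm (indicator E' \<xi> - p \<xi>))\<^sup>2) * indicator \<Omega> \<xi> \<partial>lborel)"
    by (rule nn_integral_transpose_inv[OF d]) measurable
  also have "\<dots> < ennreal \<bar>det d\<bar> * ennreal (\<epsilon> / \<bar>det d\<bar>)"
    using lt d by (intro ennreal_mult_strict_left_mono) auto
  also have "\<dots> = ennreal \<epsilon>" using d by (simp add: ennreal_mult'[symmetric])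
  finally have "(\<integral>\<^sup>+\<eta>. ennreal (?h \<eta>) \<partial>lborel) < ennreal \<epsilon>" .
  moreover have "(\<integral>\<eta>. ?h \<eta> \<partial>lborel) = enn2real (\<integral>\<^sup>+\<eta>. ennreal (?h \<eta>) \<partial>lborel)"
    by (rule integral_eq_nn_integral) measurable
  ultimately have "(\<integral>\<eta>. ?h \<eta> \<partial>lborel) < \<epsilon>"
    using \<open>\<epsilon> > 0\<close> by (cases "\<integral>\<^sup>+\<eta>. ennreal (?h \<eta>) \<partial>lborel" rule: ennreal_cases) (auto simp: ennreal_less_iff)
  then show "\<exists>p. lin_comb freq_wavelet (\<D> \<times> int_lattice G) p \<and>
      (\<integral>\<eta>. (norm (indicator (E \<inter> {\<eta>. ?d' *v \<eta> \<in> \<Omega>}) \<eta> - p \<eta>))\<^sup>2 \<partial>lborel) < \<epsilon>"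
    using q by blast
qed

lemma sqint_freq_wavelet: "i \<in> \<D> \<times> int_lattice G \<Longrightarrow> sqint (freq_wavelet i)"
  by (intro sqint_bounded_integrable bounded_integrable_freq_wavelet)

text \<open>The images \<open>d\<^sup>T \<Omega>\<close> exhaust a set of finite measure, so the set is approximated in the mean by its
  intersection with finitely many of them, which is a disjoint union of the pieces treated above.\<close>

lemma approximable_freq:
  assumes "sqint f"
  shows "approximable freq_wavelet (\<D> \<times> int_lattice G) f"
proof (rule approximable_by_indicators[OF sqint_freq_wavelet assms])
  fix E :: "(real^'n) set" assume E [measurable]: "E \<in> sets borel" and fin: "emeasure lborel E < \<infinity>"
  define S where "S d = {\<eta>::real^'n. transpose (matrix_inv d) *v \<eta> \<in> \<Omega>}" for d
  have [measurable]: "S d \<in> sets borel" for d unfolding S_def by measurable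
  define D where "D k = \<D> \<inter> from_nat_into \<D> ` {..<k}" for k
  have finD: "finite (D k)" for k by (simp add: D_def)
  have sub: "emeasure lborel (E \<inter> X) < \<infinity>" if "X \<in> sets borel" for X
    by (rule le_less_trans[OF emeasure_mono fin]) (use that in auto)
  define g where "g K = (indicator (E \<inter> (\<Union>d\<in>K. S d)) :: real^'n \<Rightarrow> complex)" for K
  have sg: "sqint (g K)" if "finite K" for K
    unfolding g_def using that by (intro sqint_bounded_integrable bounded_integrable_indicator sub sets.Int E sets.finite_UN) auto
  have ag: "approximable freq_wavelet (\<D> \<times> int_lattice G) (g K)" if "finite K" "K \<subseteq> \<D>" for K
    using that
  proof (induction K)
    case empty
    then show ?case
      unfolding approximable_def g_def by (auto intro!: exI[of _ "\<lambda>x. 0"] lin_comb.zero)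
  next
    case (insert d K)
    have "g (insert d K) = (\<lambda>x. indicator (E \<inter> S d) x + g K x)"
    proof
      fix x
      have "\<not> (x \<in> S d \<and> x \<in> S d')" if "d' \<in> K" for d'
      proof
        assume "x \<in> S d \<and> x \<in> S d'"
        then have "d = d'" using disjoint[of d d'] insert.prems that transpose_matrix_inv_cancel(2) det_\<D>
          unfolding S_def by (metis (no_types, lifting) insert_subset mem_Collect_eq subsetD)
        then show False using insert.hyps that by simp
      qed
      then show "g (insert d K) x = indicator (E \<inter> S d) x + g K x"
        by (auto simp: g_def indicator_def)
    qed
    moreover have "sqint (indicator (E \<inter> S d))"
      by (intro sqint_bounded_integrable bounded_integrable_indicator sub sets.Int E) measurable
    moreover have "approximable freq_wavelet (\<D> \<times> int_lattice G) (indicator (E \<inter> S d))"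
      unfolding S_def by (rule approximable_freq_piece) (use insert.prems E in auto)
    ultimately show ?case using insert approximable_add[OF sqint_freq_wavelet _ sg] by auto
  qed
  have lim: "(\<lambda>k. \<integral>x. (norm (indicator E x - g (D k) x))\<^sup>2 \<partial>lborel) \<longlonglongrightarrow> (\<integral>x. 0 \<partial>(lborel :: (real^'n) measure))"
  proof (rule integral_dominated_convergence)
    show "integrable lborel (\<lambda>x. indicator E x :: real)" using fin by simp
    show "(\<lambda>x. (norm (indicator E x - g (D k) x))\<^sup>2) \<in> borel_measurable lborel" for k
      using sqintD(1)[OF sg[OF finD[of k]]] by measurable
    show "AE x in lborel. norm ((norm (indicator E x - g (D k) x))\<^sup>2) \<le> indicator E x" for k
      by (intro AE_I2) (auto simp: g_def indicator_def)
    show "AE x in lborel. (\<lambda>k. (norm (indicator E x - g (D k) x))\<^sup>2) \<longlonglongrightarrow> 0"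
      using cover
    proof eventually_elim
      fix x assume "\<exists>d\<in>\<D>. \<exists>y\<in>\<Omega>. x = transpose d *v y"
      then obtain d y where d: "d \<in> \<D>" "y \<in> \<Omega>" "x = transpose d *v y" by blast
      then have xS: "x \<in> S d" unfolding S_def mem_Collect_eq d(3) transpose_matrix_inv_cancel(1)[OF det_\<D>[OF d(1)]] by simp
      obtain n where n: "from_nat_into \<D> n = d" using from_nat_into_surj[OF countable_\<D> d(1)] by blast
      have z: "(norm (indicator E x - g (D k) x))\<^sup>2 = 0" if "k > n" for k
      proof -
        have "d \<in> D k" using d(1) n that by (auto simp: D_def)
        then show ?thesis using xS by (auto simp: g_def indicator_def)
      qed
      have "\<forall>\<^sub>F k in sequentially. (norm (indicator E x - g (D k) x))\<^sup>2 = 0"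
        by (rule eventually_mono[OF eventually_gt_at_top[of n]]) (rule z)
      then show "(\<lambda>k. (norm (indicator E x - g (D k) x))\<^sup>2) \<longlonglongrightarrow> 0" by (rule tendsto_eventually)
    qed
  qed simp
  show "approximable freq_wavelet (\<D> \<times> int_lattice G) (indicator E)"
  proof (rule approximable_closed[OF sqint_freq_wavelet])
    show "sqint (indicator E)" by (intro sqint_bounded_integrable bounded_integrable_indicator E fin)
    fix \<epsilon> :: real assume "\<epsilon> > 0"
    then obtain k where k: "(\<integral>x. (norm (indicator E x - g (D k) x))\<^sup>2 \<partial>lborel) < \<epsilon>"
      using order_tendstoD(2)[OF lim, of \<epsilon>] by (auto simp: eventually_sequentially)
    have "D k \<subseteq> \<D>" by (auto simp: D_def)
    then show "\<exists>h. sqint h \<and> approximable freq_wavelet (\<D> \<times> int_lattice G) h \<and> (\<integral>x. (norm (indicator E x - h x))\<^sup>2 \<partial>lborel) < \<epsilon>"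
      using k sg[OF finD] ag[OF finD] by blast
  qed
qed

lemma sqint_time_wavelet: "i \<in> \<D> \<times> int_lattice G \<Longrightarrow> sqint (time_wavelet i)"
  by (simp add: time_wavelet_eq sqint_inverse_fourier bounded_integrable_freq_wavelet)

lemma lin_comb_inverse_fourier:
  assumes "lin_comb freq_wavelet (\<D> \<times> int_lattice G) p"
  shows "bounded_integrable p \<and> lin_comb time_wavelet (\<D> \<times> int_lattice G) (inverse_fourier p)"
  using assms
proof induction
  case zero
  have "inverse_fourier (\<lambda>x::real^'n. 0 :: complex) = (\<lambda>x. 0)" by (auto simp: inverse_fourier_def fourier_def)
  then show ?case by (auto simp: bounded_integrable_def intro: lin_comb.zero)
next
  case (monomial i c)
  have bi: "bounded_integrable (freq_wavelet i)" by (rule bounded_integrable_freq_wavelet[OF monomial])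
  have "inverse_fourier (\<lambda>x. c * freq_wavelet i x) = (\<lambda>x. c * time_wavelet i x)"
    unfolding time_wavelet_eq[OF monomial]
  proof
    fix x
    show "inverse_fourier (\<lambda>x. c * freq_wavelet i x) x = c * inverse_fourier (freq_wavelet i) x"
      by (subst (1 2) inverse_fourier_lborel) (auto simp: mult.assoc)
  qed
  then show ?case using bounded_integrable_scale[OF bi] lin_comb.monomial[OF monomial] by simp
next
  case (add p q)
  then have bi: "bounded_integrable p" "bounded_integrable q" by auto
  note [measurable] = bounded_integrableD(1)[OF bi(1)] bounded_integrableD(1)[OF bi(2)]
  have "inverse_fourier (\<lambda>x. p x + q x) = (\<lambda>x. inverse_fourier p x + inverse_fourier q x)"
  proof
    fix x :: "real^'n"
    have i: "integrable lborel (\<lambda>\<xi>. h \<xi> * cis (2 * pi * (\<xi> \<bullet> x)))" if "bounded_integrable h" for h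
      by (rule integrable_bounded_mult(1)[OF bounded_integrableD(2)[OF that], where B = 1]) auto
    show "inverse_fourier (\<lambda>x. p x + q x) x = inverse_fourier p x + inverse_fourier q x"
      using i[OF bi(1)] i[OF bi(2)] by (simp add: inverse_fourier_lborel distrib_right)
  qed
  then show ?case using bounded_integrable_add[OF bi] lin_comb.add add.IH by auto
qed

text \<open>An approximation of the transform of an indicator by a combination \<open>p\<close> of the \<open>freq_wavelet i\<close> is, by
  duality, an equally good approximation of the indicator by the combination \<open>inverse_fourier p\<close> of the
  wavelets.\<close>

lemma approximable_time:
  assumes "sqint f"
  shows "approximable time_wavelet (\<D> \<times> int_lattice G) f"
proof (rule approximable_by_indicators[OF sqint_time_wavelet assms])
  fix E :: "(real^'n) set" assume E: "E \<in> sets borel" "emeasure lborel E < \<infinity>"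
  have bi: "bounded_integrable (indicator E)" by (rule bounded_integrable_indicator[OF E])
  show "approximable time_wavelet (\<D> \<times> int_lattice G) (indicator E)"
    unfolding approximable_def
  proof (intro allI impI)
    fix \<epsilon> :: real assume "\<epsilon> > 0"
    then obtain p where p: "lin_comb freq_wavelet (\<D> \<times> int_lattice G) p"
      and lt: "(\<integral>\<xi>. (norm (fourier (indicator E) \<xi> - p \<xi>))\<^sup>2 \<partial>lborel) < \<epsilon>"
      using approximable_freq[OF sqint_fourier[OF bi]] unfolding approximable_def by blast
    from lin_comb_inverse_fourier[OF p] have bp: "bounded_integrable p"
      and ip: "lin_comb time_wavelet (\<D> \<times> int_lattice G) (inverse_fourier p)" by auto
    show "\<exists>p. lin_comb time_wavelet (\<D> \<times> int_lattice G) p \<and> (\<integral>x. (norm (indicator E x - p x))\<^sup>2 \<partial>lborel) < \<epsilon>"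
      using ip lt unfolding fourier_duality[OF bi bp, symmetric] by blast
  qed
qed

lemma square_integrable_borel_version:
  fixes f :: "real^'n \<Rightarrow> complex"
  assumes "square_integrable f"
  shows "\<exists>g. sqint g \<and> (AE x in lebesgue. f x = g x)"
proof -
  have f: "f \<in> borel_measurable lebesgue" "integrable lebesgue (\<lambda>x. (norm (f x))\<^sup>2)"
    using assms by (auto simp: square_integrable_def)
  obtain u where u: "u \<in> borel_measurable lborel" "AE x in lborel. Re (f x) = u x"
    using completion_ex_borel_measurable_real[of "\<lambda>x. Re (f x)" lborel] f(1) by auto
  obtain v where v: "v \<in> borel_measurable lborel" "AE x in lborel. Im (f x) = v x"
    using completion_ex_borel_measurable_real[of "\<lambda>x. Im (f x)" lborel] f(1) by auto
  define g where "g x = Complex (u x) (v x)" for x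
  have [measurable]: "u \<in> borel_measurable borel" "v \<in> borel_measurable borel" using u v by auto
  have gm: "g \<in> borel_measurable borel"
    unfolding g_def[abs_def] Complex_eq by measurable
  have "AE x in lborel. f x = g x"
    using u(2) v(2) by eventually_elim (simp add: g_def complex_eq_iff)
  then have ae: "AE x in lebesgue. f x = g x" by (rule AE_completion)
  have "integrable lebesgue (\<lambda>x. (norm (g x))\<^sup>2)"
  proof (rule integrable_cong_AE_imp[OF f(2)])
    show "(\<lambda>x. (norm (g x))\<^sup>2) \<in> borel_measurable lebesgue"
      using gm by (intro measurable_completion) measurable
    show "AE x in lebesgue. (norm (f x))\<^sup>2 = (norm (g x))\<^sup>2" using ae by eventually_elim simp
  qed
  then have "sqint g" using gm by (simp add: sqint_def integrable_completion)
  then show ?thesis using ae by blast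
qed

theorem is_wavelet_set: "wavelet_set \<D> (int_lattice G) \<Omega>"
proof -
  have "L2_orthonormal_basis (\<D> \<times> int_lattice G) time_wavelet"
    unfolding L2_orthonormal_basis_def
  proof (intro conjI ballI allI impI)
    show "square_integrable (time_wavelet i)" if "i \<in> \<D> \<times> int_lattice G" for i
      by (intro square_integrable_sqint sqint_time_wavelet that)
    show "L2_inner (time_wavelet i) (time_wavelet j) = (if i = j then 1 else 0)"
      if "i \<in> \<D> \<times> int_lattice G" "j \<in> \<D> \<times> int_lattice G" for i j
      unfolding L2_inner_lborel[OF sqintD(1)[OF sqint_time_wavelet[OF that(1)]] sqintD(1)[OF sqint_time_wavelet[OF that(2)]]]
      unfolding time_wavelet_eq[OF that(1)] time_wavelet_eq[OF that(2)]
        plancherel_inverse[OF bounded_integrable_freq_wavelet[OF that(1)] bounded_integrable_freq_wavelet[OF that(2)]]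
      by (rule orthonormal_freq_wavelet[OF that])
    fix f :: "real^'n \<Rightarrow> complex" and \<epsilon> :: real
    assume "square_integrable f" "\<epsilon> > 0"
    obtain g where g: "sqint g" "AE x in lebesgue. f x = g x"
      using square_integrable_borel_version[OF \<open>square_integrable f\<close>] by blast
    have "\<epsilon>\<^sup>2 > 0" using \<open>\<epsilon> > 0\<close> by simp
    then obtain p where p: "lin_comb time_wavelet (\<D> \<times> int_lattice G) p" "(\<integral>x. (norm (g x - p x))\<^sup>2 \<partial>lborel) < \<epsilon>\<^sup>2"
      using approximable_time[OF g(1)] unfolding approximable_def by blast
    have pm: "p \<in> borel_measurable borel" by (rule sqintD(1)[OF sqint_lin_comb[OF p(1) sqint_time_wavelet]])
    then have pl: "p \<in> borel_measurable lebesgue" by (intro measurable_completion) simp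
    have fm: "f \<in> borel_measurable lebesgue" using \<open>square_integrable f\<close> by (simp add: square_integrable_def)
    have gp [measurable]: "(\<lambda>x. g x - p x) \<in> borel_measurable borel" using pm sqintD(1)[OF g(1)] by measurable
    have gl: "(\<lambda>x. g x - p x) \<in> borel_measurable lebesgue"
      using gp by (intro measurable_completion) simp
    have "L2_norm (\<lambda>x. f x - p x) = L2_norm (\<lambda>x. g x - p x)"
      unfolding L2_norm_def
    proof (rule arg_cong[where f = sqrt], rule integral_cong_AE)
      show "(\<lambda>x. (norm (f x - p x))\<^sup>2) \<in> borel_measurable lebesgue"
        by (rule measurable_compose[OF borel_measurable_diff[OF fm pl], where g = "\<lambda>z. (norm z)\<^sup>2"]) measurable
      show "(\<lambda>x. (norm (g x - p x))\<^sup>2) \<in> borel_measurable lebesgue"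
        by (rule measurable_compose[OF gl, where g = "\<lambda>z. (norm z)\<^sup>2"]) measurable
      show "AE x in lebesgue. (norm (f x - p x))\<^sup>2 = (norm (g x - p x))\<^sup>2"
        using g(2) by eventually_elim simp
    qed
    also have "\<dots> < sqrt (\<epsilon>\<^sup>2)" unfolding L2_norm_lborel[OF gp] using p(2) by (rule real_sqrt_less_mono)
    finally have "L2_norm (\<lambda>x. f x - p x) < \<epsilon>" using \<open>\<epsilon> > 0\<close> by simp
    then show "\<exists>J c. finite J \<and> J \<subseteq> \<D> \<times> int_lattice G \<and> L2_norm (\<lambda>x. f x - (\<Sum>i\<in>J. c i * time_wavelet i x)) < \<epsilon>"
      using lin_comb_coefficients[OF p(1)] by blast
  qed
  then have "wavelet \<D> (int_lattice G) \<psi>"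
    unfolding wavelet_def time_wavelet_def \<psi>_def
    by (intro conjI square_integrable_sqint sqint_inverse_fourier bounded_integrable_\<Omega>)
  moreover have "has_L2_fourier \<psi> (indicator \<Omega>)"
    unfolding \<psi>_def by (rule has_L2_fourier_inverse[OF bounded_integrable_\<Omega>])
  moreover have "\<Omega> \<in> sets lebesgue" using sets_\<Omega> by simp
  ultimately show ?thesis unfolding wavelet_set_def by blast
qed

end

section \<open>Wavelet sets in a Weyl chamber\<close>

theorem theorem2p6:
  fixes \<Delta> S \<Gamma> :: "(real^'n) set"
    and \<alpha> \<alpha>' :: "'n \<Rightarrow> real^'n"
    and a :: "'n \<Rightarrow> real"
    and A B G :: "real^'n^'n"
    and \<D> :: "(real^'n^'n) set"
  assumes "root_system \<Delta>"
    and "simple_system \<Delta> S"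
    and "bij_betw \<alpha> UNIV S"
    and "dual_basis \<alpha> \<alpha>'"
    and "\<And>j. a j > 1"
    and "\<And>j. A *v \<alpha>' j = a j *\<^sub>R \<alpha>' j"
    and "B = transpose A"
    and "\<D> = {(B [^]\<^bsub>GL\<^esub> k) ** w | (k :: int) w. w \<in> weyl_group \<Delta>}"
    and "det G = 1"
    and "\<Gamma> = {G *v z | z. \<forall>i. z $ i \<in> \<int>}"
  shows "\<exists>\<Omega>. wavelet_set \<D> \<Gamma> \<Omega> \<and> \<Omega> \<subseteq> chamber S"
proof -
  have S: "S = range \<alpha>" using assms(3) by (simp add: bij_betw_def)
  have inj: "inj \<alpha>" using assms(3) by (simp add: bij_betw_def)
  have dual: "\<alpha> i \<bullet> \<alpha>' j = (if i = j then 1 else 0)" for i j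
    using assms(4) by (simp add: dual_basis_def)
  have coord: "(\<Sum>j\<in>UNIV. t j *\<^sub>R \<alpha>' j) \<bullet> \<alpha> i = t i" for t i
  proof -
    have "(\<Sum>j\<in>UNIV. t j *\<^sub>R \<alpha>' j) \<bullet> \<alpha> i = (\<Sum>j\<in>UNIV. t j * (\<alpha> i \<bullet> \<alpha>' j))"
      by (subst inner_commute) (simp add: inner_sum_right)
    also have "\<dots> = (\<Sum>j\<in>UNIV. if i = j then t j else 0)"
      by (intro sum.cong) (auto simp: dual)
    finally show ?thesis by simp
  qed
  have expand': "v = (\<Sum>j\<in>UNIV. (v \<bullet> \<alpha> j) *\<^sub>R \<alpha>' j)" for v
  proof -
    define w where "w = v - (\<Sum>j\<in>UNIV. (v \<bullet> \<alpha> j) *\<^sub>R \<alpha>' j)"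
    have "orthogonal w x" if "x \<in> S" for x
      using that coord by (auto simp: S w_def orthogonal_def inner_diff_left)
    then have "orthogonal w w"
      using assms(2) orthogonal_to_span[of w S w] by (auto simp: simple_system_def)
    then show ?thesis by (simp add: w_def orthogonal_def)
  qed
  have expand: "v = (\<Sum>j\<in>UNIV. (v \<bullet> \<alpha>' j) *\<^sub>R \<alpha> j)" for v
  proof -
    have "u \<bullet> v = u \<bullet> (\<Sum>j\<in>UNIV. (v \<bullet> \<alpha>' j) *\<^sub>R \<alpha> j)" for u
      by (subst expand'[of u]) (simp add: inner_sum_left inner_sum_right mult.commute inner_commute)
    then show ?thesis using vector_eq_ldot by blast
  qed
  interpret simple_roots \<Delta> \<alpha> \<alpha>'
  proof
    show "\<alpha> i \<in> \<Delta>" for i using assms(2) by (auto simp: simple_system_def S)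
    show "(\<forall>j. \<beta> \<bullet> \<alpha>' j \<ge> 0) \<or> (\<forall>j. \<beta> \<bullet> \<alpha>' j \<le> 0)" if \<beta>: "\<beta> \<in> \<Delta>" for \<beta>
    proof -
      obtain c where c: "\<beta> = (\<Sum>\<gamma>\<in>S. c \<gamma> *\<^sub>R \<gamma>)" "(\<forall>\<gamma>\<in>S. c \<gamma> \<ge> 0) \<or> (\<forall>\<gamma>\<in>S. c \<gamma> \<le> 0)"
        using assms(2) \<beta> unfolding simple_system_def by blast
      have "(\<Sum>\<gamma>\<in>S. c \<gamma> *\<^sub>R \<gamma>) = (\<Sum>i\<in>UNIV. c (\<alpha> i) *\<^sub>R \<alpha> i)"
        unfolding S by (subst sum.reindex[OF inj]) simp
      with c(1) have "\<beta> = (\<Sum>i\<in>UNIV. c (\<alpha> i) *\<^sub>R \<alpha> i)" by (rule trans)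
      then have "\<beta> \<bullet> \<alpha>' j = c (\<alpha> j)" for j
        by (simp add: inner_sum_left dual if_distrib cong: if_cong)
      then show ?thesis using c(2) by (auto simp: S)
    qed
  qed (fact assms(1) assms(4) expand)+
  interpret dilated_cone \<alpha> \<alpha>' a
    by standard (fact assms(4) expand' assms(5))+
  \<comment> \<open>In the coordinates of the chamber \<open>A\<close> is the basic dilation, and so the transposed powers of \<open>B\<close>
    are its powers.\<close>
  have A: "A *v x = dilation 1 x" for x
  proof -
    have "A *v x = A *v (\<Sum>j\<in>UNIV. (x \<bullet> \<alpha> j) *\<^sub>R \<alpha>' j)" by (subst expand'[of x]) simp
    also have "\<dots> = (\<Sum>j\<in>UNIV. (x \<bullet> \<alpha> j) *\<^sub>R (A *v \<alpha>' j))"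
      by (simp add: linear_sum[OF matrix_vector_mul_linear] matrix_vector_mult_scaleR)
    finally show ?thesis by (simp add: dilation_def assms(6) mult.commute)
  qed
  interpret GL: group "GL :: (real^'n^'n) monoid" by (rule group_GL)
  have "matrix (dilation (- 1)) ** A = mat 1"
  proof -
    have "linear (dilation (- 1))"
      by (rule linearI) (auto simp: dilation_def inner_add_left algebra_simps sum.distrib scaleR_sum_right)
    then show ?thesis
      by (simp add: matrix_eq matrix_vector_mul_assoc[symmetric] A matrix_works dilation_dilation dilation_0)
  qed
  then have "invertible A" using invertible_left_inverse by blast
  then have B: "B \<in> carrier GL" by (simp add: GL_def assms(7) transpose_invertible)
  define P where "P k = B [^]\<^bsub>GL\<^esub> k" for k :: int
  have P: "P k \<in> carrier GL" for k unfolding P_def by (rule GL.int_pow_closed[OF B])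
  have P_mult: "P (k + l) = P k ** P l" for k l
    using GL.int_pow_mult[OF B, of k l] by (simp add: P_def) (simp add: GL_def)
  have P0: "P 0 = mat 1" and P1: "P 1 = B"
    using GL.int_pow_1[OF B] by (simp_all add: P_def int_pow_def2) (simp add: GL_def)
  have tP1: "transpose (P 1) *v x = dilation 1 x" for x by (simp add: P1 assms(7) transpose_transpose A)
  have P_nat: "transpose (P (int n)) *v x = dilation (int n) x" for n x
  proof (induction n arbitrary: x)
    case 0
    then show ?case by (simp add: P0 transpose_mat dilation_0)
  next
    case (Suc n)
    have "P (int (Suc n)) = P (int n) ** P 1" by (subst P_mult[symmetric]) (simp add: add.commute)
    then show ?case
      by (simp add: matrix_transpose_mul matrix_vector_mul_assoc[symmetric] tP1 Suc dilation_dilation)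
  qed
  have tP: "transpose (P k) *v x = dilation k x" for k x
  proof (cases "k \<ge> 0")
    case True
    then show ?thesis using P_nat[of "nat k"] by simp
  next
    case False
    then obtain n where k: "k = - int n" by (metis int_cases2 le_cases neg_0_le_iff_le of_nat_0_le_iff)
    have "P (int n) ** P k = mat 1" using P_mult[of "int n" k] by (simp add: k P0)
    then have "transpose (P k) ** transpose (P (int n)) = mat 1" by (simp add: matrix_transpose_mul[symmetric] transpose_mat)
    then have "transpose (P k) *v (transpose (P (int n)) *v (dilation k x)) = dilation k x"
      by (simp add: matrix_vector_mul_assoc)
    then show ?thesis by (simp add: P_nat dilation_dilation k dilation_0)
  qed
  have detG: "det G \<noteq> 0" using assms(9) by simp
  have detH: "det (dual_lattice_matrix G) \<noteq> 0" using det_dual_lattice_matrix[OF detG] by auto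
  obtain \<Omega> where \<Omega>: "\<Omega> \<in> sets borel" "transversal dilation_rel (open_cone \<alpha>) \<Omega>"
    "transversal (lattice_rel (dual_lattice_matrix G)) UNIV \<Omega>"
    using dilation_lattice_transversal[OF detH] by blast
  have \<Omega>C: "\<Omega> \<subseteq> open_cone \<alpha>" using \<Omega>(2) by (simp add: transversal_def)
  have \<D>: "\<D> = (\<lambda>(k, w). P k ** w) ` (UNIV \<times> weyl_group \<Delta>)" unfolding assms(8) P_def by auto
  have act: "transpose (P k ** w) *v x = transpose w *v dilation k x" for k w x
    by (simp add: matrix_transpose_mul matrix_vector_mul_assoc[symmetric] tP)
  interpret lattice_dilation_tiling G \<D> \<Omega>
  proof
    show "det G = 1" by fact
    show "countable \<D>" unfolding \<D> using finite_weyl_group by (intro countable_image countable_SIGMA) (auto intro: countable_finite)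
    show "det d \<noteq> 0" if dD: "d \<in> \<D>" for d
    proof -
      obtain k w where "d = P k ** w" "w \<in> weyl_group \<Delta>" using dD by (auto simp: \<D>)
      then show ?thesis using P[of k] weyl_group_invertible by (simp add: det_mul GL_def invertible_det_nz)
    qed
    show "d = d'" if d: "d \<in> \<D>" "d' \<in> \<D>" and x: "x \<in> \<Omega>" "x' \<in> \<Omega>" and eq: "transpose d *v x = transpose d' *v x'"
      for d d' x x'
    proof -
      obtain k w k' w' where dd: "d = P k ** w" "w \<in> weyl_group \<Delta>" "d' = P k' ** w'" "w' \<in> weyl_group \<Delta>"
        using d by (auto simp: \<D>)
      have eq': "transpose w *v dilation k x = transpose w' *v dilation k' x'" using eq by (simp add: dd act)
      have cone: "dilation k x \<in> open_cone \<alpha>" "dilation k' x' \<in> open_cone \<alpha>"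
        using x \<Omega>C dilation_cone by auto
      \<comment> \<open>The chamber determines \<open>w\<close>, and then the orbit of \<open>A\<close> determines the exponent.\<close>
      have w: "w = w'" by (rule weyl_chambers_disjoint[OF dd(2,4) cone eq'])
      have "w ** transpose w = mat 1"
      proof -
        obtain bs where bs: "0 \<notin> set bs" "\<And>x. w *v x = word_act bs x" "\<And>x. transpose w *v x = word_act (rev bs) x"
          by (rule weyl_wordE[OF dd(2)]) blast
        then have "word_act bs (word_act (rev bs) x) = x" for x using word_act_rev[of "rev bs" x] by simp
        then show ?thesis by (simp add: matrix_eq matrix_vector_mul_assoc[symmetric] bs(2,3))
      qed
      then have "dilation k x = w *v (transpose w *v dilation k x)" by (simp add: matrix_vector_mul_assoc)
      also have "\<dots> = w *v (transpose w *v dilation k' x')" using eq' w by simp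
      also have "\<dots> = dilation k' x'" using \<open>w ** transpose w = mat 1\<close> by (simp add: matrix_vector_mul_assoc)
      finally have kk: "dilation k x = dilation k' x'" .
      then have "x' = dilation (- k' + k) x" by (metis dilation_dilation dilation_0 add.left_inverse)
      then have "dilation_rel x x'" by (auto simp: dilation_rel_def)
      moreover have "packing dilation_rel \<Omega>"
        by (rule transversal_packing[OF \<Omega>(2)]) (metis equivp_dilation_rel equivp_reflp)
      ultimately have "x = x'" using x by (auto simp: packing_def)
      then have "k = k'" using kk dilation_inject[of x k k'] x \<Omega>C by auto
      then show "d = d'" by (simp add: dd w)
    qed
    show "AE \<eta> in lborel. \<exists>d\<in>\<D>. \<exists>x\<in>\<Omega>. \<eta> = transpose d *v x"
      using AE_weyl_chambers
    proof eventually_elim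
      fix \<eta> assume "\<exists>w\<in>weyl_group \<Delta>. \<exists>y\<in>open_cone \<alpha>. \<eta> = transpose w *v y"
      then obtain w y where w: "w \<in> weyl_group \<Delta>" "y \<in> open_cone \<alpha>" "\<eta> = transpose w *v y" by blast
      obtain x where x: "x \<in> \<Omega>" "dilation_rel y x" using \<Omega>(2) w(2) unfolding transversal_def by blast
      then obtain k where "x = dilation k y" by (auto simp: dilation_rel_def)
      then have "y = dilation (- k) x" by (simp add: dilation_dilation dilation_0)
      then have "\<eta> = transpose (P (- k) ** w) *v x" by (simp add: act w(3))
      moreover have "P (- k) ** w \<in> \<D>" using w(1) by (auto simp: \<D>)
      ultimately show "\<exists>d\<in>\<D>. \<exists>x\<in>\<Omega>. \<eta> = transpose d *v x" using x(1) by blast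
    qed
  qed (use \<Omega> in auto)
  have "\<Gamma> = int_lattice G" by (simp add: assms(10) int_lattice_def)
  moreover have "\<Omega> \<subseteq> chamber S"
    using \<Omega>C by (auto simp: S chamber_def open_cone_def less_imp_le)
  ultimately show ?thesis using is_wavelet_set by blast
qed

end
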